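(* Let $(\pi_0,K,g)$ be the true model and $(\widehat\pi_0,\widehat K,g)$ the misspecified model, and let $\widehat E_t:=\|\Phi_{Y_{1:t}}(\pi_0)-\widehat\Phi_{Y_{1:t}}(\widehat\pi_0)\|_{\mathrm{TV}}$ for $t\ge1$, $\widehat E_0:=\|\pi_0-\widehat\pi_0\|_{\mathrm{TV}}$. For $t\ge0$ let $\varepsilon_t:=\sup_{\nu\in\mathcal P(\mathcal X)}\|K_{t+1}(\nu)-\widehat K_{t+1}(\nu)\|_{\mathrm{TV}}$, and assume $\sum_{t=0}^\infty\varepsilon_t<\infty$. Suppose furthermore that there exists a subsequence $\{t_j\}_{j\ge1}\subset\mathbb N$ such that $\lim_{j\to\infty}\|K_{t_j}\|=\kappa_\infty<1$. Then $\widehat E_t\to0$ almost surely, $\widehat E_t\to0$ in $L^1(\mathbb P)$, and $\operatorname{Var}(\widehat E_t)\to0$.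
   Context: Let $(\Omega,\mathcal F,\mathbb P)$ be a probability space, $\mathcal X\subseteq\mathbb R^{d_x}$ and $\mathcal Y\subseteq\mathbb R^{d_y}$ Borel sets, $\mathcal P(\mathcal X)$ the set of Borel probability measures on $\mathcal X$. The true state-space model $(\pi_0,K,g)$ consists of $\pi_0\in\mathcal P(\mathcal X)$, Markov kernels $K=\{K_t\}_{t\ge1}$ on $\mathcal X$, and measurable functions $g_t:\mathcal Y\times\mathcal X\to(0,\infty)$ with $\int_{\mathcal Y}g_t(y\mid x)\,dy=1$ for all $x$. States: $X_0\sim\pi_0$, $X_t\mid X_{t-1}=x\sim K_t(x,\cdot)$; observations $Y_t$ are conditionally independent given the states, with $Y_t\mid X_t=x$ having Lebesgue density $g_t(\cdot\mid x)$. The misspecified model has prior $\widehat\pi_0\in\mathcal P(\mathcal X)$, Markov kernels $\widehat K=\{\widehat K_t\}_{t\ge1}$ on $\mathcal X$ and the same likelihoods $g$. The observations $Y_t$ are generated by the true model. Write $g_{y_t}(x):=g_t(y_t\mid x)$, $\mu(f):=\int f\,d\mu$, $K_t(\mu)(A):=\int K_t(x,A)\,\mu(dx)$ (similarly $\widehat K_t(\mu)$), $U_{y_t}(\mu)(dx):=g_{y_t}(x)\,\mu(dx)/\mu(g_{y_t})$, $\Phi_{Y_t}:=U_{Y_t}\circ K_t$, $\widehat\Phi_{Y_t}:=U_{Y_t}\circ\widehat K_t$, $\Phi_{Y_{1:t}}:=\Phi_{Y_t}\circ\cdots\circ\Phi_{Y_1}$ and $\widehat\Phi_{Y_{1:t}}:=\widehat\Phi_{Y_t}\circ\cdots\circ\widehat\Phi_{Y_1}$.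 For a finite signed measure $m$, $\|m\|_{\mathrm{TV}}:=\tfrac12\big(\sup_F m(F)-\inf_F m(F)\big)$, over Borel sets $F$. Let $\mathcal D(\mathcal X):=\{\beta(\mu-\nu):\beta\in\mathbb R,\ \mu,\nu\in\mathcal P(\mathcal X)\}$ and $\|K_t\|:=\sup_{0\ne\lambda\in\mathcal D(\mathcal X)}\|K_t(\lambda)\|_{\mathrm{TV}}/\|\lambda\|_{\mathrm{TV}}$. *)

theory Defs
  imports "HOL-Probability.Probability"
begin

section \<open>Probability measures, signed measures and total variation\<close>

abbreviation borel_of_set :: "'a::topological_space set \<Rightarrow> 'a measure" where
  "borel_of_set A \<equiv> restrict_space borel A"

abbreviation borel_probs :: "'a::topological_space set \<Rightarrow> 'a measure set" where
  "borel_probs A \<equiv> space (prob_algebra (borel_of_set A))"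

text \<open>Finite signed measures are represented by their set functions
  (zero outside the sigma-algebra, as for \<^const>\<open>measure\<close>).\<close>

definition measure_diff :: "'a measure \<Rightarrow> 'a measure \<Rightarrow> 'a set \<Rightarrow> real" where
  "measure_diff \<mu> \<nu> = (\<lambda>F. measure \<mu> F - measure \<nu> F)"

definition tv_norm :: "'a measure \<Rightarrow> ('a set \<Rightarrow> real) \<Rightarrow> real" where
  "tv_norm M m = 1/2 * ((SUP F\<in>sets M. m F) - (INF F\<in>sets M. m F))"

definition signed_probs :: "'a::topological_space set \<Rightarrow> ('a set \<Rightarrow> real) set" where
  "signed_probs A =
     {(\<lambda>F. \<beta> * measure_diff \<mu> \<nu> F) | \<beta> \<mu> \<nu>. \<mu> \<in> borel_probs A \<and> \<nu> \<in> borel_probs A}"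

text \<open>The integral of \<open>f\<close> against a finite signed measure \<open>m\<close> is \<open>\<integral>f d\<mu> - \<integral>f d\<nu>\<close> for any
  representation of \<open>m\<close> as a difference of two finite measures; by \<open>signed_integral_eq\<close> below
  the value does not depend on the representation.\<close>

definition signed_integral :: "'a measure \<Rightarrow> ('a set \<Rightarrow> real) \<Rightarrow> ('a \<Rightarrow> real) \<Rightarrow> real" where
  "signed_integral M m f = (THE r. \<exists>\<mu> \<nu>.
     finite_measure \<mu> \<and> sets \<mu> = sets M \<and> finite_measure \<nu> \<and> sets \<nu> = sets M \<and>
     m = measure_diff \<mu> \<nu> \<and> r = integral\<^sup>L \<mu> f - integral\<^sup>L \<nu> f)"

lemma integral_add_measure_bounded:
  fixes f :: "'a \<Rightarrow> real"
  assumes \<mu>: "finite_measure \<mu>" "sets \<mu> = sets M"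
    and \<nu>: "finite_measure \<nu>" "sets \<nu> = sets M"
    and \<mu>': "finite_measure \<mu>'" "sets \<mu>' = sets M"
    and \<nu>': "finite_measure \<nu>'" "sets \<nu>' = sets M"
    and eq: "\<And>F. F \<in> sets M \<Longrightarrow> measure \<mu> F + measure \<nu>' F = measure \<mu>' F + measure \<nu> F"
    and f: "f \<in> borel_measurable M" "\<And>x. x \<in> space M \<Longrightarrow> \<bar>f x\<bar> \<le> B"
  shows "integral\<^sup>L \<mu> f + integral\<^sup>L \<nu>' f = integral\<^sup>L \<mu>' f + integral\<^sup>L \<nu> f"
proof -
  have sp: "space \<mu> = space M" "space \<nu> = space M" "space \<mu>' = space M" "space \<nu>' = space M"
    using \<mu> \<nu> \<mu>' \<nu>' sets_eq_imp_space_eq by blast+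
  have nn: "(\<integral>\<^sup>+x. h x \<partial>\<mu>) + (\<integral>\<^sup>+x. h x \<partial>\<nu>') = (\<integral>\<^sup>+x. h x \<partial>\<mu>') + (\<integral>\<^sup>+x. h x \<partial>\<nu>)"
    if "h \<in> borel_measurable M" for h :: "'a \<Rightarrow> ennreal"
    using that
  proof (induction rule: borel_measurable_induct)
    case (cong f g)
    have "integral\<^sup>N N f = integral\<^sup>N N g" if "space N = space M" for N
      using cong that by (intro nn_integral_cong) simp
    then show ?case using cong sp by simp
  next
    case (set A)
    have "emeasure \<mu> A + emeasure \<nu>' A = emeasure \<mu>' A + emeasure \<nu> A"
      using eq[OF set] \<mu> \<nu> \<mu>' \<nu>'
      by (simp add: finite_measure.emeasure_eq_measure flip: ennreal_plus)
    then show ?case using set \<mu> \<nu> \<mu>' \<nu>' by simp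
  next
    case (mult u c)
    have "u \<in> borel_measurable \<mu>" "u \<in> borel_measurable \<nu>" "u \<in> borel_measurable \<mu>'" "u \<in> borel_measurable \<nu>'"
      using mult \<mu> \<nu> \<mu>' \<nu>' by (simp_all cong: measurable_cong_sets)
    then show ?case using mult by (simp add: nn_integral_cmult flip: distrib_left)
  next
    case (add u v)
    have "u \<in> borel_measurable \<mu>" "u \<in> borel_measurable \<nu>" "u \<in> borel_measurable \<mu>'" "u \<in> borel_measurable \<nu>'"
      "v \<in> borel_measurable \<mu>" "v \<in> borel_measurable \<nu>" "v \<in> borel_measurable \<mu>'" "v \<in> borel_measurable \<nu>'"
      using add \<mu> \<nu> \<mu>' \<nu>' by (simp_all cong: measurable_cong_sets)
    then have "integral\<^sup>N N (\<lambda>x. v x + u x) = integral\<^sup>N N v + integral\<^sup>N N u"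
      if "N \<in> {\<mu>, \<nu>, \<mu>', \<nu>'}" for N
      using that by (auto intro!: nn_integral_add)
    then show ?case using add by (simp add: ac_simps)
  next
    case (seq U)
    have inc: "incseq (\<lambda>i. integral\<^sup>N N (U i))" for N
      using seq by (auto simp: incseq_def le_fun_def intro!: nn_integral_mono)
    have lim: "integral\<^sup>N N (SUP i. U i) = (SUP i. integral\<^sup>N N (U i))" if "sets N = sets M" for N
    proof -
      have "U i \<in> borel_measurable N" for i
        using seq(1)[of i] that by (simp cong: measurable_cong_sets)
      from nn_integral_monotone_convergence_SUP[OF \<open>incseq U\<close> this]
      moreover have "(SUP i. U i) = (\<lambda>x. SUP i. U i x)" by (simp add: fun_eq_iff image_comp)
      ultimately show ?thesis by simp
    qed
    have "(SUP i. integral\<^sup>N \<mu> (U i)) + (SUP i. integral\<^sup>N \<nu>' (U i))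
        = (SUP i. integral\<^sup>N \<mu> (U i) + integral\<^sup>N \<nu>' (U i))"
      by (rule ennreal_SUP_add[symmetric]) (rule inc)+
    also have "\<dots> = (SUP i. integral\<^sup>N \<mu>' (U i) + integral\<^sup>N \<nu> (U i))"
      using seq by simp
    also have "\<dots> = (SUP i. integral\<^sup>N \<mu>' (U i)) + (SUP i. integral\<^sup>N \<nu> (U i))"
      by (rule ennreal_SUP_add) (rule inc)+
    finally show ?case
      unfolding lim[OF \<mu>(2)] lim[OF \<nu>(2)] lim[OF \<mu>'(2)] lim[OF \<nu>'(2)] .
  qed
  have int: "integrable N f" if "finite_measure N" "sets N = sets M" for N
  proof -
    have "f \<in> borel_measurable N" using f that by (simp cong: measurable_cong_sets)
    moreover have "AE x in N. norm (f x) \<le> B"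
      using f(2) sets_eq_imp_space_eq[OF that(2)] by auto
    ultimately show ?thesis
      using finite_measure.integrable_const_bound[OF that(1)] by blast
  qed
  have pos: "integral\<^sup>L N f = enn2real (\<integral>\<^sup>+x. f x \<partial>N) - enn2real (\<integral>\<^sup>+x. - f x \<partial>N)"
       "(\<integral>\<^sup>+x. f x \<partial>N) < top" "(\<integral>\<^sup>+x. - f x \<partial>N) < top"
    if "finite_measure N" "sets N = sets M" for N
    using int[OF that] by (auto simp: real_lebesgue_integral_def real_integrable_def top.not_eq_extremum)
  have "f \<in> borel_measurable M" "(\<lambda>x. - f x) \<in> borel_measurable M" using f by auto
  then have "(\<lambda>x. ennreal (f x)) \<in> borel_measurable M" "(\<lambda>x. ennreal (- f x)) \<in> borel_measurable M"
    by measurable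
  note n = this[THEN nn]
  note e = n[THEN arg_cong[of _ _ enn2real]]
  show ?thesis
    using e pos[OF \<mu>] pos[OF \<nu>] pos[OF \<mu>'] pos[OF \<nu>'] by (simp add: enn2real_plus)
qed

lemma signed_integral_eq:
  assumes \<mu>: "finite_measure \<mu>" "sets \<mu> = sets M"
    and \<nu>: "finite_measure \<nu>" "sets \<nu> = sets M"
    and f: "f \<in> borel_measurable M" "\<And>x. x \<in> space M \<Longrightarrow> \<bar>f x\<bar> \<le> B"
  shows "signed_integral M (measure_diff \<mu> \<nu>) f = integral\<^sup>L \<mu> f - integral\<^sup>L \<nu> f"
  unfolding signed_integral_def
proof (rule the_equality)
  show "\<exists>\<mu>' \<nu>'. finite_measure \<mu>' \<and> sets \<mu>' = sets M \<and> finite_measure \<nu>' \<and> sets \<nu>' = sets M \<and>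
     measure_diff \<mu> \<nu> = measure_diff \<mu>' \<nu>' \<and>
     integral\<^sup>L \<mu> f - integral\<^sup>L \<nu> f = integral\<^sup>L \<mu>' f - integral\<^sup>L \<nu>' f"
    using \<mu> \<nu> by blast
next
  fix r
  assume "\<exists>\<mu>' \<nu>'. finite_measure \<mu>' \<and> sets \<mu>' = sets M \<and> finite_measure \<nu>' \<and> sets \<nu>' = sets M \<and>
     measure_diff \<mu> \<nu> = measure_diff \<mu>' \<nu>' \<and> r = integral\<^sup>L \<mu>' f - integral\<^sup>L \<nu>' f"
  then obtain \<mu>' \<nu>' where 1: "finite_measure \<mu>'" "sets \<mu>' = sets M" "finite_measure \<nu>'" "sets \<nu>' = sets M"
    and 2: "measure_diff \<mu> \<nu> = measure_diff \<mu>' \<nu>'" and 3: "r = integral\<^sup>L \<mu>' f - integral\<^sup>L \<nu>' f"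
    by blast
  have "measure \<mu> F + measure \<nu>' F = measure \<mu>' F + measure \<nu> F" for F
    using fun_cong[OF 2, of F] by (simp add: measure_diff_def)
  from integral_add_measure_bounded[OF \<mu> \<nu> 1 this f] 3
  show "r = integral\<^sup>L \<mu> f - integral\<^sup>L \<nu> f" by simp
qed

section \<open>Markov kernels\<close>

text \<open>The image \<open>K(\<mu>)\<close> of a measure \<open>\<mu>\<close> is \<open>\<mu> \<bind> K\<close>;
  for signed measures we need the following version.\<close>

definition kernel_signed ::
    "'a measure \<Rightarrow> ('a \<Rightarrow> 'a measure) \<Rightarrow> ('a set \<Rightarrow> real) \<Rightarrow> 'a set \<Rightarrow> real" where
  "kernel_signed M K m = (\<lambda>F. signed_integral M m (\<lambda>x. measure (K x) F))"

text \<open>The ratios are nonnegative, so inserting \<open>0\<close> only matters when there is no \<open>\<lambda> \<noteq> 0\<close>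
  (\<open>A\<close> a singleton), where it makes the supremum \<open>0\<close>.\<close>

definition kernel_norm :: "'a::topological_space set \<Rightarrow> ('a \<Rightarrow> 'a measure) \<Rightarrow> real" where
  "kernel_norm A K = Sup (insert 0
     {tv_norm (borel_of_set A) (kernel_signed (borel_of_set A) K m) / tv_norm (borel_of_set A) m | m.
        m \<in> signed_probs A \<and> m \<noteq> (\<lambda>F. 0)})"

definition kernel_dist ::
    "'a::topological_space set \<Rightarrow> ('a \<Rightarrow> 'a measure) \<Rightarrow> ('a \<Rightarrow> 'a measure) \<Rightarrow> real" where
  "kernel_dist A K L =
     (SUP \<nu>\<in>borel_probs A. tv_norm (borel_of_set A) (measure_diff (\<nu> \<bind> K) (\<nu> \<bind> L)))"

section \<open>State-space models and filters\<close>

text \<open>Kernels and likelihoods are indexed by times \<open>t \<ge> 1\<close>; index \<open>0\<close> is unconstrained and unused.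
  \<open>g t y x\<close> is \<open>g\<^sub>t(y | x)\<close>.\<close>

definition state_space_model ::
    "'x::euclidean_space set \<Rightarrow> 'y::euclidean_space set \<Rightarrow> 'x measure \<Rightarrow>
     (nat \<Rightarrow> 'x \<Rightarrow> 'x measure) \<Rightarrow> (nat \<Rightarrow> 'y \<Rightarrow> 'x \<Rightarrow> real) \<Rightarrow> bool" where
  "state_space_model \<X> \<Y> \<pi> K g \<longleftrightarrow>
     \<pi> \<in> borel_probs \<X> \<and>
     (\<forall>t\<ge>1. K t \<in> borel_of_set \<X> \<rightarrow>\<^sub>M prob_algebra (borel_of_set \<X>)) \<and>
     (\<forall>t\<ge>1. (\<lambda>(y, x). g t y x) \<in> borel_measurable (borel_of_set \<Y> \<Otimes>\<^sub>M borel_of_set \<X>)) \<and>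
     (\<forall>t\<ge>1. \<forall>y\<in>\<Y>. \<forall>x\<in>\<X>. 0 < g t y x) \<and>
     (\<forall>t\<ge>1. \<forall>x\<in>\<X>. (\<integral>\<^sup>+y. ennreal (g t y x) \<partial>restrict_space lborel \<Y>) = 1)"

text \<open>\<open>X\<close> and \<open>Y\<close> are states and observations of the model: \<open>X\<close> is a Markov chain with initial law
  \<open>\<pi>\<close> and transition kernels \<open>K\<close>, and given the whole state process the observations \<open>Y\<^sub>t\<close>, \<open>t \<ge> 1\<close>,
  are conditionally independent, \<open>Y\<^sub>t\<close> having conditional density \<open>y \<mapsto> g\<^sub>t(y | X\<^sub>t)\<close>.\<close>

definition states_upto ::
    "'w measure \<Rightarrow> 'x::topological_space set \<Rightarrow> (nat \<Rightarrow> 'w \<Rightarrow> 'x) \<Rightarrow> nat \<Rightarrow> 'w measure" where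
  "states_upto P \<X> X t =
     vimage_algebra (space P) (\<lambda>\<omega>. \<lambda>s\<in>{..t}. X s \<omega>) (Pi\<^sub>M {..t} (\<lambda>_. borel_of_set \<X>))"

definition states_all ::
    "'w measure \<Rightarrow> 'x::topological_space set \<Rightarrow> (nat \<Rightarrow> 'w \<Rightarrow> 'x) \<Rightarrow> 'w measure" where
  "states_all P \<X> X = vimage_algebra (space P) (\<lambda>\<omega> s. X s \<omega>) (Pi\<^sub>M UNIV (\<lambda>_. borel_of_set \<X>))"

definition generated_by_model ::
    "'w measure \<Rightarrow> 'x::euclidean_space set \<Rightarrow> 'y::euclidean_space set \<Rightarrow> 'x measure \<Rightarrow>
     (nat \<Rightarrow> 'x \<Rightarrow> 'x measure) \<Rightarrow> (nat \<Rightarrow> 'y \<Rightarrow> 'x \<Rightarrow> real) \<Rightarrow>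
     (nat \<Rightarrow> 'w \<Rightarrow> 'x) \<Rightarrow> (nat \<Rightarrow> 'w \<Rightarrow> 'y) \<Rightarrow> bool" where
  "generated_by_model P \<X> \<Y> \<pi> K g X Y \<longleftrightarrow>
     (\<forall>t. X t \<in> P \<rightarrow>\<^sub>M borel_of_set \<X>) \<and>
     (\<forall>t\<ge>1. Y t \<in> P \<rightarrow>\<^sub>M borel_of_set \<Y>) \<and>
     distr P (borel_of_set \<X>) (X 0) = \<pi> \<and>
     (\<forall>t\<ge>1. \<forall>A\<in>sets (borel_of_set \<X>). AE \<omega> in P.
        real_cond_exp P (states_upto P \<X> X (t - 1)) (\<lambda>\<omega>. indicator A (X t \<omega>)) \<omega>
          = measure (K t (X (t - 1) \<omega>)) A) \<and>
     (\<forall>J B. finite J \<and> (\<forall>t\<in>J. 1 \<le> t \<and> B t \<in> sets (borel_of_set \<Y>)) \<longrightarrow> (AE \<omega> in P.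
        real_cond_exp P (states_all P \<X> X) (\<lambda>\<omega>. \<Prod>t\<in>J. indicator (B t) (Y t \<omega>)) \<omega>
          = (\<Prod>t\<in>J. real_cond_exp P (states_all P \<X> X) (\<lambda>\<omega>. indicator (B t) (Y t \<omega>)) \<omega>))) \<and>
     (\<forall>t\<ge>1. \<forall>B\<in>sets (borel_of_set \<Y>). AE \<omega> in P.
        real_cond_exp P (states_all P \<X> X) (\<lambda>\<omega>. indicator B (Y t \<omega>)) \<omega>
          = measure (density (restrict_space lborel \<Y>) (\<lambda>y. ennreal (g t y (X t \<omega>)))) B)"

text \<open>If \<open>\<mu>(h)\<close> is infinite, which happens only on a null set of observations,
  \<open>bayes_update h \<mu>\<close> is the zero measure.\<close>

definition bayes_update :: "('x \<Rightarrow> real) \<Rightarrow> 'x measure \<Rightarrow> 'x measure" where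
  "bayes_update h \<mu> = density \<mu> (\<lambda>x. ennreal (h x) / (\<integral>\<^sup>+z. ennreal (h z) \<partial>\<mu>))"

primrec bayes_filter ::
    "(nat \<Rightarrow> 'x \<Rightarrow> 'x measure) \<Rightarrow> (nat \<Rightarrow> 'y \<Rightarrow> 'x \<Rightarrow> real) \<Rightarrow> (nat \<Rightarrow> 'y) \<Rightarrow>
     'x measure \<Rightarrow> nat \<Rightarrow> 'x measure" where
  "bayes_filter K g y \<pi> 0 = \<pi>"
| "bayes_filter K g y \<pi> (Suc t) =
     bayes_update (g (Suc t) (y (Suc t))) (bayes_filter K g y \<pi> t \<bind> K (Suc t))"

definition filter_error ::
    "'x::euclidean_space set \<Rightarrow> (nat \<Rightarrow> 'y \<Rightarrow> 'x \<Rightarrow> real) \<Rightarrow>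
     'x measure \<Rightarrow> (nat \<Rightarrow> 'x \<Rightarrow> 'x measure) \<Rightarrow>
     'x measure \<Rightarrow> (nat \<Rightarrow> 'x \<Rightarrow> 'x measure) \<Rightarrow> (nat \<Rightarrow> 'y) \<Rightarrow> nat \<Rightarrow> real" where
  "filter_error \<X> g \<pi> K \<pi>' K' y t =
     tv_norm (borel_of_set \<X>) (measure_diff (bayes_filter K g y \<pi> t) (bayes_filter K' g y \<pi>' t))"

end

theory Submission
  imports Defs
begin

text \<open>Prediction contracts the distance of the two filters, but a Bayes update does not: if the observation
follows the true prediction \<open>p\<close>, the expected distance of the updates of \<open>p\<close> and \<open>q\<close> can be nearly twice
the distance of \<open>p\<close> and \<open>q\<close>. (Take \<open>p = (1 - e) \<delta>\<^sub>a + e \<delta>\<^sub>b\<close> and \<open>q = (1 - e) \<delta>\<^sub>a + e \<delta>\<^sub>c\<close> with an observation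
that hardly separates \<open>a\<close> from \<open>c\<close> and nearly identifies \<open>b\<close>.) A factor \<open>2\<close> per step outweighs every
contraction whose constant exceeds \<open>1/2\<close>, so the errors themselves satisfy no useful recursion.

What behaves well is the \<^emph>\<open>excess\<close> \<open>sup\<^sub>F (a \<mu>(F) - b \<nu>(F))\<close> of one weighted measure over another. Let the
weight of the misspecified filter be multiplied by the evidence ratio \<open>q(g\<^sub>Y) / p(g\<^sub>Y)\<close> at each update.
Averaging over \<open>Y\<close> then undoes the normalisation, and because a single Hahn set of \<open>a p - b q\<close> serves all
\<open>y\<close>, the update does not increase the mean excess (\<open>integral_excess_update\<close>). A prediction increases it
by at most \<open>a \<epsilon>\<close>, and for equal weights it contracts it by \<open>\<parallel>K\<parallel>\<close> first (\<open>excess_predict\<close>,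
\<open>excess_predict_centred\<close>).

The accumulated weight \<open>\<Lambda>\<^sub>t\<close> of the misspecified filter, a likelihood ratio, is a nonnegative
supermartingale. The posterior probability \<open>u\<^sub>t = 1 / (1 + \<Lambda>\<^sub>t)\<close> of the true model is therefore almost
constant at late times, in a mean square sense (\<open>posterior_increment\<close>). Weighting both filters by
\<open>1 - u\<^sub>s\<close> makes the weights equal at time \<open>s\<close>, so that the next prediction contracts; replacing \<open>u\<^sub>s\<close> by
\<open>u\<^sub>t\<close> afterwards costs little. Hence \<open>(1 - u\<^sub>t)\<close> times the error tends to \<open>0\<close> in mean
(\<open>centred_tendsto_0\<close>).

It remains to prevent \<open>u\<^sub>t\<close> from approaching \<open>1\<close>, which can happen if the true filter charges sets that the
misspecified one neglects. This is cured by starting late. If the weight of the misspecified filter is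
raised by the current excess before each step, then every prediction contracts the excess, up to \<open>3 \<epsilon>\<close>,
although the weights differ (\<open>excess_predict_raise\<close>); so at a late time \<open>n\<close> the true filter is nearly
dominated by an integrable multiple of the other one, and it stays so. With this multiple as initial weight,
\<open>err_le_centred\<close> gives convergence in mean, \<open>err_L1\<close>.

For almost sure convergence, start at time \<open>n\<close> with weight \<open>1\<close>. The excess of either filter over the
other, summed, dominates the error and is a supermartingale up to \<open>2 \<epsilon>\<close> per step, so the maximal
inequality \<open>err_maximal\<close> bounds the probability of a large error after time \<open>n\<close> by the mean error at time
\<open>n\<close> and the remaining \<open>\<epsilon>\<close>. The variance tends to \<open>0\<close> because the error takes values in \<open>[0, 1]\<close>.

The state-space model enters through one fact, \<open>disintegration\<close>: given the earlier observations, the next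
one has the evidence of the true prediction as its density.\<close>

section \<open>The excess of one weighted measure over another\<close>

text \<open>The mass of the positive part of the signed measure \<open>a \<mu> - b \<nu>\<close>.\<close>

definition excess :: "'a measure \<Rightarrow> real \<Rightarrow> 'a measure \<Rightarrow> real \<Rightarrow> 'a measure \<Rightarrow> real" where
  "excess M a \<mu> b \<nu> = (SUP F\<in>sets M. a * measure \<mu> F - b * measure \<nu> F)"

locale subprob_pair =
  fixes M \<mu> \<nu> :: "'a measure" and a b :: real
  assumes fst_sub: "\<mu> \<in> space (subprob_algebra M)" and snd_sub: "\<nu> \<in> space (subprob_algebra M)"
    and a: "0 \<le> a" and b: "0 \<le> b"
begin

sublocale \<mu>: subprob_space \<mu> using fst_sub by (simp add: space_subprob_algebra)
sublocale \<nu>: subprob_space \<nu> using snd_sub by (simp add: space_subprob_algebra)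

lemma sets_pair [measurable_cong, simp]: "sets \<mu> = sets M" "sets \<nu> = sets M"
  using fst_sub snd_sub by (simp_all add: space_subprob_algebra)

lemma space_pair [simp]: "space \<mu> = space M" "space \<nu> = space M"
  using sets_pair sets_eq_imp_space_eq by blast+

lemma diff_le: "a * measure \<mu> F - b * measure \<nu> F \<le> a"
proof -
  have "a * measure \<mu> F \<le> a * 1" using a \<mu>.subprob_measure_le_1 by (intro mult_left_mono) auto
  moreover have "0 \<le> b * measure \<nu> F" using b by simp
  ultimately show ?thesis by linarith
qed

lemma bdd: "bdd_above ((\<lambda>F. a * measure \<mu> F - b * measure \<nu> F) ` A)"
  using diff_le by (auto intro!: bdd_aboveI)

lemma excess_upper: "F \<in> sets M \<Longrightarrow> a * measure \<mu> F - b * measure \<nu> F \<le> excess M a \<mu> b \<nu>"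
  unfolding excess_def by (intro cSUP_upper bdd)

lemma excess_nonneg: "0 \<le> excess M a \<mu> b \<nu>"
  using excess_upper[of "{}"] by simp

lemma excess_le: "excess M a \<mu> b \<nu> \<le> a"
  unfolding excess_def using diff_le by (intro cSUP_least) auto

text \<open>A positive set of the Hahn decomposition of \<open>a \<mu> - b \<nu>\<close>, with its inequalities passed on from sets to nonnegative integrands.\<close>

lemma Hahn_set:
  obtains N where "N \<in> sets M"
    and "\<And>h. h \<in> borel_measurable M \<Longrightarrow>
        ennreal b * (\<integral>\<^sup>+x\<in>N. h x \<partial>\<nu>) \<le> ennreal a * (\<integral>\<^sup>+x\<in>N. h x \<partial>\<mu>)"
    and "\<And>h. h \<in> borel_measurable M \<Longrightarrow>
        ennreal a * (\<integral>\<^sup>+x\<in>(space M - N). h x \<partial>\<mu>)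
          \<le> ennreal b * (\<integral>\<^sup>+x\<in>(space M - N). h x \<partial>\<nu>)"
proof -
  let ?A = "scale_measure (ennreal a) \<mu>" and ?B = "scale_measure (ennreal b) \<nu>"
  have fin: "finite_measure ?A" "finite_measure ?B"
    by (auto intro!: finite_measureI simp: ennreal_mult_eq_top_iff)
  have "\<exists>N\<in>sets ?A. (\<forall>X\<in>sets ?A. X \<subseteq> N \<longrightarrow> ?B X \<le> ?A X) \<and> (\<forall>X\<in>sets ?A. X \<inter> N = {} \<longrightarrow> ?A X \<le> ?B X)"
    by (rule finite_unsigned_Hahn_decomposition[OF fin]) simp
  then obtain N where N: "N \<in> sets M" "\<And>X. X \<in> sets M \<Longrightarrow> X \<subseteq> N \<Longrightarrow> ?B X \<le> ?A X"
     "\<And>X. X \<in> sets M \<Longrightarrow> X \<inter> N = {} \<Longrightarrow> ?A X \<le> ?B X"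
    by auto
  have le: "c * (\<integral>\<^sup>+x\<in>S. h x \<partial>\<rho>) \<le> d * (\<integral>\<^sup>+x\<in>S. h x \<partial>\<sigma>)"
    if S: "S \<in> sets M" and s: "sets \<rho> = sets M" "sets \<sigma> = sets M"
      and X: "\<And>X. X \<in> sets M \<Longrightarrow> X \<subseteq> S \<Longrightarrow> scale_measure c \<rho> X \<le> scale_measure d \<sigma> X"
      and h: "h \<in> borel_measurable M" for S c d \<rho> \<sigma> and h :: "'a \<Rightarrow> ennreal"
  proof -
    let ?R = "scale_measure c \<rho>" and ?S = "scale_measure d \<sigma>"
    have m: "h \<in> borel_measurable \<rho>" "h \<in> borel_measurable \<sigma>" "h \<in> borel_measurable ?R" "h \<in> borel_measurable ?S"
      using h s by (simp_all cong: measurable_cong_sets)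
    have "c * (\<integral>\<^sup>+x\<in>S. h x \<partial>\<rho>) = (\<integral>\<^sup>+x\<in>S. h x \<partial>?R)"
      using S s m by (subst nn_integral_scale_measure) (auto intro!: borel_measurable_times_ennreal)
    also have "\<dots> = (\<integral>\<^sup>+x. h x \<partial>restrict_space ?R S)"
      using S s by (subst nn_integral_restrict_space) (auto simp: sets_eq_imp_space_eq[OF s(1)])
    also have "\<dots> \<le> (\<integral>\<^sup>+x. h x \<partial>restrict_space ?S S)"
    proof (rule nn_integral_mono_measure)
      show sRS: "sets (restrict_space ?R S) = sets (restrict_space ?S S)"
        using s by (simp add: sets_restrict_space)
      have "emeasure (restrict_space ?R S) X \<le> emeasure (restrict_space ?S S) X" for X
      proof (cases "X \<in> sets (restrict_space ?R S)")
        case True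
        then have "X \<in> sets M" "X \<subseteq> S" using S s by (auto simp: sets_restrict_space_iff)
        then show ?thesis using X S s 
          by (subst (1 2) emeasure_restrict_space) (auto simp: sets_eq_imp_space_eq[OF s(1)] sets_eq_imp_space_eq[OF s(2)])
      next
        case False
        then show ?thesis using sRS by (simp add: emeasure_notin_sets)
      qed
      then show "restrict_space ?R S \<le> restrict_space ?S S"
        using sRS by (subst le_measure) (auto simp: le_fun_def)
    qed
    also have "\<dots> = (\<integral>\<^sup>+x\<in>S. h x \<partial>?S)"
      using S s by (subst nn_integral_restrict_space) (auto simp: sets_eq_imp_space_eq[OF s(2)])
    also have "\<dots> = d * (\<integral>\<^sup>+x\<in>S. h x \<partial>\<sigma>)"
      using S s m by (subst nn_integral_scale_measure) (auto intro!: borel_measurable_times_ennreal)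
    finally show ?thesis .
  qed
  show thesis
  proof (rule that[OF N(1)])
    show "ennreal b * (\<integral>\<^sup>+x\<in>N. h x \<partial>\<nu>) \<le> ennreal a * (\<integral>\<^sup>+x\<in>N. h x \<partial>\<mu>)"
      if "h \<in> borel_measurable M" for h
      by (rule le) (use N that in auto)
    show "ennreal a * (\<integral>\<^sup>+x\<in>(space M - N). h x \<partial>\<mu>)
          \<le> ennreal b * (\<integral>\<^sup>+x\<in>(space M - N). h x \<partial>\<nu>)" if "h \<in> borel_measurable M" for h
      by (rule le) (use N that in auto)
  qed
qed

text \<open>The set \<open>N\<close> maximises \<open>\<integral> h f d(a \<mu> - b \<nu>)\<close> over all \<open>f\<close> with values in \<open>[0, 1]\<close>, for every \<open>h \<ge> 0\<close>. The
inequality is rearranged into sums since the integrals may be infinite.\<close>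

definition maximising :: "'a set \<Rightarrow> bool" where
  "maximising N \<longleftrightarrow> N \<in> sets M \<and> (\<forall>h\<in>borel_measurable M. \<forall>f\<in>borel_measurable M. (\<forall>x\<in>space M. f x \<le> 1) \<longrightarrow>
        ennreal a * (\<integral>\<^sup>+x. h x * f x \<partial>\<mu>) + ennreal b * (\<integral>\<^sup>+x\<in>N. h x \<partial>\<nu>)
          \<le> ennreal a * (\<integral>\<^sup>+x\<in>N. h x \<partial>\<mu>) + ennreal b * (\<integral>\<^sup>+x. h x * f x \<partial>\<nu>))"

lemma maximisingD:
  assumes "maximising N" "h \<in> borel_measurable M" "f \<in> borel_measurable M" "\<And>x. x \<in> space M \<Longrightarrow> f x \<le> 1"
  shows "ennreal a * (\<integral>\<^sup>+x. h x * f x \<partial>\<mu>) + ennreal b * (\<integral>\<^sup>+x\<in>N. h x \<partial>\<nu>)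
          \<le> ennreal a * (\<integral>\<^sup>+x\<in>N. h x \<partial>\<mu>) + ennreal b * (\<integral>\<^sup>+x. h x * f x \<partial>\<nu>)"
  using assms unfolding maximising_def by blast

text \<open>In a Hahn decomposition, raise \<open>f\<close> to \<open>1\<close> on the positive set and lower it to \<open>0\<close> off it.\<close>

lemma maximising_ex: "\<exists>N. maximising N"
proof -
  obtain N where N[measurable]: "N \<in> sets M"
    and pos: "\<And>h. h \<in> borel_measurable M \<Longrightarrow>
        ennreal b * (\<integral>\<^sup>+x\<in>N. h x \<partial>\<nu>) \<le> ennreal a * (\<integral>\<^sup>+x\<in>N. h x \<partial>\<mu>)"
    and neg: "\<And>h. h \<in> borel_measurable M \<Longrightarrow>
        ennreal a * (\<integral>\<^sup>+x\<in>(space M - N). h x \<partial>\<mu>) \<le> ennreal b * (\<integral>\<^sup>+x\<in>(space M - N). h x \<partial>\<nu>)"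
    using Hahn_set by blast
  show ?thesis
    unfolding maximising_def
  proof (intro exI conjI ballI impI)
    show "N \<in> sets M" by (rule N)
    fix h f :: "'a \<Rightarrow> ennreal"
    assume [measurable]: "h \<in> borel_measurable M" "f \<in> borel_measurable M"
      and f1: "\<forall>x\<in>space M. f x \<le> 1"
    have split: "(\<integral>\<^sup>+x. h x * f x \<partial>\<rho>) = (\<integral>\<^sup>+x\<in>N. h x * f x \<partial>\<rho>) + (\<integral>\<^sup>+x\<in>(space M - N). h x * f x \<partial>\<rho>)"
      "(\<integral>\<^sup>+x\<in>N. h x \<partial>\<rho>) = (\<integral>\<^sup>+x\<in>N. h x * f x \<partial>\<rho>) + (\<integral>\<^sup>+x\<in>N. h x * (1 - f x) \<partial>\<rho>)"
      if [measurable_cong]: "sets \<rho> = sets M" for \<rho>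
    proof -
      have sp: "space \<rho> = space M" by (rule sets_eq_imp_space_eq) fact
      have "(\<integral>\<^sup>+x. h x * f x \<partial>\<rho>) = (\<integral>\<^sup>+x. h x * f x * indicator N x + h x * f x * indicator (space M - N) x \<partial>\<rho>)"
        using sp by (intro nn_integral_cong) (auto simp: indicator_def)
      then show "(\<integral>\<^sup>+x. h x * f x \<partial>\<rho>) = (\<integral>\<^sup>+x\<in>N. h x * f x \<partial>\<rho>) + (\<integral>\<^sup>+x\<in>(space M - N). h x * f x \<partial>\<rho>)"
        by (simp add: nn_integral_add)
      have "(\<integral>\<^sup>+x\<in>N. h x \<partial>\<rho>) = (\<integral>\<^sup>+x. h x * f x * indicator N x + h x * (1 - f x) * indicator N x \<partial>\<rho>)"
      proof (rule nn_integral_cong)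
        fix x assume "x \<in> space \<rho>"
        then have "f x + (1 - f x) = 1" using f1 sp by (intro add_diff_inverse_ennreal) auto
        then have "h x = h x * f x + h x * (1 - f x)" by (metis distrib_left mult.right_neutral)
        then show "h x * indicator N x = h x * f x * indicator N x + h x * (1 - f x) * indicator N x"
          by (auto simp: indicator_def)
      qed
      then show "(\<integral>\<^sup>+x\<in>N. h x \<partial>\<rho>) = (\<integral>\<^sup>+x\<in>N. h x * f x \<partial>\<rho>) + (\<integral>\<^sup>+x\<in>N. h x * (1 - f x) \<partial>\<rho>)"
        by (simp add: nn_integral_add)
    qed
    have "ennreal a * (\<integral>\<^sup>+x\<in>(space M - N). h x * f x \<partial>\<mu>) \<le> ennreal b * (\<integral>\<^sup>+x\<in>(space M - N). h x * f x \<partial>\<nu>)"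
      by (rule neg) measurable
    moreover have "ennreal b * (\<integral>\<^sup>+x\<in>N. h x * (1 - f x) \<partial>\<nu>) \<le> ennreal a * (\<integral>\<^sup>+x\<in>N. h x * (1 - f x) \<partial>\<mu>)"
      by (rule pos) measurable
    ultimately show "ennreal a * (\<integral>\<^sup>+x. h x * f x \<partial>\<mu>) + ennreal b * (\<integral>\<^sup>+x\<in>N. h x \<partial>\<nu>)
          \<le> ennreal a * (\<integral>\<^sup>+x\<in>N. h x \<partial>\<mu>) + ennreal b * (\<integral>\<^sup>+x. h x * f x \<partial>\<nu>)"
      unfolding split[OF sets_pair(1)] split[OF sets_pair(2)] distrib_left
      by (simp add: ac_simps add_left_mono add_mono)
  qed
qed

text \<open>Compare \<open>f\<close> with a maximising set, taking \<open>h = 1\<close>.\<close>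

lemma excess_integral:
  fixes f :: "'a \<Rightarrow> real"
  assumes f: "f \<in> borel_measurable M" and f01: "\<And>x. x \<in> space M \<Longrightarrow> 0 \<le> f x" "\<And>x. x \<in> space M \<Longrightarrow> f x \<le> 1"
  shows "a * (\<integral>x. f x \<partial>\<mu>) - b * (\<integral>x. f x \<partial>\<nu>) \<le> excess M a \<mu> b \<nu>"
proof -
  obtain N where max: "maximising N" using maximising_ex by blast
  then have N: "N \<in> sets M" by (simp add: maximising_def)
  have nn: "(\<integral>\<^sup>+x. ennreal (f x) \<partial>\<rho>) = ennreal (\<integral>x. f x \<partial>\<rho>)" "0 \<le> (\<integral>x. f x \<partial>\<rho>)"
    if "sets \<rho> = sets M" "finite_measure \<rho>" for \<rho>
  proof -
    have sp: "space \<rho> = space M" by (rule sets_eq_imp_space_eq) fact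
    have "integrable \<rho> f"
      using that f f01 sp
      by (intro finite_measure.integrable_const_bound[where B=1] AE_I2) (auto cong: measurable_cong_sets)
    then show "(\<integral>\<^sup>+x. ennreal (f x) \<partial>\<rho>) = ennreal (\<integral>x. f x \<partial>\<rho>)"
      using f01 sp by (intro nn_integral_eq_integral AE_I2) auto
    show "0 \<le> (\<integral>x. f x \<partial>\<rho>)" using f01 sp by (intro integral_nonneg_AE AE_I2) auto
  qed
  note nn\<mu> = nn[OF sets_pair(1) \<mu>.finite_measure_axioms] and nn\<nu> = nn[OF sets_pair(2) \<nu>.finite_measure_axioms]
  have "ennreal a * (\<integral>\<^sup>+x. 1 * ennreal (f x) \<partial>\<mu>) + ennreal b * (\<integral>\<^sup>+x\<in>N. 1 \<partial>\<nu>)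
      \<le> ennreal a * (\<integral>\<^sup>+x\<in>N. 1 \<partial>\<mu>) + ennreal b * (\<integral>\<^sup>+x. 1 * ennreal (f x) \<partial>\<nu>)"
    using f f01 by (intro maximisingD[OF max]) auto
  then have "ennreal (a * (\<integral>x. f x \<partial>\<mu>) + b * measure \<nu> N) \<le> ennreal (a * measure \<mu> N + b * (\<integral>x. f x \<partial>\<nu>))"
    using N a b nn\<mu> nn\<nu>
    by (simp add: \<mu>.emeasure_eq_measure \<nu>.emeasure_eq_measure ennreal_mult ennreal_plus)
  then have "a * (\<integral>x. f x \<partial>\<mu>) + b * measure \<nu> N \<le> a * measure \<mu> N + b * (\<integral>x. f x \<partial>\<nu>)"
    using a b nn\<mu> nn\<nu> by (subst (asm) ennreal_le_iff) (auto intro!: add_nonneg_nonneg)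
  then show ?thesis using excess_upper[OF N] by linarith
qed

text \<open>Split off the constant \<open>m\<close>, which sees only the total masses \<open>a\<close> and \<open>b\<close>, and rescale the rest to \<open>[0, 1]\<close>.\<close>

lemma excess_integral_osc:
  fixes f :: "'a \<Rightarrow> real"
  assumes prob: "prob_space \<mu>" "prob_space \<nu>" and f: "f \<in> borel_measurable M"
    and f01: "\<And>x. x \<in> space M \<Longrightarrow> m \<le> f x" "\<And>x. x \<in> space M \<Longrightarrow> f x \<le> m + c" and c: "0 \<le> c"
  shows "a * (\<integral>x. f x \<partial>\<mu>) - b * (\<integral>x. f x \<partial>\<nu>) \<le> c * excess M a \<mu> b \<nu> + m * (a - b)"
proof -
  note f[measurable]
  have sp: "(\<integral>x. f x \<partial>\<tau>) = (\<integral>x. f x - m \<partial>\<tau>) + m" if "sets \<tau> = sets M" "prob_space \<tau>" for \<tau>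
  proof -
    interpret prob_space \<tau> by fact
    have "integrable \<tau> f" using that f f01 sets_eq_imp_space_eq[OF that(1)]
      by (intro integrable_const_bound[where B="\<bar>m\<bar> + c"] AE_I2) (force simp: abs_le_iff cong: measurable_cong_sets)+
    then show ?thesis by (simp add: prob_space)
  qed
  have "a * (\<integral>x. f x - m \<partial>\<mu>) - b * (\<integral>x. f x - m \<partial>\<nu>) \<le> c * excess M a \<mu> b \<nu>"
  proof (cases "c = 0")
    case True
    have "(\<integral>x. f x - m \<partial>\<tau>) = (\<integral>x. 0 \<partial>\<tau>)" if "sets \<tau> = sets M" for \<tau>
      using f01 True sets_eq_imp_space_eq[OF that] by (intro Bochner_Integration.integral_cong) (auto intro: antisym)
    then show ?thesis using True by simp
  next
    case False
    with c have c: "0 < c" by simp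
    have "a * (\<integral>x. (f x - m) / c \<partial>\<mu>) - b * (\<integral>x. (f x - m) / c \<partial>\<nu>) \<le> excess M a \<mu> b \<nu>"
      using f01 c by (intro excess_integral) (auto simp: divide_simps algebra_simps)
    then show ?thesis using c by (simp add: field_simps)
  qed
  then show ?thesis using sp[OF _ prob(1)] sp[OF _ prob(2)] by (simp add: algebra_simps)
qed

end

lemma excess_least:
  assumes "\<And>F. F \<in> sets M \<Longrightarrow> a * measure \<mu> F - b * measure \<nu> F \<le> c"
  shows "excess M a \<mu> b \<nu> \<le> c"
  unfolding excess_def using assms by (intro cSUP_least) auto

lemma prob_pair:
  assumes "\<mu> \<in> space (prob_algebra M)" "\<nu> \<in> space (prob_algebra M)" "0 \<le> a" "0 \<le> b"
  shows "subprob_pair M \<mu> \<nu> a b"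
  using assms by unfold_locales (auto simp: space_prob_algebra space_subprob_algebra intro: prob_space_imp_subprob_space)

lemma excess_scale:
  assumes "subprob_pair M \<mu> \<nu> 1 1" "0 \<le> c"
  shows "excess M c \<mu> c \<nu> = c * excess M 1 \<mu> 1 \<nu>"
proof (rule antisym)
  interpret subprob_pair M \<mu> \<nu> 1 1 by fact
  interpret c: subprob_pair M \<mu> \<nu> c c by unfold_locales (use assms fst_sub snd_sub in auto)
  show "excess M c \<mu> c \<nu> \<le> c * excess M 1 \<mu> 1 \<nu>"
  proof (rule excess_least)
    fix F assume "F \<in> sets M"
    then have "c * (1 * measure \<mu> F - 1 * measure \<nu> F) \<le> c * excess M 1 \<mu> 1 \<nu>"
      using assms excess_upper by (intro mult_left_mono)
    then show "c * measure \<mu> F - c * measure \<nu> F \<le> c * excess M 1 \<mu> 1 \<nu>" by (simp add: algebra_simps)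
  qed
  show "c * excess M 1 \<mu> 1 \<nu> \<le> excess M c \<mu> c \<nu>"
  proof (cases "c = 0")
    case False
    with assms have c: "0 < c" by simp
    have "excess M 1 \<mu> 1 \<nu> \<le> excess M c \<mu> c \<nu> / c"
    proof (rule excess_least)
      fix F assume "F \<in> sets M"
      from c.excess_upper[OF this] show "1 * measure \<mu> F - 1 * measure \<nu> F \<le> excess M c \<mu> c \<nu> / c"
        using c by (simp add: field_simps)
    qed
    then show ?thesis using c by (simp add: field_simps)
  qed (use c.excess_nonneg in simp)
qed

lemma excess_reweight:
  assumes \<mu>: "\<mu> \<in> space (subprob_algebra M)" and \<nu>: "\<nu> \<in> space (subprob_algebra M)"
    and w: "0 \<le> a" "0 \<le> b" "0 \<le> a'" "0 \<le> b'"
  shows "excess M a \<mu> b \<nu> \<le> excess M a' \<mu> b' \<nu> + \<bar>a - a'\<bar> + \<bar>b - b'\<bar>"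
proof (rule excess_least)
  fix F assume F: "F \<in> sets M"
  interpret subprob_pair M \<mu> \<nu> a' b' by unfold_locales fact+
  have "(a - a') * measure \<mu> F \<le> \<bar>a - a'\<bar> * 1"
    using \<mu>.subprob_measure_le_1 by (intro mult_mono) auto
  moreover have "(b' - b) * measure \<nu> F \<le> \<bar>b - b'\<bar> * 1"
    using \<nu>.subprob_measure_le_1 by (intro mult_mono) auto
  ultimately show "a * measure \<mu> F - b * measure \<nu> F \<le> excess M a' \<mu> b' \<nu> + \<bar>a - a'\<bar> + \<bar>b - b'\<bar>"
    using excess_upper[OF F] by (simp add: algebra_simps)
qed

lemma one_minus_le_excess:
  assumes \<mu>: "\<mu> \<in> space (prob_algebra M)" and \<nu>: "\<nu> \<in> space (prob_algebra M)" and b: "0 \<le> b"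
  shows "1 - b \<le> excess M 1 \<mu> b \<nu>"
proof -
  have prob: "prob_space \<mu>" "prob_space \<nu>" using \<mu> \<nu> by (auto simp: space_prob_algebra)
  interpret subprob_pair M \<mu> \<nu> 1 b by (rule prob_pair[OF \<mu> \<nu> _ b]) simp
  show ?thesis
    using excess_upper[of "space M"] prob_space.prob_space[OF prob(1)] prob_space.prob_space[OF prob(2)] by simp
qed

text \<open>The right-hand side is the mass of the positive part plus that of the negative part of \<open>\<mu> - b \<nu>\<close>. For
\<open>b \<le> 1\<close> the positive part alone dominates the left-hand side, for \<open>b \<ge> 1\<close> the negative part does.\<close>

lemma excess_le_two_sided:
  assumes \<mu>: "\<mu> \<in> space (prob_algebra M)" and \<nu>: "\<nu> \<in> space (prob_algebra M)" and b: "0 \<le> b"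
  shows "excess M 1 \<mu> 1 \<nu> \<le> 2 * excess M 1 \<mu> b \<nu> + b - 1"
proof (rule excess_least)
  fix F assume F: "F \<in> sets M"
  have prob: "prob_space \<mu>" "prob_space \<nu>" using \<mu> \<nu> by (auto simp: space_prob_algebra)
  interpret subprob_pair M \<mu> \<nu> 1 b by (rule prob_pair[OF \<mu> \<nu> _ b]) simp
  have Z: "1 - b \<le> excess M 1 \<mu> b \<nu>" by (rule one_minus_le_excess[OF \<mu> \<nu> b])
  have "measure \<nu> F \<le> 1" by (rule \<nu>.subprob_measure_le_1)
  show "1 * measure \<mu> F - 1 * measure \<nu> F \<le> 2 * excess M 1 \<mu> b \<nu> + b - 1"
  proof (cases "b \<le> 1")
    case True
    then have "(b - 1) * measure \<nu> F \<le> 0" by (simp add: mult_nonpos_nonneg)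
    then show ?thesis using excess_upper[OF F] Z by (simp add: algebra_simps)
  next
    case False
    then have "(b - 1) * measure \<nu> F \<le> (b - 1) * 1"
      using \<nu>.subprob_measure_le_1 by (intro mult_left_mono) auto
    then show ?thesis using excess_upper[OF F] excess_nonneg by (simp add: algebra_simps)
  qed
qed

section \<open>Measurability of the excess\<close>

text \<open>Every open set between \<open>F\<close> and \<open>U\<close> is good, so one open set can be chosen for two measures.\<close>

lemma outer_regular_restrict:
  fixes X :: "'a::polish_space set"
  assumes fin: "finite_measure \<rho>" and s: "sets \<rho> = sets (borel_of_set X)" and X: "X \<in> sets borel"
    and F: "F \<in> sets (borel_of_set X)" and e: "0 < e"
  obtains U where "open U" "F \<subseteq> U" "\<And>V. open V \<Longrightarrow> F \<subseteq> V \<Longrightarrow> V \<subseteq> U \<Longrightarrow> \<bar>measure \<rho> (X \<inter> V) - measure \<rho> F\<bar> < e"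
proof -
  interpret finite_measure \<rho> by fact
  have sp: "space \<rho> = X" using sets_eq_imp_space_eq[OF s] by (simp add: space_restrict_space)
  have m: "id \<in> measurable \<rho> borel"
    unfolding measurable_cong_sets[OF s refl] by (rule measurable_restrict_space1) (simp add: id_def)
  let ?D = "distr \<rho> borel id"
  interpret D: finite_measure ?D by (rule finite_measure_distr[OF m])
  have D: "emeasure ?D A = ennreal (measure \<rho> (X \<inter> A))" if "A \<in> sets borel" for A
    using that m sp by (subst emeasure_distr) (auto simp: emeasure_eq_measure Int_commute)
  have F': "F \<in> sets borel" "F \<subseteq> X"
    using F X by (auto simp: sets_restrict_space_iff)
  have FX: "X \<inter> F = F" using F' by auto
  have "emeasure ?D F = (INF U\<in>{U. F \<subseteq> U \<and> open U}. emeasure ?D U)"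
    by (rule outer_regular) (use F' D.emeasure_finite in auto)
  moreover have "emeasure ?D F < ennreal (measure \<rho> F + e)"
    using D[OF F'(1)] e FX by (simp add: ennreal_less_iff)
  ultimately have "(INF U\<in>{U. F \<subseteq> U \<and> open U}. emeasure ?D U) < ennreal (measure \<rho> F + e)"
    by simp
  then obtain U where U: "F \<subseteq> U" "open U" "emeasure ?D U < ennreal (measure \<rho> F + e)"
    unfolding INF_less_iff by blast
  show thesis
  proof (rule that[OF U(2,1)])
    fix V assume V: "open V" "F \<subseteq> V" "V \<subseteq> U"
    have *: "X \<inter> A \<in> sets \<rho>" if "open A" for A
      using that X s by (auto simp: sets_restrict_space_iff)
    have "measure \<rho> F \<le> measure \<rho> (X \<inter> V)"
      using F' V * by (intro finite_measure_mono) auto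
    moreover have "measure \<rho> (X \<inter> V) \<le> measure \<rho> (X \<inter> U)"
      using V U * by (intro finite_measure_mono) auto
    moreover have "measure \<rho> (X \<inter> U) < measure \<rho> F + e"
      using U(3) D[OF borel_open[OF U(2)]] by (simp only: ennreal_less_iff measure_nonneg)
    ultimately show "\<bar>measure \<rho> (X \<inter> V) - measure \<rho> F\<bar> < e" by linarith
  qed
qed

text \<open>Traces on \<open>X\<close> of finite unions from a countable base. They form a countable family that approximates all
Borel sets with respect to any two finite measures simultaneously.\<close>

definition basic_sets :: "'a::polish_space set \<Rightarrow> 'a set set" where
  "basic_sets X = (\<lambda>A. X \<inter> \<Union>A) ` {A. finite A \<and> A \<subseteq> (SOME B. countable B \<and> topological_basis B)}"

lemma some_basis:
  "countable (SOME B::'a::second_countable_topology set set. countable B \<and> topological_basis B)"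
  "topological_basis (SOME B::'a set set. countable B \<and> topological_basis B)"
  using someI_ex[OF ex_countable_basis[where 'a='a, unfolded conj_commute[of "countable _"]]] ex_countable_basis
  by (smt (verit) someI_ex)+

lemma countable_basic_sets: "countable (basic_sets X)"
  unfolding basic_sets_def by (intro countable_image countable_Collect_finite_subset some_basis)

lemma basic_sets_subset: "X \<in> sets borel \<Longrightarrow> basic_sets X \<subseteq> sets (borel_of_set X)"
proof
  fix V assume X: "X \<in> sets borel" and "V \<in> basic_sets X"
  then obtain A where A: "V = X \<inter> \<Union>A" "A \<subseteq> (SOME B. countable B \<and> topological_basis B)"
    by (auto simp: basic_sets_def)
  have "open (\<Union>A)" using A(2) topological_basis_open[OF some_basis(2)] by blast
  then show "V \<in> sets (borel_of_set X)" using X A by (auto simp: sets_restrict_space_iff)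
qed

lemma basic_sets_approx:
  fixes X :: "'a::polish_space set"
  assumes X: "X \<in> sets borel" and \<mu>: "finite_measure \<mu>" "sets \<mu> = sets (borel_of_set X)"
    and \<nu>: "finite_measure \<nu>" "sets \<nu> = sets (borel_of_set X)"
    and F: "F \<in> sets (borel_of_set X)" and e: "0 < e"
  obtains V where "V \<in> basic_sets X" "\<bar>measure \<mu> V - measure \<mu> F\<bar> < e" "\<bar>measure \<nu> V - measure \<nu> F\<bar> < e"
proof -
  define B :: "'a set set" where "B = (SOME B. countable B \<and> topological_basis B)"
  have B: "countable B" "topological_basis B" unfolding B_def by (rule some_basis)+
  obtain U1 where U1: "open U1" "F \<subseteq> U1" "\<And>V. open V \<Longrightarrow> F \<subseteq> V \<Longrightarrow> V \<subseteq> U1 \<Longrightarrow> \<bar>measure \<mu> (X \<inter> V) - measure \<mu> F\<bar> < e / 2"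
    using outer_regular_restrict[OF \<mu> X F, of "e/2"] e by auto
  obtain U2 where U2: "open U2" "F \<subseteq> U2" "\<And>V. open V \<Longrightarrow> F \<subseteq> V \<Longrightarrow> V \<subseteq> U2 \<Longrightarrow> \<bar>measure \<nu> (X \<inter> V) - measure \<nu> F\<bar> < e / 2"
    using outer_regular_restrict[OF \<nu> X F, of "e/2"] e by auto
  define U where "U = U1 \<inter> U2"
  have U: "open U" "\<bar>measure \<mu> (X \<inter> U) - measure \<mu> F\<bar> < e / 2" "\<bar>measure \<nu> (X \<inter> U) - measure \<nu> F\<bar> < e / 2"
    using U1(3)[of U] U2(3)[of U] U1(1,2) U2(1,2) by (auto simp: U_def)
  obtain B' where B': "B' \<subseteq> B" "\<Union>B' = U" using B(2) U(1) by (auto simp: topological_basis_def)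
  define C where "C = insert {} B'"
  have C: "countable C" "C \<noteq> {}" "\<Union>C = U" using B' B(1) by (auto simp: C_def intro: countable_subset)
  define D where "D k = from_nat_into C ` {..k::nat}" for k
  have UD: "(\<Union>k. \<Union>(D k)) = U"
  proof -
    have "(\<Union>k. \<Union>(D k)) = \<Union>(range (from_nat_into C))" by (auto simp: D_def)
    then show ?thesis using range_from_nat_into[OF C(2,1)] C(3) by simp
  qed
  have inc: "incseq (\<lambda>k. X \<inter> \<Union>(D k))"
  proof (rule incseq_SucI)
    show "X \<inter> \<Union>(D k) \<subseteq> X \<inter> \<Union>(D (Suc k))" for k
      unfolding D_def by (intro Int_mono Union_mono image_mono) auto
  qed
  have opD: "open (\<Union>(D k))" for k
  proof -
    have "D k \<subseteq> C" using from_nat_into[OF C(2)] by (auto simp: D_def)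
    then show ?thesis using B' topological_basis_open[OF B(2)] by (fastforce simp: C_def)
  qed
  have lim: "(\<lambda>k. measure \<rho> (X \<inter> \<Union>(D k))) \<longlonglongrightarrow> measure \<rho> (X \<inter> U)"
    if "finite_measure \<rho>" "sets \<rho> = sets (borel_of_set X)" for \<rho>
  proof -
    have "range (\<lambda>k. X \<inter> \<Union>(D k)) \<subseteq> sets \<rho>"
      using that X opD by (auto simp: sets_restrict_space_iff)
    from finite_measure.finite_Lim_measure_incseq[OF that(1) this inc]
    have "(\<lambda>k. measure \<rho> (X \<inter> \<Union>(D k))) \<longlonglongrightarrow> measure \<rho> (\<Union>k. X \<inter> \<Union>(D k))" .
    moreover have "(\<Union>k. X \<inter> \<Union>(D k)) = X \<inter> U" using UD by blast
    ultimately show ?thesis by simp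
  qed
  have "eventually (\<lambda>k. \<bar>measure \<mu> (X \<inter> \<Union>(D k)) - measure \<mu> (X \<inter> U)\<bar> < e/2 \<and>
      \<bar>measure \<nu> (X \<inter> \<Union>(D k)) - measure \<nu> (X \<inter> U)\<bar> < e/2) sequentially"
    using tendstoD[OF lim[OF \<mu>], of "e/2"] tendstoD[OF lim[OF \<nu>], of "e/2"] e
    by (intro eventually_conj) (simp_all add: dist_real_def)
  then obtain k where k: "\<bar>measure \<mu> (X \<inter> \<Union>(D k)) - measure \<mu> (X \<inter> U)\<bar> < e/2"
      "\<bar>measure \<nu> (X \<inter> \<Union>(D k)) - measure \<nu> (X \<inter> U)\<bar> < e/2"
    using eventually_happens'[OF sequentially_bot] by blast
  show thesis
  proof (rule that)
    have "finite (D k - {{}})" "D k - {{}} \<subseteq> B" "\<Union>(D k - {{}}) = \<Union>(D k)"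
      using from_nat_into[OF C(2)] B'(1) by (auto simp: D_def C_def)
    then show "X \<inter> \<Union>(D k) \<in> basic_sets X"
      unfolding basic_sets_def B_def[symmetric] by (intro image_eqI[where x="D k - {{}}"]) auto
  qed (use k U in linarith)+
qed

lemma excess_basic_sets:
  fixes X :: "'a::polish_space set"
  assumes pair: "subprob_pair (borel_of_set X) \<mu> \<nu> a b" and X: "X \<in> sets borel"
  shows "excess (borel_of_set X) a \<mu> b \<nu> = (SUP F\<in>basic_sets X. a * measure \<mu> F - b * measure \<nu> F)"
proof (rule antisym)
  let ?M = "borel_of_set X"
  interpret subprob_pair ?M \<mu> \<nu> a b by (rule pair)
  have *: "basic_sets X \<noteq> {}" by (auto simp: basic_sets_def)
  show "(SUP F\<in>basic_sets X. a * measure \<mu> F - b * measure \<nu> F) \<le> excess ?M a \<mu> b \<nu>"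
    using basic_sets_subset[OF X] * by (intro cSUP_least excess_upper) auto
  show "excess ?M a \<mu> b \<nu> \<le> (SUP F\<in>basic_sets X. a * measure \<mu> F - b * measure \<nu> F)"
  proof (rule excess_least)
    fix F assume F: "F \<in> sets ?M"
    show "a * measure \<mu> F - b * measure \<nu> F \<le> (SUP F\<in>basic_sets X. a * measure \<mu> F - b * measure \<nu> F)" (is "_ \<le> ?S")
    proof (rule field_le_epsilon)
      fix e :: real assume e: "0 < e"
      define d where "d = e / (a + b + 1)"
      have d: "0 < d" using e a b by (auto simp: d_def intro!: divide_pos_pos)
      obtain V where V: "V \<in> basic_sets X" "\<bar>measure \<mu> V - measure \<mu> F\<bar> < d" "\<bar>measure \<nu> V - measure \<nu> F\<bar> < d"
        using basic_sets_approx[OF X _ _ _ _ _ d, of \<mu> \<nu> F] F \<mu>.finite_measure_axioms \<nu>.finite_measure_axioms by auto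
      have "a * (measure \<mu> F - measure \<mu> V) \<le> a * d" using V a by (intro mult_left_mono) auto
      moreover have "b * (measure \<nu> V - measure \<nu> F) \<le> b * d" using V b by (intro mult_left_mono) auto
      moreover have "a * d + b * d \<le> e"
      proof -
        have "(a + b) * d \<le> (a + b + 1) * d" using d by (intro mult_right_mono) auto
        also have "\<dots> = e" using a b by (simp add: d_def)
        finally show ?thesis by (simp add: distrib_right)
      qed
      moreover have "a * measure \<mu> V - b * measure \<nu> V \<le> ?S"
        using V by (intro cSUP_upper bdd)
      ultimately show "a * measure \<mu> F - b * measure \<nu> F \<le> ?S + e"
        by (simp add: algebra_simps)
    qed
  qed
qed

text \<open>The supremum over the uncountably many Borel sets reduces to one over \<open>basic_sets\<close>.\<close>

lemma measurable_excess:
  fixes X :: "'a::polish_space set"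
  assumes X: "X \<in> sets borel"
    and \<mu>[measurable]: "\<mu> \<in> measurable N (subprob_algebra (borel_of_set X))"
    and \<nu>[measurable]: "\<nu> \<in> measurable N (subprob_algebra (borel_of_set X))"
    and a[measurable]: "a \<in> borel_measurable N" and b[measurable]: "b \<in> borel_measurable N"
    and a0: "\<And>w. w \<in> space N \<Longrightarrow> 0 \<le> a w" and b0: "\<And>w. w \<in> space N \<Longrightarrow> 0 \<le> b w"
  shows "(\<lambda>w. excess (borel_of_set X) (a w) (\<mu> w) (b w) (\<nu> w)) \<in> borel_measurable N"
proof -
  have pair: "subprob_pair (borel_of_set X) (\<mu> w) (\<nu> w) (a w) (b w)" if "w \<in> space N" for w
    using that a0 b0 measurable_space[OF \<mu>] measurable_space[OF \<nu>] by unfold_locales auto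
  have "(\<lambda>w. SUP F\<in>basic_sets X. a w * measure (\<mu> w) F - b w * measure (\<nu> w) F) \<in> borel_measurable N"
  proof (rule borel_measurable_cSUP)
    fix F assume "F \<in> basic_sets X"
    then have [measurable]: "F \<in> sets (borel_of_set X)" using basic_sets_subset[OF X] by auto
    show "(\<lambda>w. a w * measure (\<mu> w) F - b w * measure (\<nu> w) F) \<in> borel_measurable N"
      by measurable
  next
    show "bdd_above ((\<lambda>F. a w * measure (\<mu> w) F - b w * measure (\<nu> w) F) ` basic_sets X)" if "w \<in> space N" for w
      by (rule subprob_pair.bdd[OF pair[OF that]])
  qed (rule countable_basic_sets)
  then show ?thesis
    by (rule measurable_cong[THEN iffD1, rotated])
      (simp add: pair excess_basic_sets[OF _ X])
qed

section \<open>Prediction with two nearby kernels\<close>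

text \<open>The bound \<open>\<kappa>\<close> on the oscillations of \<open>x \<mapsto> k x F\<close> bounds the Dobrushin coefficient of \<open>k\<close>.\<close>

locale kernel_perturbation =
  fixes S :: "'a measure" and k kh :: "'a \<Rightarrow> 'a measure" and \<epsilon> \<kappa> :: real
  assumes k: "k \<in> measurable S (prob_algebra S)" and kh: "kh \<in> measurable S (prob_algebra S)"
    and \<epsilon>: "\<And>x F. x \<in> space S \<Longrightarrow> F \<in> sets S \<Longrightarrow> \<bar>measure (k x) F - measure (kh x) F\<bar> \<le> \<epsilon>"
    and \<kappa>: "\<And>x x' F. x \<in> space S \<Longrightarrow> x' \<in> space S \<Longrightarrow> F \<in> sets S \<Longrightarrow> measure (k x) F - measure (k x') F \<le> \<kappa>"
    and \<kappa>01: "0 \<le> \<kappa>" "\<kappa> \<le> 1"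
begin

lemma measure_bind_kernel:
  assumes "\<mu> \<in> space (prob_algebra S)" and h: "h \<in> measurable S (prob_algebra S)" and F: "F \<in> sets S"
  shows "measure (\<mu> \<bind> h) F = (\<integral>x. measure (h x) F \<partial>\<mu>)"
    and "integrable \<mu> (\<lambda>x. measure (h x) F)"
proof -
  have s: "sets \<mu> = sets S" "prob_space \<mu>" using assms(1) by (auto simp: space_prob_algebra)
  interpret prob_space \<mu> by fact
  have m: "h \<in> measurable \<mu> (subprob_algebra S)"
    using measurable_prob_algebraD[OF h] s(1) by (simp cong: measurable_cong_sets)
  show "measure (\<mu> \<bind> h) F = (\<integral>x. measure (h x) F \<partial>\<mu>)"
    by (rule measure_bind[OF m F])
  have "(\<lambda>x. measure (h x) F) \<in> borel_measurable \<mu>" 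
    using measurable_compose[OF m measurable_measure_subprob_algebra[OF F]] .
  moreover have "AE x in \<mu>. norm (measure (h x) F) \<le> 1"
    using measurable_space[OF m] by (intro AE_I2) (auto simp: space_subprob_algebra intro: subprob_space.subprob_measure_le_1)
  ultimately show "integrable \<mu> (\<lambda>x. measure (h x) F)" by (intro integrable_const_bound)
qed

lemma \<epsilon>_nonneg: "space S \<noteq> {} \<Longrightarrow> 0 \<le> \<epsilon>"
  using \<epsilon>[of _ "{}"] by force

text \<open>Here \<open>m\<close> is the infimum of \<open>h x F\<close>, the mass that \<open>F\<close> receives whatever the starting point. It contributes
through the total masses only, and it is a lower bound for the second prediction.\<close>

lemma bind_oscillation:
  assumes \<mu>: "\<mu> \<in> space (prob_algebra S)" and \<nu>: "\<nu> \<in> space (prob_algebra S)" and ab: "0 \<le> a" "0 \<le> b"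
    and h: "h \<in> measurable S (prob_algebra S)" and F: "F \<in> sets S"
    and osc: "\<And>x x'. x \<in> space S \<Longrightarrow> x' \<in> space S \<Longrightarrow> measure (h x) F - measure (h x') F \<le> c" and c: "0 \<le> c"
  obtains m where "0 \<le> m" "m \<le> measure (\<nu> \<bind> h) F"
    "a * measure (\<mu> \<bind> h) F - b * measure (\<nu> \<bind> h) F \<le> c * excess S a \<mu> b \<nu> + m * (a - b)"
proof -
  have prob: "prob_space \<mu>" "prob_space \<nu>" using \<mu> \<nu> by (auto simp: space_prob_algebra)
  interpret subprob_pair S \<mu> \<nu> a b by (rule prob_pair[OF \<mu> \<nu> ab])
  have ne: "space S \<noteq> {}" using prob_space.not_empty[OF prob(1)] by simp
  define m where "m = (INF x\<in>space S. measure (h x) F)"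
  have m: "m \<le> measure (h x) F" if "x \<in> space S" for x
    unfolding m_def using that by (intro cINF_lower bdd_belowI[where m=0]) auto
  have m0: "0 \<le> m" unfolding m_def using ne by (intro cINF_greatest) auto
  have m': "measure (h x) F \<le> m + c" if x: "x \<in> space S" for x
  proof -
    have "measure (h x) F - c \<le> m"
      unfolding m_def using osc[OF x] ne by (intro cINF_greatest) (auto simp: algebra_simps)
    then show ?thesis by simp
  qed
  interpret \<nu>': prob_space \<nu> by fact
  have "m = (\<integral>x. m \<partial>\<nu>)" by (simp add: \<nu>'.prob_space del: space_pair)
  also have "\<dots> \<le> (\<integral>x. measure (h x) F \<partial>\<nu>)"
    using m measure_bind_kernel[OF \<nu> h F] by (intro integral_mono_AE AE_I2) auto
  finally have "m \<le> measure (\<nu> \<bind> h) F" using measure_bind_kernel[OF \<nu> h F] by simp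
  moreover have "a * measure (\<mu> \<bind> h) F - b * measure (\<nu> \<bind> h) F \<le> c * excess S a \<mu> b \<nu> + m * (a - b)"
    using measure_bind_kernel(1)[OF \<nu> h F] measure_bind_kernel(1)[OF \<mu> h F] m m' c
      measurable_compose[OF measurable_prob_algebraD[OF h] measurable_measure_subprob_algebra[OF F]]
    by (simp add: excess_integral_osc[OF prob])
  ultimately show thesis using m0 that by blast
qed

lemma bind_perturb:
  assumes \<mu>: "\<mu> \<in> space (prob_algebra S)" and F: "F \<in> sets S"
  shows "\<bar>measure (\<mu> \<bind> k) F - measure (\<mu> \<bind> kh) F\<bar> \<le> \<epsilon>"
proof -
  note k' = measure_bind_kernel[OF \<mu> k F] and kh' = measure_bind_kernel[OF \<mu> kh F]
  have s: "space \<mu> = space S" "prob_space \<mu>" using \<mu> by (auto simp: space_prob_algebra dest: sets_eq_imp_space_eq)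
  interpret prob_space \<mu> by fact
  have "measure (\<mu> \<bind> k) F - measure (\<mu> \<bind> kh) F = (\<integral>x. measure (k x) F - measure (kh x) F \<partial>\<mu>)"
    using k' kh' by simp
  also have "\<bar>\<dots>\<bar> \<le> (\<integral>x. \<bar>measure (k x) F - measure (kh x) F\<bar> \<partial>\<mu>)"
    by (rule integral_abs_bound)
  also have "\<dots> \<le> (\<integral>x. \<epsilon> \<partial>\<mu>)"
    using k' kh' \<epsilon>[OF _ F] s by (intro integral_mono_AE AE_I2) auto
  finally show ?thesis by (simp add: prob_space)
qed

text \<open>The change of kernel is applied to the first measure, so that it costs \<open>a \<epsilon>\<close>; applied to the second it
would cost \<open>b \<epsilon>\<close>, and the weights \<open>b\<close> that occur below are unbounded.\<close>

lemma excess_predict: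
  assumes \<mu>: "\<mu> \<in> space (prob_algebra S)" and \<nu>: "\<nu> \<in> space (prob_algebra S)" and ab: "0 \<le> a" "0 \<le> b"
  shows "excess S a (\<mu> \<bind> k) b (\<nu> \<bind> kh) \<le> excess S a \<mu> b \<nu> + a * \<epsilon>"
proof (rule excess_least)
  fix F assume F: "F \<in> sets S"
  have prob: "prob_space \<mu>" "prob_space \<nu>" using \<mu> \<nu> by (auto simp: space_prob_algebra)
  interpret subprob_pair S \<mu> \<nu> a b by (rule prob_pair[OF \<mu> \<nu> ab])
  have kh1: "measure (kh x) F \<le> 1" if "x \<in> space S" for x
    using measurable_space[OF kh that] by (auto simp: space_prob_algebra intro: prob_space.prob_le_1)
  have "a * measure (\<mu> \<bind> kh) F - b * measure (\<nu> \<bind> kh) F \<le> 1 * excess S a \<mu> b \<nu> + 0 * (a - b)"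
    using measure_bind_kernel(1)[OF \<nu> kh F] measure_bind_kernel(1)[OF \<mu> kh F] kh1
      measurable_compose[OF measurable_prob_algebraD[OF kh] measurable_measure_subprob_algebra[OF F]]
    by (simp add: excess_integral)
  moreover have "a * (measure (\<mu> \<bind> k) F - measure (\<mu> \<bind> kh) F) \<le> a * \<epsilon>"
    using bind_perturb[OF \<mu> F] ab by (intro mult_left_mono) auto
  ultimately show "a * measure (\<mu> \<bind> k) F - b * measure (\<nu> \<bind> kh) F \<le> excess S a \<mu> b \<nu> + a * \<epsilon>"
    by (simp add: algebra_simps)
qed

text \<open>For equal weights the total masses cancel and only the oscillation of the kernel remains.\<close>

lemma excess_predict_centred:
  assumes \<mu>: "\<mu> \<in> space (prob_algebra S)" and \<nu>: "\<nu> \<in> space (prob_algebra S)" and a: "0 \<le> a"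
  shows "excess S a (\<mu> \<bind> k) a (\<nu> \<bind> kh) \<le> \<kappa> * excess S a \<mu> a \<nu> + a * \<epsilon>"
proof (rule excess_least)
  fix F assume F: "F \<in> sets S"
  obtain m where "a * measure (\<mu> \<bind> k) F - a * measure (\<nu> \<bind> k) F \<le> \<kappa> * excess S a \<mu> a \<nu> + m * (a - a)"
    using bind_oscillation[OF \<mu> \<nu> a a k F \<kappa>[OF _ _ F] \<kappa>01(1)] by blast
  moreover have "a * (measure (\<nu> \<bind> k) F - measure (\<nu> \<bind> kh) F) \<le> a * \<epsilon>"
    using bind_perturb[OF \<nu> F] a by (intro mult_left_mono) auto
  ultimately show "a * measure (\<mu> \<bind> k) F - a * measure (\<nu> \<bind> kh) F \<le> \<kappa> * excess S a \<mu> a \<nu> + a * \<epsilon>"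
    by (simp add: algebra_simps)
qed

text \<open>Write \<open>T\<close> for the excess. In the bound of \<open>bind_oscillation\<close> the term \<open>m (1 - b)\<close> is at most \<open>m T\<close>, because
\<open>1 - b\<close> is the value of \<open>\<mu> - b \<nu>\<close> on the whole space. Since \<open>m\<close> bounds the second prediction from below,
this is compensated by the additional weight \<open>T\<close>. The argument uses the oscillation of \<open>kh\<close>, which is at
most \<open>\<kappa> + 2 \<epsilon>\<close>.\<close>

lemma excess_predict_raise:
  assumes \<mu>: "\<mu> \<in> space (prob_algebra S)" and \<nu>: "\<nu> \<in> space (prob_algebra S)" and b: "0 \<le> b"
  shows "excess S 1 (\<mu> \<bind> k) (b + excess S 1 \<mu> b \<nu>) (\<nu> \<bind> kh) \<le> \<kappa> * excess S 1 \<mu> b \<nu> + 3 * \<epsilon>"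
proof (rule excess_least)
  fix F assume F: "F \<in> sets S"
  let ?T = "excess S 1 \<mu> b \<nu>"
  have prob: "prob_space \<mu>" "prob_space \<nu>" using \<mu> \<nu> by (auto simp: space_prob_algebra)
  interpret subprob_pair S \<mu> \<nu> 1 b by (rule prob_pair[OF \<mu> \<nu> _ b]) simp
  have ne: "space S \<noteq> {}" using prob_space.not_empty[OF prob(1)] by simp
  have osc: "measure (kh x) F - measure (kh x') F \<le> \<kappa> + 2 * \<epsilon>" if "x \<in> space S" "x' \<in> space S" for x x'
    using \<epsilon>[OF that(1) F] \<epsilon>[OF that(2) F] \<kappa>[OF that F] by linarith
  obtain m where m: "0 \<le> m" "m \<le> measure (\<nu> \<bind> kh) F"
     "1 * measure (\<mu> \<bind> kh) F - b * measure (\<nu> \<bind> kh) F \<le> (\<kappa> + 2 * \<epsilon>) * ?T + m * (1 - b)"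
    using bind_oscillation[OF \<mu> \<nu> zero_le_one b kh F osc] \<kappa>01(1) \<epsilon>_nonneg[OF ne] by (metis add_nonneg_nonneg mult_nonneg_nonneg zero_le_numeral)
  have T: "0 \<le> ?T" "?T \<le> 1" by (rule excess_nonneg, rule excess_le)
  have "1 - b \<le> ?T"
    using excess_upper[of "space S"] prob_space.prob_space[OF prob(1)] prob_space.prob_space[OF prob(2)] by simp
  then have "m * (1 - b) \<le> m * ?T" using m by (intro mult_left_mono)
  also have "\<dots> \<le> measure (\<nu> \<bind> kh) F * ?T" using m T by (intro mult_right_mono)
  finally have "m * (1 - b) \<le> measure (\<nu> \<bind> kh) F * ?T" .
  moreover have "\<epsilon> * ?T \<le> \<epsilon> * 1" using T \<epsilon>_nonneg[OF ne] by (intro mult_left_mono)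
  ultimately show "1 * measure (\<mu> \<bind> k) F - (b + ?T) * measure (\<nu> \<bind> kh) F \<le> \<kappa> * ?T + 3 * \<epsilon>"
    using m(3) bind_perturb[OF \<mu> F] by (simp add: algebra_simps abs_le_iff)
qed

end

section \<open>Two filters weighted by their likelihood ratio\<close>

text \<open>Two random measures, adapted to a filtration, that are predicted with the kernels \<open>k t\<close> and \<open>kh t\<close> and
then updated. The updates enter only through \<open>update\<close> and \<open>ratio\<close>: if the weight of the second measure is
multiplied by \<open>\<rho> t\<close>, the mean excess does not increase, nor do mean weights.\<close>

locale perturbed_filter_pair = prob_space P for P :: "'w measure" +
  fixes G :: "nat \<Rightarrow> 'w measure" and X :: "'x::polish_space set"
    and \<mu> \<nu> :: "nat \<Rightarrow> 'w \<Rightarrow> 'x measure" and k kh :: "nat \<Rightarrow> 'x \<Rightarrow> 'x measure"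
    and \<rho> :: "nat \<Rightarrow> 'w \<Rightarrow> real" and \<epsilon> \<kappa> :: "nat \<Rightarrow> real" and c :: real
  assumes X: "X \<in> sets borel"
    and space_G: "\<And>t. space (G t) = space P" and sets_G: "\<And>t. sets (G t) \<subseteq> sets P"
    and G_mono: "\<And>t. sets (G t) \<subseteq> sets (G (Suc t))"
    and \<mu>: "\<And>t. \<mu> t \<in> measurable (G t) (subprob_algebra (borel_of_set X))"
    and \<nu>: "\<And>t. \<nu> t \<in> measurable (G t) (subprob_algebra (borel_of_set X))"
    and prob: "\<And>t. AE w in P. \<mu> t w \<in> space (prob_algebra (borel_of_set X)) \<and> \<nu> t w \<in> space (prob_algebra (borel_of_set X))"
    and \<rho>: "\<And>t. \<rho> t \<in> borel_measurable (G (Suc t))" and \<rho>_nonneg: "\<And>t w. 0 \<le> \<rho> t w"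
    and kernels: "\<And>t. kernel_perturbation (borel_of_set X) (k t) (kh t) (\<epsilon> t) (\<kappa> t)"
    and update: "\<And>t a b. a \<in> borel_measurable (G t) \<Longrightarrow> b \<in> borel_measurable (G t) \<Longrightarrow>
        (\<And>w. w \<in> space P \<Longrightarrow> 0 \<le> a w) \<Longrightarrow> (\<And>w. w \<in> space P \<Longrightarrow> 0 \<le> b w) \<Longrightarrow> integrable P a \<Longrightarrow>
        (\<integral>w. excess (borel_of_set X) (a w) (\<mu> (Suc t) w) (b w * \<rho> t w) (\<nu> (Suc t) w) \<partial>P)
          \<le> (\<integral>w. excess (borel_of_set X) (a w) (\<mu> t w \<bind> k t) (b w) (\<nu> t w \<bind> kh t) \<partial>P)"
    and ratio: "\<And>t a. a \<in> borel_measurable (G t) \<Longrightarrow> (\<And>w. w \<in> space P \<Longrightarrow> 0 \<le> a w) \<Longrightarrow> integrable P a \<Longrightarrow>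
        integrable P (\<lambda>w. a w * \<rho> t w) \<and> (\<integral>w. a w * \<rho> t w \<partial>P) \<le> (\<integral>w. a w \<partial>P)"
    and \<epsilon>_summable: "summable \<epsilon>"
    and c: "c < 1" "\<exists>\<^sub>\<infinity>t. \<kappa> t \<le> c"
begin

abbreviation "S \<equiv> borel_of_set X"

lemma \<kappa>01: "0 \<le> \<kappa> t" "\<kappa> t \<le> 1"
  using kernels[of t] by (auto simp: kernel_perturbation_def)

lemma X_nonempty: "space S \<noteq> {}"
proof -
  have "\<exists>w. \<mu> 0 w \<in> space (prob_algebra S)"
  proof (rule ccontr)
    assume "\<not> ?thesis"
    then have "AE w in P. False" using prob[of 0] by auto
    then show False by simp
  qed
  then obtain w where "\<mu> 0 w \<in> space (prob_algebra S)" by blast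
  then show ?thesis
    using prob_space.not_empty[of "\<mu> 0 w"] sets_eq_imp_space_eq[of "\<mu> 0 w" S]
    by (auto simp: space_prob_algebra)
qed

lemma \<epsilon>_nonneg: "0 \<le> \<epsilon> t"
  using kernel_perturbation.\<epsilon>_nonneg[OF kernels X_nonempty] .

lemma G_mono': "s \<le> t \<Longrightarrow> sets (G s) \<subseteq> sets (G t)"
  by (induction rule: dec_induct) (use G_mono in auto)

lemma meas_mono: "f \<in> measurable (G s) N \<Longrightarrow> s \<le> t \<Longrightarrow> f \<in> measurable (G t) N"
  using measurable_mono[OF order_refl refl G_mono'[of s t], of N] space_G by auto

lemma meas_P: "f \<in> measurable (G s) N \<Longrightarrow> f \<in> measurable P N"
  using measurable_mono[OF order_refl refl sets_G[of s], of N] space_G by auto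

lemma pair:
  assumes "w \<in> space P" "0 \<le> a" "0 \<le> b"
  shows "subprob_pair S (\<mu> t w) (\<nu> t w) a b"
  using assms measurable_space[OF \<mu>, of w t] measurable_space[OF \<nu>, of w t] space_G by unfold_locales auto

lemma excess_meas:
  assumes "a \<in> borel_measurable (G t)" "b \<in> borel_measurable (G t)"
    "\<And>w. w \<in> space P \<Longrightarrow> 0 \<le> a w" "\<And>w. w \<in> space P \<Longrightarrow> 0 \<le> b w"
  shows "(\<lambda>w. excess S (a w) (\<mu> t w) (b w) (\<nu> t w)) \<in> borel_measurable (G t)"
  using assms space_G by (intro measurable_excess[OF X \<mu> \<nu>]) auto

lemma excess_bounds:
  assumes "w \<in> space P" "0 \<le> a" "0 \<le> b"
  shows "0 \<le> excess S a (\<mu> t w) b (\<nu> t w)" "excess S a (\<mu> t w) b (\<nu> t w) \<le> a"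
  using subprob_pair.excess_nonneg[OF pair[OF assms]] subprob_pair.excess_le[OF pair[OF assms]] by auto

lemma excess_integrable:
  assumes "a \<in> borel_measurable (G t)" "b \<in> borel_measurable (G t)"
    "\<And>w. w \<in> space P \<Longrightarrow> 0 \<le> a w" "\<And>w. w \<in> space P \<Longrightarrow> 0 \<le> b w" "integrable P a"
  shows "integrable P (\<lambda>w. excess S (a w) (\<mu> t w) (b w) (\<nu> t w))"
proof (rule Bochner_Integration.integrable_bound[OF assms(5)])
  show "(\<lambda>w. excess S (a w) (\<mu> t w) (b w) (\<nu> t w)) \<in> borel_measurable P"
    using excess_meas[OF assms(1-4)] meas_P by blast
  show "AE w in P. norm (excess S (a w) (\<mu> t w) (b w) (\<nu> t w)) \<le> norm (a w)"
    using assms excess_bounds by (intro AE_I2) auto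
qed

lemma k_meas: "k t \<in> measurable S (prob_algebra S)" and kh_meas: "kh t \<in> measurable S (prob_algebra S)"
  using kernels[of t] by (auto simp: kernel_perturbation_def)

lemma predict_meas:
  "(\<lambda>w. \<mu> t w \<bind> k t) \<in> measurable (G t) (subprob_algebra S)"
  "(\<lambda>w. \<nu> t w \<bind> kh t) \<in> measurable (G t) (subprob_algebra S)"
  using measurable_bind2[OF \<mu> measurable_prob_algebraD[OF k_meas]]
    measurable_bind2[OF \<nu> measurable_prob_algebraD[OF kh_meas]] by auto

lemma excess_predict_integrable:
  assumes "a \<in> borel_measurable (G t)" "b \<in> borel_measurable (G t)"
    "\<And>w. w \<in> space P \<Longrightarrow> 0 \<le> a w" "\<And>w. w \<in> space P \<Longrightarrow> 0 \<le> b w" "integrable P a"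
  shows "integrable P (\<lambda>w. excess S (a w) (\<mu> t w \<bind> k t) (b w) (\<nu> t w \<bind> kh t))"
proof (rule Bochner_Integration.integrable_bound[OF assms(5)])
  have pair': "subprob_pair S (\<mu> t w \<bind> k t) (\<nu> t w \<bind> kh t) (a w) (b w)" if "w \<in> space P" for w
    using that assms(3,4) measurable_space[OF predict_meas(1)] measurable_space[OF predict_meas(2)] space_G
    by unfold_locales auto
  show "(\<lambda>w. excess S (a w) (\<mu> t w \<bind> k t) (b w) (\<nu> t w \<bind> kh t)) \<in> borel_measurable P"
    using assms space_G by (intro meas_P[of _ t] measurable_excess[OF X predict_meas]) auto
  show "AE w in P. norm (excess S (a w) (\<mu> t w \<bind> k t) (b w) (\<nu> t w \<bind> kh t)) \<le> norm (a w)"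
    using assms subprob_pair.excess_nonneg[OF pair'] subprob_pair.excess_le[OF pair'] by (intro AE_I2) auto
qed

lemma update_then:
  assumes a: "a \<in> borel_measurable (G t)" and b: "b \<in> borel_measurable (G t)"
    "\<And>w. w \<in> space P \<Longrightarrow> 0 \<le> a w" "\<And>w. w \<in> space P \<Longrightarrow> 0 \<le> b w" "integrable P a"
    and f: "integrable P f" and le: "\<And>w. w \<in> space P \<Longrightarrow> \<mu> t w \<in> space (prob_algebra S) \<Longrightarrow> \<nu> t w \<in> space (prob_algebra S) \<Longrightarrow>
       excess S (a w) (\<mu> t w \<bind> k t) (b w) (\<nu> t w \<bind> kh t) \<le> f w"
  shows "(\<integral>w. excess S (a w) (\<mu> (Suc t) w) (b w * \<rho> t w) (\<nu> (Suc t) w) \<partial>P) \<le> (\<integral>w. f w \<partial>P)"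
proof -
  have "(\<integral>w. excess S (a w) (\<mu> t w \<bind> k t) (b w) (\<nu> t w \<bind> kh t) \<partial>P) \<le> (\<integral>w. f w \<partial>P)"
  proof (rule integral_mono_AE[OF excess_predict_integrable[OF a b] f])
    show "AE w in P. excess S (a w) (\<mu> t w \<bind> k t) (b w) (\<nu> t w \<bind> kh t) \<le> f w"
      using prob[of t] by (rule AE_mp) (auto intro!: AE_I2 le)
  qed
  then show ?thesis using update[OF a b] by linarith
qed

text \<open>When \<open>\<rho>\<close> is the evidence ratio, this is the likelihood of the observations at the times \<open>s + 1, \<dots>, t\<close>
under the second model relative to the first.\<close>

definition likelihood_ratio :: "nat \<Rightarrow> nat \<Rightarrow> 'w \<Rightarrow> real" where
  "likelihood_ratio s t w = (\<Prod>i=s..<t. \<rho> i w)"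

lemma likelihood_ratio_self [simp]: "likelihood_ratio s s w = 1"
  by (simp add: likelihood_ratio_def)

lemma likelihood_ratio_Suc: "s \<le> t \<Longrightarrow> likelihood_ratio s (Suc t) w = likelihood_ratio s t w * \<rho> t w"
  by (simp add: likelihood_ratio_def)

lemma likelihood_ratio_trans: "r \<le> s \<Longrightarrow> s \<le> t \<Longrightarrow> likelihood_ratio r s w * likelihood_ratio s t w = likelihood_ratio r t w"
  unfolding likelihood_ratio_def by (rule prod.atLeastLessThan_concat)

lemma likelihood_ratio_nonneg: "0 \<le> likelihood_ratio s t w"
  unfolding likelihood_ratio_def using \<rho>_nonneg by (intro prod_nonneg) auto

lemma likelihood_ratio_meas: "likelihood_ratio s t \<in> borel_measurable (G t)"
  unfolding likelihood_ratio_def[abs_def] using meas_mono[OF \<rho>] by (intro borel_measurable_prod) auto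

lemma likelihood_ratio_integral:
  assumes "s \<le> t" "a \<in> borel_measurable (G s)" "\<And>w. w \<in> space P \<Longrightarrow> 0 \<le> a w" "integrable P a"
  shows "integrable P (\<lambda>w. a w * likelihood_ratio s t w) \<and> (\<integral>w. a w * likelihood_ratio s t w \<partial>P) \<le> (\<integral>w. a w \<partial>P)"
  using assms(1)
proof (induction rule: dec_induct)
  case base
  then show ?case using assms by simp
next
  case (step t)
  have "(\<lambda>w. a w * likelihood_ratio s t w) \<in> borel_measurable (G t)"
    using assms(2) meas_mono[OF assms(2), of t] step likelihood_ratio_meas by auto
  from ratio[OF this] step show ?case
    using assms(3) likelihood_ratio_nonneg by (auto simp: likelihood_ratio_Suc mult.assoc intro: order_trans)
qed

text \<open>The weight \<open>b\<close> follows the likelihood ratio, so updates cost nothing and a prediction costs \<open>a \<epsilon>\<close>.\<close>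

lemma excess_propagate:
  assumes "s \<le> t" and a: "a \<in> borel_measurable (G s)" and b: "b \<in> borel_measurable (G s)"
    and a0: "\<And>w. w \<in> space P \<Longrightarrow> 0 \<le> a w" and b0: "\<And>w. w \<in> space P \<Longrightarrow> 0 \<le> b w" and ia: "integrable P a"
  shows "(\<integral>w. excess S (a w) (\<mu> t w) (b w * likelihood_ratio s t w) (\<nu> t w) \<partial>P)
    \<le> (\<integral>w. excess S (a w) (\<mu> s w) (b w) (\<nu> s w) \<partial>P) + (\<Sum>i=s..<t. \<epsilon> i) * (\<integral>w. a w \<partial>P)"
  using assms(1)
proof (induction rule: dec_induct)
  case base
  then show ?case by simp
next
  case (step t)
  have m: "a \<in> borel_measurable (G t)" "(\<lambda>w. b w * likelihood_ratio s t w) \<in> borel_measurable (G t)"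
    using step meas_mono[OF a] meas_mono[OF b] likelihood_ratio_meas by auto
  have b0': "0 \<le> b w * likelihood_ratio s t w" if "w \<in> space P" for w
    using b0[OF that] likelihood_ratio_nonneg by auto
  let ?Z = "\<lambda>w. excess S (a w) (\<mu> t w) (b w * likelihood_ratio s t w) (\<nu> t w)"
  have iZ: "integrable P ?Z" by (rule excess_integrable[OF m a0 b0' ia])
  have "(\<integral>w. excess S (a w) (\<mu> (Suc t) w) (b w * likelihood_ratio s t w * \<rho> t w) (\<nu> (Suc t) w) \<partial>P)
     \<le> (\<integral>w. ?Z w + a w * \<epsilon> t \<partial>P)"
    using iZ ia by (intro update_then[OF m a0 b0' ia])
      (auto intro!: kernel_perturbation.excess_predict[OF kernels] a0 b0')
  also have "\<dots> = (\<integral>w. ?Z w \<partial>P) + (\<integral>w. a w \<partial>P) * \<epsilon> t" using iZ ia by simp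
  finally show ?case
    using step by (simp add: likelihood_ratio_Suc mult.assoc algebra_simps)
qed

text \<open>The weights agree only at time \<open>s\<close>, so only the first prediction contracts.\<close>

lemma excess_contract:
  assumes st: "s < t" and a: "a \<in> borel_measurable (G s)"
    and a0: "\<And>w. w \<in> space P \<Longrightarrow> 0 \<le> a w" and ia: "integrable P a"
  shows "(\<integral>w. excess S (a w) (\<mu> t w) (a w * likelihood_ratio s t w) (\<nu> t w) \<partial>P)
    \<le> \<kappa> s * (\<integral>w. excess S (a w) (\<mu> s w) (a w) (\<nu> s w) \<partial>P) + (\<Sum>i=s..<t. \<epsilon> i) * (\<integral>w. a w \<partial>P)"
proof -
  let ?Z = "\<lambda>w. excess S (a w) (\<mu> s w) (a w) (\<nu> s w)"
  have iZ: "integrable P ?Z" by (rule excess_integrable[OF a a a0 a0 ia])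
  have 1: "(\<integral>w. excess S (a w) (\<mu> (Suc s) w) (a w * \<rho> s w) (\<nu> (Suc s) w) \<partial>P) \<le> (\<integral>w. \<kappa> s * ?Z w + a w * \<epsilon> s \<partial>P)"
    using iZ ia by (intro update_then[OF a a a0 a0 ia])
      (auto intro!: kernel_perturbation.excess_predict_centred[OF kernels] a0)
  have am: "a \<in> borel_measurable (G (Suc s))" "(\<lambda>w. a w * \<rho> s w) \<in> borel_measurable (G (Suc s))"
    using meas_mono[OF a, of "Suc s"] \<rho> by auto
  have a\<rho>: "0 \<le> a w * \<rho> s w" if "w \<in> space P" for w using a0[OF that] \<rho>_nonneg by simp
  have eq: "a w * likelihood_ratio s t w = a w * \<rho> s w * likelihood_ratio (Suc s) t w" for w
    using likelihood_ratio_trans[of s "Suc s" t w] st by (simp add: likelihood_ratio_Suc mult.assoc)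
  have "(\<integral>w. excess S (a w) (\<mu> t w) (a w * likelihood_ratio s t w) (\<nu> t w) \<partial>P)
    \<le> (\<integral>w. excess S (a w) (\<mu> (Suc s) w) (a w * \<rho> s w) (\<nu> (Suc s) w) \<partial>P) + (\<Sum>i=Suc s..<t. \<epsilon> i) * (\<integral>w. a w \<partial>P)"
    unfolding eq using st by (intro excess_propagate am a0 a\<rho> ia) auto
  moreover have "(\<integral>w. \<kappa> s * ?Z w + a w * \<epsilon> s \<partial>P) = \<kappa> s * (\<integral>w. ?Z w \<partial>P) + (\<integral>w. a w \<partial>P) * \<epsilon> s"
    using iZ ia by simp
  moreover have "(\<Sum>i=s..<t. \<epsilon> i) = \<epsilon> s + (\<Sum>i=Suc s..<t. \<epsilon> i)"
    using st by (simp add: sum.atLeast_Suc_lessThan)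
  ultimately show ?thesis using 1 by (simp add: algebra_simps)
qed

end

section \<open>Convergence of the error in mean\<close>

text \<open>From a late time on, \<open>x\<close> increases by at most \<open>e\<close> whatever the number of steps, so it is enough to contract
by \<open>c\<close> infinitely often, however rarely.\<close>

lemma contraction_tendsto_0:
  fixes x \<kappa> :: "nat \<Rightarrow> real"
  assumes x: "\<And>t. 0 \<le> x t" "\<And>t. x t \<le> 1" and \<kappa>: "\<And>t. 0 \<le> \<kappa> t"
    and c: "c < 1" "\<exists>\<^sub>\<infinity>t. \<kappa> t \<le> c"
    and step: "\<And>e. 0 < e \<Longrightarrow> \<exists>N. \<forall>s\<ge>N. \<forall>t>s. x t \<le> \<kappa> s * x s + e"
  shows "x \<longlonglongrightarrow> 0"
proof -
  have c0: "0 \<le> c" using \<kappa> c(2) by (metis INFM_E order_trans)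
  have iter: "\<exists>N. \<forall>t\<ge>N. x t \<le> c ^ j + e / (1 - c)" if e: "0 < e" for e j
  proof (induction j)
    case 0
    have "x t \<le> c ^ 0 + e / (1 - c)" for t
      using x(2)[of t] e c(1) by (simp add: add_increasing2)
    then show ?case by blast
  next
    case (Suc j)
    then obtain N where N: "\<And>t. t \<ge> N \<Longrightarrow> x t \<le> c ^ j + e / (1 - c)" by blast
    obtain N' where N': "\<And>s t. s \<ge> N' \<Longrightarrow> t > s \<Longrightarrow> x t \<le> \<kappa> s * x s + e" using step[OF e] by blast
    obtain s where s: "s \<ge> max N N'" "\<kappa> s \<le> c" using c(2) by (meson INFM_nat_le)
    have "x t \<le> c ^ Suc j + e / (1 - c)" if "t \<ge> Suc s" for t
    proof -
      have "x t \<le> \<kappa> s * x s + e" using N'[of s t] s that by auto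
      also have "\<dots> \<le> c * (c ^ j + e / (1 - c)) + e"
        using s N[of s] x \<kappa> c0 by (intro add_right_mono mult_mono) auto
      also have "\<dots> = c ^ Suc j + e / (1 - c)" using c by (simp add: field_simps)
      finally show ?thesis .
    qed
    then show ?case by blast
  qed
  show ?thesis
  proof (rule LIMSEQ_I)
    fix r :: real assume r: "0 < r"
    define e where "e = (1 - c) * r / 2"
    have e: "0 < e" "e / (1 - c) = r / 2" using r c(1) by (simp_all add: e_def divide_simps)
    have "(\<lambda>j. c ^ j) \<longlonglongrightarrow> 0" using c c0 by (intro LIMSEQ_realpow_zero) auto
    then have "eventually (\<lambda>j. c ^ j < r / 2) sequentially" using r by (intro order_tendstoD) auto
    then obtain j where j: "c ^ j < r / 2" by (auto simp: eventually_sequentially)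
    obtain N where N: "\<And>t. t \<ge> N \<Longrightarrow> x t \<le> c ^ j + e / (1 - c)" using iter[OF e(1), of j] by blast
    have "norm (x t - 0) < r" if "t \<ge> N" for t
      using N[OF that] j e x(1)[of t] by simp
    then show "\<exists>N. \<forall>t\<ge>N. norm (x t - 0) < r" by blast
  qed
qed

lemma summable_tail_sums:
  fixes f :: "nat \<Rightarrow> real"
  assumes "summable f" "\<And>i. 0 \<le> f i" "0 < e"
  obtains N where "\<And>m n. N \<le> m \<Longrightarrow> (\<Sum>k=m..<n. f k) \<le> e"
proof -
  obtain N where N: "\<And>m n. N \<le> m \<Longrightarrow> norm (sum f {m..<n}) < e"
    using assms(1,3) unfolding summable_Cauchy by blast
  show thesis
  proof (rule that[of N])
    show "sum f {m..<n} \<le> e" if "N \<le> m" for m n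
      using N[OF that, of n] by simp
  qed
qed

context perturbed_filter_pair
begin

text \<open>The weight that is raised by the current excess before each prediction, as in \<open>excess_predict_raise\<close>.\<close>

fun raised_weight :: "nat \<Rightarrow> 'w \<Rightarrow> real" where
  "raised_weight 0 w = 0"
| "raised_weight (Suc t) w = (raised_weight t w + excess S 1 (\<mu> t w) (raised_weight t w) (\<nu> t w)) * \<rho> t w"

lemma raised_weight_nonneg: "w \<in> space P \<Longrightarrow> 0 \<le> raised_weight t w"
  by (induction t) (auto intro!: mult_nonneg_nonneg add_nonneg_nonneg excess_bounds \<rho>_nonneg)

lemma raised_weight_meas: "raised_weight t \<in> borel_measurable (G t)"
proof (induction t)
  case 0
  have "raised_weight 0 = (\<lambda>w. 0)" by auto
  then show ?case by simp
next
  case (Suc t)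
  have "(\<lambda>w. excess S 1 (\<mu> t w) (raised_weight t w) (\<nu> t w)) \<in> borel_measurable (G t)"
    by (intro excess_meas Suc raised_weight_nonneg) auto
  then have "(\<lambda>w. (raised_weight t w + excess S 1 (\<mu> t w) (raised_weight t w) (\<nu> t w)) * \<rho> t w) \<in> borel_measurable (G (Suc t))"
    using meas_mono[of _ t borel "Suc t"] Suc \<rho> by (intro borel_measurable_times borel_measurable_add) auto
  then show ?case by simp
qed

lemma raised_weight_excess_integrable: "integrable P (\<lambda>w. excess S 1 (\<mu> t w) (raised_weight t w) (\<nu> t w))"
  by (intro excess_integrable raised_weight_meas raised_weight_nonneg) auto

lemma raised_weight_integrable: "integrable P (raised_weight t)"
proof (induction t)
  case 0
  have "raised_weight 0 = (\<lambda>w. 0)" by auto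
  then show ?case by simp
next
  case (Suc t)
  have "(\<lambda>w. raised_weight t w + excess S 1 (\<mu> t w) (raised_weight t w) (\<nu> t w)) \<in> borel_measurable (G t)"
    using raised_weight_meas by (intro borel_measurable_add excess_meas raised_weight_nonneg) auto
  from ratio[OF this] have "integrable P (\<lambda>w. raised_weight (Suc t) w)"
    using Suc raised_weight_excess_integrable excess_bounds raised_weight_nonneg by auto
  then show ?case .
qed

text \<open>At late times the first measure is nearly dominated by an integrable multiple of the second one. This
stands in for absolute continuity, which may fail at every time.\<close>

lemma excess_raised_weight_tendsto_0:
  "(\<lambda>t. \<integral>w. excess S 1 (\<mu> t w) (raised_weight t w) (\<nu> t w) \<partial>P) \<longlonglongrightarrow> 0" (is "?x \<longlonglongrightarrow> 0")
proof (rule contraction_tendsto_0)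
  let ?T = "\<lambda>t w. excess S 1 (\<mu> t w) (raised_weight t w) (\<nu> t w)"
  have T: "0 \<le> ?T t w" "?T t w \<le> 1" if "w \<in> space P" for t w
    using excess_bounds[OF that zero_le_one raised_weight_nonneg[OF that]] by auto
  show x0: "0 \<le> ?x t" for t using T by (intro integral_nonneg_AE AE_I2)
  show "?x t \<le> 1" for t
    using integral_mono_AE[OF raised_weight_excess_integrable, of "\<lambda>_. 1" t] T prob_space by auto
  show "0 \<le> \<kappa> t" for t by (rule \<kappa>01)
  show "c < 1" "\<exists>\<^sub>\<infinity>t. \<kappa> t \<le> c" by (rule c)+
  have one: "?x (Suc t) \<le> \<kappa> t * ?x t + 3 * \<epsilon> t" for t
  proof -
    have "(\<integral>w. excess S 1 (\<mu> (Suc t) w) ((raised_weight t w + ?T t w) * \<rho> t w) (\<nu> (Suc t) w) \<partial>P)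
       \<le> (\<integral>w. \<kappa> t * ?T t w + 3 * \<epsilon> t \<partial>P)"
      using raised_weight_excess_integrable raised_weight_meas raised_weight_nonneg excess_meas[OF _ raised_weight_meas, of "\<lambda>_. 1"] T
      by (intro update_then) (auto intro!: kernel_perturbation.excess_predict_raise[OF kernels] add_nonneg_nonneg)
    also have "\<dots> = \<kappa> t * ?x t + 3 * \<epsilon> t" using raised_weight_excess_integrable prob_space by simp
    finally show ?thesis by simp
  qed
  have many: "?x t \<le> \<kappa> s * ?x s + 3 * (\<Sum>i=s..<t. \<epsilon> i)" if "s < t" for s t
    using Suc_leI[OF that]
  proof (induction rule: dec_induct)
    case base
    show ?case using one[of s] by simp
  next
    case (step t)
    have "\<kappa> t * ?x t \<le> 1 * ?x t" using \<kappa>01 x0 by (intro mult_right_mono) auto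
    then show ?case using one[of t] step by (simp add: algebra_simps)
  qed
  show "\<exists>N. \<forall>s\<ge>N. \<forall>t>s. ?x t \<le> \<kappa> s * ?x s + e" if e: "0 < e" for e
  proof -
    obtain N where N: "\<And>m n. N \<le> m \<Longrightarrow> (\<Sum>k=m..<n. \<epsilon> k) \<le> e / 3"
      using summable_tail_sums[OF \<epsilon>_summable \<epsilon>_nonneg, of "e/3"] e by auto
    have "?x t \<le> \<kappa> s * ?x s + e" if "N \<le> s" "s < t" for s t
      using N[OF that(1), of t] many[OF that(2)] by linarith
    then show ?thesis by blast
  qed
qed

abbreviation err :: "nat \<Rightarrow> 'w \<Rightarrow> real" where
  "err t w \<equiv> excess S 1 (\<mu> t w) 1 (\<nu> t w)"

lemma err_meas: "err t \<in> borel_measurable (G t)"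
  by (intro excess_meas) auto

lemma err_integrable: "integrable P (err t)"
  by (intro excess_integrable) auto

lemma err_bounds: "w \<in> space P \<Longrightarrow> 0 \<le> err t w" "w \<in> space P \<Longrightarrow> err t w \<le> 1"
  using excess_bounds[of w 1 1] by auto

context
  fixes n :: nat and B :: "'w \<Rightarrow> real"
  assumes B: "B \<in> borel_measurable (G n)" "\<And>w. w \<in> space P \<Longrightarrow> 0 \<le> B w" "integrable P B"
begin

definition weight :: "nat \<Rightarrow> 'w \<Rightarrow> real" where "weight t w = B w * likelihood_ratio n t w"
text \<open>The posterior probability of the first model if the two models compete with odds \<open>1 : B\<close> at time \<open>n\<close>.\<close>

definition posterior :: "nat \<Rightarrow> 'w \<Rightarrow> real" where "posterior t w = 1 / (1 + weight t w)"

lemma weight_nonneg: "w \<in> space P \<Longrightarrow> 0 \<le> weight t w"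
  unfolding weight_def using B likelihood_ratio_nonneg by simp

lemma weight_meas: "n \<le> t \<Longrightarrow> weight t \<in> borel_measurable (G t)"
  unfolding weight_def[abs_def] using meas_mono[OF B(1)] likelihood_ratio_meas by auto

lemma weight_split: "n \<le> s \<Longrightarrow> s \<le> t \<Longrightarrow> weight t w = weight s w * likelihood_ratio s t w"
  by (simp add: weight_def likelihood_ratio_trans mult.assoc)

lemma weight_integral: "n \<le> t \<Longrightarrow> integrable P (weight t)" "n \<le> t \<Longrightarrow> (\<integral>w. weight t w \<partial>P) \<le> (\<integral>w. B w \<partial>P)"
  using likelihood_ratio_integral[OF _ B, of t] by (auto simp: weight_def[abs_def])

lemma posterior_meas: "n \<le> t \<Longrightarrow> posterior t \<in> borel_measurable (G t)"
  unfolding posterior_def[abs_def] using weight_meas by auto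

lemma posterior_bounds:
  assumes "w \<in> space P" shows "0 < posterior t w" "posterior t w \<le> 1"
  using weight_nonneg[OF assms, of t] by (auto simp: posterior_def divide_simps)

lemma posterior_weight: "w \<in> space P \<Longrightarrow> posterior t w * weight t w = 1 - posterior t w"
  using weight_nonneg[of w t] by (simp add: posterior_def field_simps)

lemma bounded_meas_integrable:
  fixes f :: "'w \<Rightarrow> real"
  assumes "f \<in> borel_measurable (G t)" "\<And>w. w \<in> space P \<Longrightarrow> \<bar>f w\<bar> \<le> C"
  shows "integrable P f"
  using assms meas_P by (intro integrable_const_bound[where B=C] AE_I2) auto

lemma posterior_integrable: "n \<le> t \<Longrightarrow> integrable P (posterior t)"
  using posterior_bounds[of _ t] by (intro bounded_meas_integrable[where C=1 and t=t] posterior_meas) (auto simp: less_imp_le)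

text \<open>The unnormalised mixture of both models has density \<open>1 + weight\<close> relative to \<open>P\<close>, so that the mean of the
posterior under \<open>P\<close> is its second moment under the mixture. If the weight is a martingale
under \<open>P\<close>, then the posterior is one under the mixture, and the claim, with equality, is the orthogonality
of its increments. For a supermartingale the inequality remains.\<close>

lemma posterior_increment:
  assumes "n \<le> s" "s \<le> t"
  shows "integrable P (\<lambda>w. (1 + weight t w) * (posterior t w - posterior s w)\<^sup>2)"
    and "(\<integral>w. (1 + weight t w) * (posterior t w - posterior s w)\<^sup>2 \<partial>P) \<le> (\<integral>w. posterior t w \<partial>P) - (\<integral>w. posterior s w \<partial>P)"
proof -
  have t: "n \<le> t" using assms by simp
  have eq: "(1 + weight t w) * (posterior t w - posterior s w)\<^sup>2 = posterior t w - 2 * posterior s w + (posterior s w)\<^sup>2 + (posterior s w)\<^sup>2 * weight s w * likelihood_ratio s t w"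
    if w: "w \<in> space P" for w
  proof -
    have "(1 + weight t w) * posterior t w = 1" using posterior_weight[OF w, of t] by (simp add: algebra_simps)
    then have "(1 + weight t w) * (posterior t w - posterior s w)\<^sup>2 = posterior t w - 2 * posterior s w + (1 + weight t w) * (posterior s w)\<^sup>2"
      by algebra
    then show ?thesis using weight_split[OF assms] by (simp add: algebra_simps)
  qed
  have sq: "(\<lambda>w. (posterior s w)\<^sup>2 * weight s w) \<in> borel_measurable (G s)" "(\<lambda>w. (posterior s w)\<^sup>2) \<in> borel_measurable (G s)"
    using posterior_meas[OF assms(1)] weight_meas[OF assms(1)] by auto
  have pw: "(posterior s w)\<^sup>2 * weight s w = posterior s w - (posterior s w)\<^sup>2" if "w \<in> space P" for w
    using posterior_weight[OF that, of s] by (simp add: power2_eq_square mult.assoc right_diff_distrib)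
  have psq: "(posterior s w)\<^sup>2 \<le> posterior s w" if "w \<in> space P" for w
    using posterior_bounds[OF that, of s] by (simp add: power2_eq_square mult_left_le)
  have i1: "integrable P (\<lambda>w. (posterior s w)\<^sup>2)"
    using order_trans[OF psq posterior_bounds(2)] by (intro bounded_meas_integrable[OF sq(2), of 1]) auto
  have i2: "integrable P (\<lambda>w. (posterior s w)\<^sup>2 * weight s w)"
    using i1 posterior_integrable[OF assms(1)] pw by (subst Bochner_Integration.integrable_cong[OF refl pw]) auto
  have L: "integrable P (\<lambda>w. (posterior s w)\<^sup>2 * weight s w * likelihood_ratio s t w)"
    "(\<integral>w. (posterior s w)\<^sup>2 * weight s w * likelihood_ratio s t w \<partial>P) \<le> (\<integral>w. (posterior s w)\<^sup>2 * weight s w \<partial>P)"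
    using likelihood_ratio_integral[OF assms(2) sq(1) _ i2] weight_nonneg by auto
  show "integrable P (\<lambda>w. (1 + weight t w) * (posterior t w - posterior s w)\<^sup>2)"
    using i1 L(1) posterior_integrable[OF assms(1)] posterior_integrable[OF t] by (subst Bochner_Integration.integrable_cong[OF refl eq]) auto
  have "(\<integral>w. (1 + weight t w) * (posterior t w - posterior s w)\<^sup>2 \<partial>P)
     = (\<integral>w. posterior t w - 2 * posterior s w + (posterior s w)\<^sup>2 + (posterior s w)\<^sup>2 * weight s w * likelihood_ratio s t w \<partial>P)"
    by (rule Bochner_Integration.integral_cong[OF refl eq])
  also have "\<dots> = (\<integral>w. posterior t w \<partial>P) - 2 * (\<integral>w. posterior s w \<partial>P) + (\<integral>w. (posterior s w)\<^sup>2 \<partial>P)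
      + (\<integral>w. (posterior s w)\<^sup>2 * weight s w * likelihood_ratio s t w \<partial>P)"
    using i1 L(1) posterior_integrable[OF assms(1)] posterior_integrable[OF t] by simp
  also have "\<dots> \<le> (\<integral>w. posterior t w \<partial>P) - 2 * (\<integral>w. posterior s w \<partial>P) + (\<integral>w. (posterior s w)\<^sup>2 \<partial>P)
      + (\<integral>w. (posterior s w)\<^sup>2 * weight s w \<partial>P)" using L(2) by simp
  also have "(\<integral>w. (posterior s w)\<^sup>2 * weight s w \<partial>P) = (\<integral>w. posterior s w - (posterior s w)\<^sup>2 \<partial>P)"
    by (rule Bochner_Integration.integral_cong[OF refl pw])
  also have "\<dots> = (\<integral>w. posterior s w \<partial>P) - (\<integral>w. (posterior s w)\<^sup>2 \<partial>P)"
    using i1 posterior_integrable[OF assms(1)] by simp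
  finally show "(\<integral>w. (1 + weight t w) * (posterior t w - posterior s w)\<^sup>2 \<partial>P) \<le> (\<integral>w. posterior t w \<partial>P) - (\<integral>w. posterior s w \<partial>P)"
    by simp
qed

text \<open>The means of the posterior increase by \<open>posterior_increment\<close> and are at most \<open>1\<close>.\<close>

lemma posterior_Cauchy:
  assumes e: "0 < e"
  obtains N where "n \<le> N" "\<And>s t. N \<le> s \<Longrightarrow> s \<le> t \<Longrightarrow> (\<integral>w. posterior t w \<partial>P) - (\<integral>w. posterior s w \<partial>P) \<le> e"
proof -
  define f where "f m = (\<integral>w. posterior (n + m) w \<partial>P)" for m
  have "incseq f"
  proof (rule incseq_SucI)
    fix m
    have "0 \<le> (\<integral>w. (1 + weight (n + Suc m) w) * (posterior (n + Suc m) w - posterior (n + m) w)\<^sup>2 \<partial>P)"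
      using weight_nonneg by (intro integral_nonneg_AE AE_I2) auto
    also have "\<dots> \<le> f (Suc m) - f m" unfolding f_def by (rule posterior_increment) auto
    finally show "f m \<le> f (Suc m)" by simp
  qed
  moreover have "f m \<le> 1" for m
    using integral_mono_AE[OF posterior_integrable, of "n + m" "\<lambda>_. 1"] posterior_bounds prob_space by (auto simp: f_def)
  ultimately have "convergent f" by (auto intro: incseq_convergent simp: convergent_def)
  then have "Cauchy f" by (rule convergent_Cauchy)
  then obtain M where M: "\<And>i j. i \<ge> M \<Longrightarrow> j \<ge> M \<Longrightarrow> norm (f i - f j) < e"
    using e unfolding Cauchy_iff by blast
  show thesis
  proof (rule that[of "n + M"])
    fix s t assume "n + M \<le> s" "s \<le> t"
    then have "M \<le> t - n" "M \<le> s - n" "n \<le> s" "n \<le> t" by auto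
    then show "(\<integral>w. posterior t w \<partial>P) - (\<integral>w. posterior s w \<partial>P) \<le> e"
      using M[of "t - n" "s - n"] by (simp add: f_def)
  qed simp
qed

text \<open>With \<open>u\<close> for the posterior and \<open>\<Lambda>\<close> for the weight, \<open>(1 - u) (\<mu> - \<nu>) = \<mu> - u (\<mu> + \<Lambda> \<nu>)\<close>: the deviation of
\<open>\<mu>\<close> from its share of the unnormalised mixture.\<close>

definition centred :: "nat \<Rightarrow> real" where
  "centred t = (\<integral>w. excess S (1 - posterior t w) (\<mu> t w) (1 - posterior t w) (\<nu> t w) \<partial>P)"

text \<open>Freeze the posterior at time \<open>s\<close>. The weights \<open>1 - u\<^sub>s\<close> and \<open>u\<^sub>s \<Lambda>\<^sub>s\<close> agree at time \<open>s\<close>, and \<open>excess_contract\<close>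
applies. At time \<open>t\<close>, replacing \<open>u\<^sub>s\<close> by \<open>u\<^sub>t\<close> changes the excess by at most \<open>\<bar>u\<^sub>t - u\<^sub>s\<bar> (1 + \<Lambda>\<^sub>t)\<close>, whose mean is
estimated by \<open>posterior_increment\<close>; \<open>\<delta>\<close> is a free parameter from the inequality of arithmetic and geometric means.\<close>

lemma centred_step:
  assumes st: "n \<le> s" "s < t" and \<delta>: "0 < \<delta>"
  shows "centred t \<le> \<kappa> s * centred s + (\<Sum>i=s..<t. \<epsilon> i)
     + ((\<integral>w. posterior t w \<partial>P) - (\<integral>w. posterior s w \<partial>P)) / (2 * \<delta>) + \<delta> / 2 * (1 + (\<integral>w. B w \<partial>P))"
proof -
  have t: "n \<le> t" and s: "n \<le> s" and st': "s \<le> t" using st by auto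
  define a where "a w = 1 - posterior s w" for w
  have a: "a \<in> borel_measurable (G s)" unfolding a_def[abs_def] using posterior_meas[OF s] by auto
  have a0: "0 \<le> a w" "a w \<le> 1" if "w \<in> space P" for w using posterior_bounds[OF that, of s] by (auto simp: a_def)
  have ia: "integrable P a" using a0 by (intro bounded_meas_integrable[OF a, of 1]) auto
  have b: "a w * likelihood_ratio s t w = posterior s w * weight t w" if "w \<in> space P" for w
    using posterior_weight[OF that, of s] weight_split[OF s st', of w] by (simp add: a_def mult.assoc[symmetric])
  have at: "a \<in> borel_measurable (G t)" "(\<lambda>w. a w * likelihood_ratio s t w) \<in> borel_measurable (G t)"
    using meas_mono[OF a st'] likelihood_ratio_meas by auto
  let ?Z = "\<lambda>w. excess S (a w) (\<mu> t w) (a w * likelihood_ratio s t w) (\<nu> t w)"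
  let ?C = "\<lambda>w. (1 + weight t w) * (posterior t w - posterior s w)\<^sup>2"
  have iZ: "integrable P ?Z"
    using a0 likelihood_ratio_nonneg ia by (intro excess_integrable at) auto
  note iC = posterior_increment[OF s st']
  have "centred t \<le> (\<integral>w. ?Z w + ?C w / (2 * \<delta>) + \<delta> / 2 * (1 + weight t w) \<partial>P)"
    unfolding centred_def
  proof (rule integral_mono_AE)
    show "integrable P (\<lambda>w. excess S (1 - posterior t w) (\<mu> t w) (1 - posterior t w) (\<nu> t w))"
      using posterior_meas[OF t] posterior_bounds by (intro excess_integrable Bochner_Integration.integrable_diff posterior_integrable t) auto
    show "integrable P (\<lambda>w. ?Z w + ?C w / (2 * \<delta>) + \<delta> / 2 * (1 + weight t w))"
      using iZ iC(1) weight_integral(1)[OF t] by auto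
    show "AE w in P. excess S (1 - posterior t w) (\<mu> t w) (1 - posterior t w) (\<nu> t w) \<le> ?Z w + ?C w / (2 * \<delta>) + \<delta> / 2 * (1 + weight t w)"
    proof (rule AE_I2)
      fix w assume w: "w \<in> space P"
      let ?d = "\<bar>posterior t w - posterior s w\<bar>"
      have wt0: "0 \<le> weight t w" by (rule weight_nonneg[OF w])
      have 1: "excess S (1 - posterior t w) (\<mu> t w) (1 - posterior t w) (\<nu> t w)
         \<le> ?Z w + \<bar>(1 - posterior t w) - a w\<bar> + \<bar>(1 - posterior t w) - a w * likelihood_ratio s t w\<bar>"
        using pair[OF w, of 0 0 t] posterior_bounds[OF w] a0[OF w] likelihood_ratio_nonneg
        by (intro excess_reweight) (auto simp: subprob_pair_def)
      have "\<bar>(1 - posterior t w) - a w\<bar> = ?d" by (simp add: a_def abs_minus_commute)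
      moreover have "(1 - posterior t w) - a w * likelihood_ratio s t w = (posterior t w - posterior s w) * weight t w"
        unfolding b[OF w] using posterior_weight[OF w, of t] by (simp add: algebra_simps)
      then have "\<bar>(1 - posterior t w) - a w * likelihood_ratio s t w\<bar> = ?d * weight t w"
        using wt0 by (simp add: abs_mult)
      moreover have "?d \<le> ?d\<^sup>2 / (2 * \<delta>) + \<delta> / 2"
      proof -
        \<comment> \<open>arithmetic-geometric mean inequality, written so as to bring in the square\<close>
        have "0 \<le> (?d - \<delta>)\<^sup>2" by simp
        then have "?d * (2 * \<delta>) \<le> ?d\<^sup>2 + \<delta>\<^sup>2" by (simp add: power2_eq_square algebra_simps)
        then show ?thesis using \<delta> by (simp add: field_simps power2_eq_square)
      qed
      then have "(1 + weight t w) * ?d \<le> (1 + weight t w) * (?d\<^sup>2 / (2 * \<delta>) + \<delta> / 2)"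
        using wt0 by (intro mult_left_mono) auto
      ultimately show "excess S (1 - posterior t w) (\<mu> t w) (1 - posterior t w) (\<nu> t w) \<le> ?Z w + ?C w / (2 * \<delta>) + \<delta> / 2 * (1 + weight t w)"
        using 1 by (simp add: algebra_simps)
    qed
  qed
  also have "\<dots> = (\<integral>w. ?Z w \<partial>P) + (\<integral>w. ?C w \<partial>P) / (2 * \<delta>) + \<delta> / 2 * (1 + (\<integral>w. weight t w \<partial>P))"
    using iZ iC(1) weight_integral(1)[OF t] prob_space by (simp add: algebra_simps)
  also have "\<dots> \<le> (\<integral>w. ?Z w \<partial>P) + ((\<integral>w. posterior t w \<partial>P) - (\<integral>w. posterior s w \<partial>P)) / (2 * \<delta>) + \<delta> / 2 * (1 + (\<integral>w. B w \<partial>P))"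
    using iC(2) weight_integral(2)[OF t] \<delta> by (intro add_mono divide_right_mono mult_left_mono) auto
  also have "(\<integral>w. ?Z w \<partial>P) \<le> \<kappa> s * centred s + (\<Sum>i=s..<t. \<epsilon> i)"
  proof -
    have "(\<integral>w. a w \<partial>P) \<le> 1"
      using integral_mono_AE[OF ia, of "\<lambda>_. 1"] a0 prob_space by auto
    then have "(\<Sum>i=s..<t. \<epsilon> i) * (\<integral>w. a w \<partial>P) \<le> (\<Sum>i=s..<t. \<epsilon> i) * 1"
      using \<epsilon>_nonneg by (intro mult_left_mono sum_nonneg)
    then show ?thesis
      using excess_contract[OF st(2) a a0(1) ia] by (simp add: centred_def a_def)
  qed
  finally show ?thesis by simp
qed

lemma centred_tendsto_0: "centred \<longlonglongrightarrow> 0"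
proof -
  let ?x = "\<lambda>m. centred (n + m)"
  have "?x \<longlonglongrightarrow> 0"
  proof (rule contraction_tendsto_0)
    have pb: "0 \<le> 1 - posterior t w" "1 - posterior t w \<le> 1" if "w \<in> space P" for t w
      using posterior_bounds[OF that, of t] by auto
    show "0 \<le> ?x m" for m
      unfolding centred_def using excess_bounds(1)[OF _ pb(1) pb(1)] by (intro integral_nonneg_AE AE_I2) auto
    have "?x m \<le> (\<integral>w. 1 \<partial>P)" for m
      unfolding centred_def
    proof (intro integral_mono_AE AE_I2)
      show "integrable P (\<lambda>w. excess S (1 - posterior (n + m) w) (\<mu> (n + m) w) (1 - posterior (n + m) w) (\<nu> (n + m) w))"
        using posterior_meas[of "n + m"] pb by (intro excess_integrable Bochner_Integration.integrable_diff posterior_integrable) auto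
      show "excess S (1 - posterior (n + m) w) (\<mu> (n + m) w) (1 - posterior (n + m) w) (\<nu> (n + m) w) \<le> 1" if "w \<in> space P" for w
        using excess_bounds(2)[OF that pb(1)[OF that] pb(1)[OF that]] pb(2)[OF that] by (rule order_trans)
    qed auto
    then show "?x m \<le> 1" for m using prob_space by simp
    show "0 \<le> \<kappa> (n + m)" for m by (rule \<kappa>01)
    show "c < 1" by (rule c)
    show "\<exists>\<^sub>\<infinity>m. \<kappa> (n + m) \<le> c"
      unfolding INFM_nat_le
    proof
      fix m
      obtain t where "t \<ge> n + m" "\<kappa> t \<le> c" using c(2) unfolding INFM_nat_le by blast
      then show "\<exists>m'\<ge>m. \<kappa> (n + m') \<le> c" by (intro exI[of _ "t - n"]) auto
    qed
    fix e :: real assume e: "0 < e"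
    define b where "b = 1 + (\<integral>w. B w \<partial>P)"
    have b: "0 < b" unfolding b_def using B(2) by (intro add_pos_nonneg integral_nonneg_AE AE_I2) auto
    \<comment> \<open>chosen such that each of the three error terms of \<open>centred_step\<close> is at most \<open>e / 3\<close>\<close>
    define \<delta> where "\<delta> = 2 * e / (3 * b)"
    have \<delta>: "0 < \<delta>" "\<delta> / 2 * b = e / 3" using e b by (auto simp: \<delta>_def)
    obtain N1 where N1: "\<And>m n. N1 \<le> m \<Longrightarrow> (\<Sum>k=m..<n. \<epsilon> k) \<le> e / 3"
      using summable_tail_sums[OF \<epsilon>_summable \<epsilon>_nonneg, of "e/3"] e by auto
    have "0 < 2 * \<delta> * e / 3" using e \<delta> by simp
    then obtain N2 where N2: "\<And>s t. N2 \<le> s \<Longrightarrow> s \<le> t \<Longrightarrow> (\<integral>w. posterior t w \<partial>P) - (\<integral>w. posterior s w \<partial>P) \<le> 2 * \<delta> * e / 3"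
      using posterior_Cauchy by blast
    have "?x t \<le> \<kappa> (n + s) * ?x s + e" if "max N1 N2 \<le> s" "s < t" for s t
    proof -
      have "((\<integral>w. posterior (n + t) w \<partial>P) - (\<integral>w. posterior (n + s) w \<partial>P)) / (2 * \<delta>) \<le> e / 3"
        using N2[of "n + s" "n + t"] that \<delta> by (simp add: field_simps)
      moreover have "(\<Sum>i=n + s..<n + t. \<epsilon> i) \<le> e / 3" using that by (intro N1) auto
      moreover have "\<delta> / 2 * (1 + (\<integral>w. B w \<partial>P)) = e / 3" using \<delta>(2) by (simp only: b_def)
      moreover have "?x t \<le> \<kappa> (n + s) * ?x s + (\<Sum>i=n + s..<n + t. \<epsilon> i)
         + ((\<integral>w. posterior (n + t) w \<partial>P) - (\<integral>w. posterior (n + s) w \<partial>P)) / (2 * \<delta>) + \<delta> / 2 * (1 + (\<integral>w. B w \<partial>P))"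
        using that \<delta> by (intro centred_step) auto
      ultimately show ?thesis by linarith
    qed
    then show "\<exists>N. \<forall>s\<ge>N. \<forall>t>s. ?x t \<le> \<kappa> (n + s) * ?x s + e" by blast
  qed
  then show ?thesis by (simp add: LIMSEQ_offset add.commute[of n])
qed

text \<open>If the weight exceeds \<open>1/2\<close>, then \<open>1 - u \<ge> 1/3\<close> and the centred error controls the error. Otherwise the
excess over the weighted second measure is at least \<open>1/2\<close>, by \<open>one_minus_le_excess\<close>; its mean remains small if
it is small at time \<open>n\<close>.\<close>

lemma err_le_centred:
  assumes t: "n \<le> t"
  shows "(\<integral>w. err t w \<partial>P) \<le> 3 * centred t
     + 2 * ((\<integral>w. excess S 1 (\<mu> n w) (B w) (\<nu> n w) \<partial>P) + (\<Sum>i=n..<t. \<epsilon> i))"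
proof -
  let ?D = "\<lambda>w. excess S (1 - posterior t w) (\<mu> t w) (1 - posterior t w) (\<nu> t w)"
  let ?Z = "\<lambda>w. excess S 1 (\<mu> t w) (weight t w) (\<nu> t w)"
  have iD: "integrable P ?D"
    using posterior_meas[OF t] posterior_bounds by (intro excess_integrable Bochner_Integration.integrable_diff posterior_integrable t) auto
  have iZ: "integrable P ?Z" using weight_meas[OF t] weight_nonneg by (intro excess_integrable) auto
  have "(\<integral>w. err t w \<partial>P) \<le> (\<integral>w. 3 * ?D w + 2 * ?Z w \<partial>P)"
  proof (rule integral_mono_AE[OF err_integrable])
    show "integrable P (\<lambda>w. 3 * ?D w + 2 * ?Z w)" using iD iZ by auto
    show "AE w in P. err t w \<le> 3 * ?D w + 2 * ?Z w"
      using prob[of t] AE_space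
    proof eventually_elim
      case (elim w)
      then have w: "w \<in> space P" by simp
      have wt0: "0 \<le> weight t w" by (rule weight_nonneg[OF w])
      have D: "?D w = (1 - posterior t w) * err t w"
        using posterior_bounds[OF w, of t] by (intro excess_scale pair w) auto
      have Z: "1 - weight t w \<le> ?Z w" "0 \<le> ?Z w"
        using elim wt0 by (auto intro!: one_minus_le_excess excess_bounds)
      show ?case
      proof (cases "weight t w \<le> 1 / 2")
        case True
        have "0 \<le> ?D w" unfolding D using posterior_bounds[OF w, of t] err_bounds[OF w] by simp
        then show ?thesis using True Z err_bounds[OF w, of t] by linarith
      next
        case False
        then have "1 / 3 \<le> 1 - posterior t w" using wt0 by (simp add: posterior_def field_simps)
        then have "1 / 3 * err t w \<le> ?D w" unfolding D using err_bounds[OF w] by (intro mult_right_mono) auto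
        then show ?thesis using Z by linarith
      qed
    qed
  qed
  also have "\<dots> = 3 * centred t + 2 * (\<integral>w. ?Z w \<partial>P)" using iD iZ by (simp add: centred_def)
  also have "(\<integral>w. ?Z w \<partial>P) \<le> (\<integral>w. excess S 1 (\<mu> n w) (B w) (\<nu> n w) \<partial>P) + (\<Sum>i=n..<t. \<epsilon> i) * (\<integral>w. 1 \<partial>P)"
    unfolding weight_def using B by (intro excess_propagate t) auto
  finally show ?thesis using prob_space by simp
qed

end

text \<open>Choose \<open>n\<close> late, so that the excess over \<open>raised_weight n\<close> and the remaining \<open>\<epsilon>\<close> are small; then use
\<open>raised_weight n\<close> as initial weight.\<close>

theorem err_L1: "(\<lambda>t. \<integral>w. err t w \<partial>P) \<longlonglongrightarrow> 0"
proof (rule LIMSEQ_I)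
  fix e :: real assume e: "0 < e"
  \<comment> \<open>\<open>err_le_centred\<close> will give the bound \<open>3 e / 8 + 2 (e / 8 + e / 8) < e\<close>\<close>
  obtain N1 where N1: "\<And>m n. N1 \<le> m \<Longrightarrow> (\<Sum>k=m..<n. \<epsilon> k) \<le> e / 8"
    using summable_tail_sums[OF \<epsilon>_summable \<epsilon>_nonneg, of "e/8"] e by auto
  have "eventually (\<lambda>t. (\<integral>w. excess S 1 (\<mu> t w) (raised_weight t w) (\<nu> t w) \<partial>P) < e / 8) sequentially"
    using excess_raised_weight_tendsto_0 e by (intro order_tendstoD) auto
  then obtain N2 where N2: "\<And>t. t \<ge> N2 \<Longrightarrow> (\<integral>w. excess S 1 (\<mu> t w) (raised_weight t w) (\<nu> t w) \<partial>P) < e / 8"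
    by (auto simp: eventually_sequentially)
  define n where "n = max N1 N2"
  note B = raised_weight_meas[of n] raised_weight_nonneg[of _ n] raised_weight_integrable[of n]
  have "eventually (\<lambda>t. centred n (raised_weight n) t < e / 8) sequentially"
    using centred_tendsto_0[OF B] e by (intro order_tendstoD) auto
  then obtain N3 where N3: "\<And>t. t \<ge> N3 \<Longrightarrow> centred n (raised_weight n) t < e / 8"
    by (auto simp: eventually_sequentially)
  have "norm ((\<integral>w. err t w \<partial>P) - 0) < e" if t: "t \<ge> max n N3" for t
  proof -
    have "(\<integral>w. err t w \<partial>P) < e"
      using err_le_centred[OF B, of t] N3[of t] N2[of n] N1[of n t] t e by (simp add: n_def)
    moreover have "0 \<le> (\<integral>w. err t w \<partial>P)" using err_bounds by (intro integral_nonneg_AE AE_I2)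
    ultimately show ?thesis by simp
  qed
  then show "\<exists>N. \<forall>t\<ge>N. norm ((\<integral>w. err t w \<partial>P) - 0) < e" by blast
qed

end

section \<open>Almost sure convergence of the error\<close>

context perturbed_filter_pair
begin

lemma likelihood_ratio_integrable:
  assumes "n \<le> t" shows "integrable P (likelihood_ratio n t)"
proof -
  have "integrable P (\<lambda>w. 1 * likelihood_ratio n t w)"
    by (rule likelihood_ratio_integral[OF assms, THEN conjunct1]) simp_all
  then show ?thesis by simp
qed

definition two_sided_excess :: "nat \<Rightarrow> nat \<Rightarrow> 'w \<Rightarrow> real" where
  "two_sided_excess n t w = 2 * excess S 1 (\<mu> t w) (likelihood_ratio n t w) (\<nu> t w) + likelihood_ratio n t w - 1"

lemma two_sided_excess_integrable:
  assumes "n \<le> t" shows "integrable P (two_sided_excess n t)"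
proof -
  have "integrable P (\<lambda>w. excess S 1 (\<mu> t w) (likelihood_ratio n t w) (\<nu> t w))"
    by (rule excess_integrable[OF _ likelihood_ratio_meas _ likelihood_ratio_nonneg]) simp_all
  moreover note likelihood_ratio_integrable[OF assms]
  ultimately show ?thesis unfolding two_sided_excess_def[abs_def]
    by (intro Bochner_Integration.integrable_diff Bochner_Integration.integrable_add integrable_mult_right) auto
qed

text \<open>The excess is taken with both weights multiplied by the indicator of \<open>A\<close>, which localises \<open>update\<close> to \<open>A\<close>.\<close>

lemma two_sided_excess_step:
  assumes nt: "n \<le> t" and A: "A \<in> sets (G t)"
  shows "(\<integral>w. indicator A w * two_sided_excess n (Suc t) w \<partial>P)
    \<le> (\<integral>w. indicator A w * two_sided_excess n t w \<partial>P) + 2 * \<epsilon> t"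
proof -
  let ?I = "indicator A :: 'w \<Rightarrow> real" and ?L = "likelihood_ratio n t"
  have AP: "A \<in> events" using A sets_G by auto
  have I: "?I \<in> borel_measurable (G t)" using A by simp
  have IL: "(\<lambda>w. ?I w * ?L w) \<in> borel_measurable (G t)" using I likelihood_ratio_meas by auto
  have iL: "integrable P (likelihood_ratio n t)" "integrable P (likelihood_ratio n (Suc t))"
    using nt by (auto intro!: likelihood_ratio_integrable)
  have iI: "integrable P ?I" using AP by (simp add: emeasure_eq_measure)
  have iIL: "integrable P (\<lambda>w. ?I w * ?L w)" "integrable P (\<lambda>w. ?I w * likelihood_ratio n (Suc t) w)"
    using integrable_mult_indicator[OF AP iL(1)] integrable_mult_indicator[OF AP iL(2)]
    by (simp_all only: real_scaleR_def)
  have z: "excess S (?I w) \<mu>' (?I w * b) \<nu>' = ?I w * excess S 1 \<mu>' b \<nu>'" for w \<mu>' b \<nu>'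
  proof -
    have "sets S \<noteq> {}" using sets.top[of S] by blast
    then show ?thesis by (cases "w \<in> A") (simp_all add: excess_def)
  qed
  let ?Z = "\<lambda>t w. excess S 1 (\<mu> t w) (likelihood_ratio n t w) (\<nu> t w)"
  have iZ: "integrable P (?Z t)" for t
    by (rule excess_integrable[OF _ likelihood_ratio_meas _ likelihood_ratio_nonneg]) simp_all
  have iIZ: "integrable P (\<lambda>w. ?I w * ?Z t w)" for t
    using integrable_mult_indicator[OF AP iZ] by (simp only: real_scaleR_def)
  have predict: "?I w * excess S 1 (\<mu> t w \<bind> k t) (?L w) (\<nu> t w \<bind> kh t) \<le> ?I w * ?Z t w + ?I w * \<epsilon> t"
    if "\<mu> t w \<in> space (prob_algebra S)" "\<nu> t w \<in> space (prob_algebra S)" for w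
    using kernel_perturbation.excess_predict[OF kernels that zero_le_one likelihood_ratio_nonneg]
    by (cases "w \<in> A") auto
  have "(\<integral>w. excess S (?I w) (\<mu> (Suc t) w) (?I w * ?L w * \<rho> t w) (\<nu> (Suc t) w) \<partial>P)
     \<le> (\<integral>w. ?I w * ?Z t w + ?I w * \<epsilon> t \<partial>P)"
    using iIZ iI likelihood_ratio_nonneg
    by (intro update_then[OF I IL]) 
       (auto intro!: predict simp: z)
  also have "\<dots> = (\<integral>w. ?I w * ?Z t w \<partial>P) + prob A * \<epsilon> t"
    using iIZ iI AP by (simp add: Int_absorb2 sets.sets_into_space)
  also have "\<dots> \<le> (\<integral>w. ?I w * ?Z t w \<partial>P) + 1 * \<epsilon> t"
    using \<epsilon>_nonneg by (intro add_mono mult_right_mono) auto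
  finally have 1: "(\<integral>w. ?I w * ?Z (Suc t) w \<partial>P) \<le> (\<integral>w. ?I w * ?Z t w \<partial>P) + \<epsilon> t"
    using nt by (simp add: mult.assoc z likelihood_ratio_Suc)
  have 2: "(\<integral>w. ?I w * likelihood_ratio n (Suc t) w \<partial>P) \<le> (\<integral>w. ?I w * ?L w \<partial>P)"
    using ratio[OF IL _ iIL(1)] likelihood_ratio_nonneg nt by (simp add: likelihood_ratio_Suc mult.assoc)
  have split: "(\<integral>w. ?I w * two_sided_excess n r w \<partial>P) = 2 * (\<integral>w. ?I w * ?Z r w \<partial>P) + (\<integral>w. ?I w * likelihood_ratio n r w \<partial>P) - (\<integral>w. ?I w \<partial>P)"
    if "integrable P (\<lambda>w. ?I w * likelihood_ratio n r w)" for r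
  proof -
    have "(\<integral>w. ?I w * two_sided_excess n r w \<partial>P) = (\<integral>w. 2 * (?I w * ?Z r w) + ?I w * likelihood_ratio n r w - ?I w \<partial>P)"
      by (intro Bochner_Integration.integral_cong) (auto simp: two_sided_excess_def algebra_simps)
    also have "\<dots> = 2 * (\<integral>w. ?I w * ?Z r w \<partial>P) + (\<integral>w. ?I w * likelihood_ratio n r w \<partial>P) - (\<integral>w. ?I w \<partial>P)"
      using that iIZ iI by simp
    finally show ?thesis .
  qed
  show ?thesis using split[OF iIL(1)] split[OF iIL(2)] 1 2 by simp
qed

text \<open>The maximal inequality for nonnegative supermartingales, applied to the two-sided excess, which dominates
the error and is twice the error at time \<open>n\<close>. Here \<open>A t\<close> is the event that the error has stayed below \<open>a\<close>
up to time \<open>t\<close>.\<close>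

lemma err_maximal:
  assumes a: "0 < a" and nt: "n \<le> t"
  shows "a * prob {w\<in>space P. \<exists>s\<in>{n..t}. a < err s w} \<le> 2 * (\<integral>w. err n w \<partial>P) + 2 * (\<Sum>i=n..<t. \<epsilon> i)"
proof -
  define A where "A t = {w\<in>space P. \<forall>s\<in>{n..t}. err s w \<le> a}" for t
  have A: "A t \<in> sets (G t)" for t
  proof -
    have "(\<lambda>w. err s w) \<in> borel_measurable (G t)" if "s \<in> {n..t}" for s
      using meas_mono[OF err_meas] that by auto
    then have "{w\<in>space (G t). \<forall>s\<in>{n..t}. err s w \<le> a} \<in> sets (G t)" by measurable
    then show ?thesis by (simp add: A_def space_G)
  qed
  have AP: "A t \<in> events" for t using A sets_G by blast
  let ?I = "\<lambda>t. indicator (A t) :: 'w \<Rightarrow> real"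
  have int: "integrable P (\<lambda>w. ?I s w * two_sided_excess n r w)" if "n \<le> r" for r s
    using integrable_mult_indicator[OF AP two_sided_excess_integrable[OF that]] by (simp only: real_scaleR_def)
  have compl: "{w\<in>space P. \<exists>s\<in>{n..t}. a < err s w} = space P - A t" for t
    by (auto simp: A_def not_le)
  have claim: "a * prob (space P - A t) + (\<integral>w. ?I t w * two_sided_excess n t w \<partial>P) \<le> 2 * (\<integral>w. err n w \<partial>P) + 2 * (\<Sum>i=n..<t. \<epsilon> i)"
    using nt
  proof (induction rule: dec_induct)
    case base
    have "a * prob (space P - A n) = (\<integral>w. a * indicator (space P - A n) w \<partial>P)"
      using AP[of n] by simp
    also have "\<dots> + (\<integral>w. ?I n w * two_sided_excess n n w \<partial>P) = (\<integral>w. a * indicator (space P - A n) w + ?I n w * two_sided_excess n n w \<partial>P)"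
      using AP[of n] int[of n n] by (intro Bochner_Integration.integral_add[symmetric]) (auto simp: emeasure_eq_measure)
    also have "\<dots> \<le> (\<integral>w. 2 * err n w \<partial>P)"
    proof (intro integral_mono_AE AE_I2)
      show "a * indicator (space P - A n) w + ?I n w * two_sided_excess n n w \<le> 2 * err n w" if "w \<in> space P" for w
        using that err_bounds[OF that, of n] a by (cases "w \<in> A n") (auto simp: A_def two_sided_excess_def)
    qed (use AP[of n] int[of n n] err_integrable in \<open>auto simp: emeasure_eq_measure\<close>)
    finally show ?case using err_integrable by simp
  next
    case (step t)
    let ?B = "A t - A (Suc t)"
    have B: "?B \<in> events" using AP by auto
    have sub: "A (Suc t) \<subseteq> A t" by (auto simp: A_def)
    have nS: "n \<le> Suc t" using step by simp
    have "prob (space P - A (Suc t)) = prob (space P - A t) + prob ?B"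
    proof -
      have "space P - A (Suc t) = (space P - A t) \<union> ?B" using sub sets.sets_into_space[OF AP] by auto
      moreover have "prob ((space P - A t) \<union> ?B) = prob (space P - A t) + prob ?B"
        using AP B by (intro finite_measure_Union) auto
      ultimately show ?thesis by simp
    qed
    moreover have "a * prob ?B + (\<integral>w. ?I (Suc t) w * two_sided_excess n (Suc t) w \<partial>P) \<le> (\<integral>w. ?I t w * two_sided_excess n (Suc t) w \<partial>P)"
    proof -
      have "a * prob ?B + (\<integral>w. ?I (Suc t) w * two_sided_excess n (Suc t) w \<partial>P)
         = (\<integral>w. a * indicator ?B w + ?I (Suc t) w * two_sided_excess n (Suc t) w \<partial>P)"
        using B int[OF nS] by (subst Bochner_Integration.integral_add) (auto simp: emeasure_eq_measure)
      also have "\<dots> \<le> (\<integral>w. ?I t w * two_sided_excess n (Suc t) w \<partial>P)"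
      proof (rule integral_mono_AE)
        show "AE w in P. a * indicator ?B w + ?I (Suc t) w * two_sided_excess n (Suc t) w \<le> ?I t w * two_sided_excess n (Suc t) w"
          using prob[of "Suc t"] AE_space
        proof eventually_elim
          case (elim w)
          have le: "err (Suc t) w \<le> two_sided_excess n (Suc t) w"
            unfolding two_sided_excess_def using elim likelihood_ratio_nonneg by (intro excess_le_two_sided) auto
          have "a < err (Suc t) w" if "w \<in> ?B"
            using that by (auto simp: A_def le_Suc_eq)
          then show ?case using le sub by (cases "w \<in> A t"; cases "w \<in> A (Suc t)") auto
        qed
      qed (use B int[OF nS] in \<open>auto simp: emeasure_eq_measure\<close>)
      finally show ?thesis .
    qed
    moreover have "(\<integral>w. ?I t w * two_sided_excess n (Suc t) w \<partial>P) \<le> (\<integral>w. ?I t w * two_sided_excess n t w \<partial>P) + 2 * \<epsilon> t"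
      by (rule two_sided_excess_step[OF step(1) A])
    moreover have "(\<Sum>i=n..<Suc t. \<epsilon> i) = (\<Sum>i=n..<t. \<epsilon> i) + \<epsilon> t" using step by simp
    ultimately show ?case using step.IH by (simp add: algebra_simps)
  qed
  have "0 \<le> (\<integral>w. ?I t w * two_sided_excess n t w \<partial>P)"
  proof (rule integral_nonneg_AE)
    show "AE w in P. 0 \<le> ?I t w * two_sided_excess n t w"
      using prob[of t] AE_space
    proof eventually_elim
      case (elim w)
      have "err t w \<le> two_sided_excess n t w"
        unfolding two_sided_excess_def using elim likelihood_ratio_nonneg by (intro excess_le_two_sided) auto
      then show ?case using err_bounds[of w t] elim by auto
    qed
  qed
  then show ?thesis using claim unfolding compl by linarith
qed

text \<open>By \<open>err_maximal\<close> the probability of an error above \<open>a\<close> after time \<open>n\<close> is controlled by the mean error at time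
\<open>n\<close> and a tail of \<open>\<epsilon>\<close>, and both are small for late \<open>n\<close>.\<close>

theorem err_AE: "AE w in P. (\<lambda>t. err t w) \<longlonglongrightarrow> 0"
proof -
  have ev: "AE w in P. \<exists>N. \<forall>t\<ge>N. err t w \<le> a" if a: "0 < a" for a
  proof -
    define Bad where "Bad n = {w\<in>space P. \<exists>s\<ge>n. a < err s w}" for n
    define C where "C n m = {w\<in>space P. \<exists>s\<in>{n..n + m}. a < err s w}" for n m
    have errP: "err t \<in> borel_measurable P" for t using err_meas meas_P by blast
    have C: "C n m \<in> events" for n m unfolding C_def using errP by measurable
    have Bad: "Bad n \<in> events" for n unfolding Bad_def using errP by measurable
    have BC: "Bad n = (\<Union>m. C n m)" for n
    proof (intro set_eqI iffI)
      fix w assume "w \<in> Bad n"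
      then obtain s where "w \<in> space P" "n \<le> s" "a < err s w" by (auto simp: Bad_def)
      then have "w \<in> C n (s - n)" by (auto simp: C_def intro!: bexI[of _ s])
      then show "w \<in> (\<Union>m. C n m)" by blast
    next
      show "w \<in> Bad n" if "w \<in> (\<Union>m. C n m)" for w
        using that by (auto simp: Bad_def C_def)
    qed
    have small: "prob (Bad n) \<le> (2 * (\<integral>w. err n w \<partial>P) + 2 * e) / a"
      if e: "\<And>m. (\<Sum>i=n..<m. \<epsilon> i) \<le> e" for n e
    proof -
      have "incseq (C n)" by (force simp: incseq_def C_def)
      then have "(\<lambda>m. prob (C n m)) \<longlonglongrightarrow> prob (Bad n)"
        unfolding BC using C by (intro finite_Lim_measure_incseq) auto
      moreover have "prob (C n m) \<le> (2 * (\<integral>w. err n w \<partial>P) + 2 * e) / a" for m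
        using err_maximal[OF a, of n "n + m"] e[of "n + m"] a by (simp add: C_def field_simps)
      ultimately show ?thesis by (intro LIMSEQ_le_const2[of "\<lambda>m. prob (C n m)"]) auto
    qed
    have "prob (\<Inter>n. Bad n) \<le> r" if r: "0 < r" for r
    proof -
      have ra: "0 < r * a / 4" using r a by simp
      obtain N1 where N1: "\<And>m n. N1 \<le> m \<Longrightarrow> (\<Sum>k=m..<n. \<epsilon> k) \<le> r * a / 4"
        using summable_tail_sums[OF \<epsilon>_summable \<epsilon>_nonneg ra] by blast
      have "eventually (\<lambda>t. (\<integral>w. err t w \<partial>P) < r * a / 4) sequentially"
        using err_L1 ra by (intro order_tendstoD) auto
      then obtain N2 where N2: "\<And>t. t \<ge> N2 \<Longrightarrow> (\<integral>w. err t w \<partial>P) < r * a / 4"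
        by (auto simp: eventually_sequentially)
      define n where "n = max N1 N2"
      have "prob (\<Inter>n. Bad n) \<le> prob (Bad n)" using Bad by (intro finite_measure_mono) auto
      also have "\<dots> \<le> (2 * (\<integral>w. err n w \<partial>P) + 2 * (r * a / 4)) / a"
        by (intro small N1) (simp add: n_def)
      also have "\<dots> \<le> r" using N2[of n] a by (simp add: n_def field_simps)
      finally show ?thesis .
    qed
    then have "prob (\<Inter>n. Bad n) \<le> 0" by (rule field_le_epsilon) simp
    then have "(\<Inter>n. Bad n) \<in> null_sets P"
      using Bad by (intro null_setsI) (auto simp: emeasure_eq_measure measure_le_0_iff)
    then have "AE w in P. w \<notin> (\<Inter>n. Bad n)" by (rule AE_not_in)
    then show ?thesis using AE_space
      by eventually_elim (auto simp: Bad_def not_less)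
  qed
  have "AE w in P. \<forall>j::nat. \<exists>N. \<forall>t\<ge>N. err t w \<le> 1 / Suc j"
    unfolding AE_all_countable by (intro allI ev) simp
  then show ?thesis using AE_space
  proof eventually_elim
    case (elim w)
    show ?case
    proof (rule LIMSEQ_I)
      fix r :: real assume "0 < r"
      then obtain j where j: "1 / Suc j < r" using reals_Archimedean[of r] by (auto simp: inverse_eq_divide)
      obtain N where "\<And>t. t \<ge> N \<Longrightarrow> err t w \<le> 1 / Suc j" using elim by blast
      then have "norm (err t w - 0) < r" if "t \<ge> N" for t
        using that j err_bounds[of w t] elim by fastforce
      then show "\<exists>N. \<forall>t\<ge>N. norm (err t w - 0) < r" by blast
    qed
  qed
qed

end

section \<open>Bayes updates averaged over the observation\<close>

lemma emeasure_bayes_update: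
  assumes h: "h \<in> borel_measurable \<mu>" and A: "A \<in> sets \<mu>"
  shows "emeasure (bayes_update h \<mu>) A = (\<integral>\<^sup>+x\<in>A. ennreal (h x) \<partial>\<mu>) / (\<integral>\<^sup>+x. ennreal (h x) \<partial>\<mu>)"
proof -
  note [measurable] = h A
  have "emeasure (bayes_update h \<mu>) A = (\<integral>\<^sup>+x. ennreal (h x) * indicator A x / (\<integral>\<^sup>+z. ennreal (h z) \<partial>\<mu>) \<partial>\<mu>)"
    unfolding bayes_update_def
    by (subst emeasure_density) (auto intro!: nn_integral_cong simp: divide_ennreal_def mult_ac)
  also have "\<dots> = (\<integral>\<^sup>+x\<in>A. ennreal (h x) \<partial>\<mu>) / (\<integral>\<^sup>+x. ennreal (h x) \<partial>\<mu>)"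
    by (rule nn_integral_divide) measurable
  finally show ?thesis .
qed

lemma sets_bayes_update [simp]: "sets (bayes_update h \<mu>) = sets \<mu>"
  and space_bayes_update [simp]: "space (bayes_update h \<mu>) = space \<mu>"
  by (simp_all add: bayes_update_def)

lemma ennreal_divide_self_le_1: "(x::ennreal) / x \<le> 1"
proof (cases "x = 0 \<or> x = top")
  case True
  then show ?thesis by (auto simp: divide_ennreal_def)
next
  case False
  then show ?thesis by (simp add: ennreal_divide_self less_top)
qed

lemma subprob_bayes_update:
  assumes h: "h \<in> borel_measurable M" and \<mu>: "\<mu> \<in> space (subprob_algebra M)"
  shows "bayes_update h \<mu> \<in> space (subprob_algebra M)"
proof -
  have s: "sets \<mu> = sets M" "subprob_space \<mu>" using \<mu> by (auto simp: space_subprob_algebra)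
  have h': "h \<in> borel_measurable \<mu>" using h s by (simp cong: measurable_cong_sets)
  have "(\<integral>\<^sup>+x. ennreal (h x) * indicator (space \<mu>) x \<partial>\<mu>) = (\<integral>\<^sup>+x. ennreal (h x) \<partial>\<mu>)"
    by (intro nn_integral_cong) auto
  then have "emeasure (bayes_update h \<mu>) (space (bayes_update h \<mu>)) \<le> 1"
    using emeasure_bayes_update[OF h' sets.top] ennreal_divide_self_le_1 by simp
  then have "subprob_space (bayes_update h \<mu>)"
    using subprob_space.subprob_not_empty[OF s(2)] by (intro subprob_spaceI) auto
  then show ?thesis using s by (simp add: space_subprob_algebra)
qed

locale likelihood = T: sigma_finite_measure T for T :: "'y measure" +
  fixes S :: "'x measure" and g :: "'y \<Rightarrow> 'x \<Rightarrow> real"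
  assumes g_meas [measurable]: "(\<lambda>(y, x). g y x) \<in> borel_measurable (T \<Otimes>\<^sub>M S)"
    and g_pos: "\<And>y x. y \<in> space T \<Longrightarrow> x \<in> space S \<Longrightarrow> 0 < g y x"
    and g_int: "\<And>x. x \<in> space S \<Longrightarrow> (\<integral>\<^sup>+y. ennreal (g y x) \<partial>T) = 1"
begin

definition evidence :: "'y \<Rightarrow> 'x measure \<Rightarrow> ennreal" where
  "evidence y \<mu> = (\<integral>\<^sup>+x. ennreal (g y x) \<partial>\<mu>)"

lemma g_section: "y \<in> space T \<Longrightarrow> g y \<in> borel_measurable S"
  using measurable_compose[OF measurable_Pair1' g_meas, of y] by simp

lemma g_section': "x \<in> space S \<Longrightarrow> (\<lambda>y. g y x) \<in> borel_measurable T"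
  using measurable_compose[OF measurable_Pair2' g_meas, of x] by simp

lemma evidence_measurable:
  assumes p: "p \<in> measurable N (subprob_algebra S)"
  shows "(\<lambda>(w, y). evidence y (p w)) \<in> borel_measurable (N \<Otimes>\<^sub>M T)"
proof -
  have "(\<lambda>z. integral\<^sup>N (p (fst z)) (\<lambda>x. ennreal (g (snd z) x))) \<in> borel_measurable (N \<Otimes>\<^sub>M T)"
  proof (rule nn_integral_measurable_subprob_algebra2)
    show "(\<lambda>(z, x). ennreal (g (snd z) x)) \<in> borel_measurable ((N \<Otimes>\<^sub>M T) \<Otimes>\<^sub>M S)" by measurable
    show "(\<lambda>z. p (fst z)) \<in> measurable (N \<Otimes>\<^sub>M T) (subprob_algebra S)" using p by measurable
  qed
  then show ?thesis by (simp add: evidence_def case_prod_beta')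
qed

lemma update_measurable:
  assumes p: "p \<in> measurable N (subprob_algebra S)"
  shows "(\<lambda>(w, y). bayes_update (g y) (p w)) \<in> measurable (N \<Otimes>\<^sub>M T) (subprob_algebra S)"
proof (rule measurable_subprob_algebra)
  have sub: "bayes_update (g y) (p w) \<in> space (subprob_algebra S)" if "w \<in> space N" "y \<in> space T" for w y
    using that g_section measurable_space[OF p] by (intro subprob_bayes_update) auto
  show "subprob_space (case z of (w, y) \<Rightarrow> bayes_update (g y) (p w))" if "z \<in> space (N \<Otimes>\<^sub>M T)" for z
    using that sub by (auto simp: space_pair_measure space_subprob_algebra)
  show "sets (case z of (w, y) \<Rightarrow> bayes_update (g y) (p w)) = sets S" if "z \<in> space (N \<Otimes>\<^sub>M T)" for z
    using that measurable_space[OF p] by (auto simp: space_pair_measure space_subprob_algebra)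
  fix A assume A[measurable]: "A \<in> sets S"
  have 1: "(\<lambda>z. integral\<^sup>N (p (fst z)) (\<lambda>x. ennreal (g (snd z) x) * indicator A x)) \<in> borel_measurable (N \<Otimes>\<^sub>M T)"
  proof (rule nn_integral_measurable_subprob_algebra2)
    show "(\<lambda>(z, x). ennreal (g (snd z) x) * indicator A x) \<in> borel_measurable ((N \<Otimes>\<^sub>M T) \<Otimes>\<^sub>M S)" by measurable
    show "(\<lambda>z. p (fst z)) \<in> measurable (N \<Otimes>\<^sub>M T) (subprob_algebra S)" using p by measurable
  qed
  have 2: "(\<lambda>z. evidence (snd z) (p (fst z))) \<in> borel_measurable (N \<Otimes>\<^sub>M T)"
    using evidence_measurable[OF p] by (simp add: case_prod_beta')
  have "(\<lambda>z. integral\<^sup>N (p (fst z)) (\<lambda>x. ennreal (g (snd z) x) * indicator A x) / evidence (snd z) (p (fst z)))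
    \<in> borel_measurable (N \<Otimes>\<^sub>M T)"
    using 1 2 by (rule borel_measurable_divide_ennreal)
  then show "(\<lambda>z. emeasure (case z of (w, y) \<Rightarrow> bayes_update (g y) (p w)) A) \<in> borel_measurable (N \<Otimes>\<^sub>M T)"
  proof (rule measurable_cong[THEN iffD1, rotated])
    fix z assume "z \<in> space (N \<Otimes>\<^sub>M T)"
    then obtain w y where z: "z = (w, y)" "w \<in> space N" "y \<in> space T" by (auto simp: space_pair_measure)
    have s: "sets (p w) = sets S" using measurable_space[OF p z(2)] by (simp add: space_subprob_algebra)
    then have "g y \<in> borel_measurable (p w)" using g_section[OF z(3)] by (simp cong: measurable_cong_sets)
    then show "integral\<^sup>N (p (fst z)) (\<lambda>x. ennreal (g (snd z) x) * indicator A x) / evidence (snd z) (p (fst z))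
       = emeasure (case z of (w, y) \<Rightarrow> bayes_update (g y) (p w)) A"
      using s A z by (simp add: emeasure_bayes_update evidence_def)
  qed
qed

text \<open>Averaged over the observation with respect to \<open>T\<close>, the unnormalised update gives back the prior, by Tonelli.\<close>

lemma integral_evidence:
  assumes \<mu>: "\<mu> \<in> space (subprob_algebra S)" and A: "A \<in> sets S"
  shows "(\<integral>\<^sup>+y. (\<integral>\<^sup>+x\<in>A. ennreal (g y x) \<partial>\<mu>) \<partial>T) = emeasure \<mu> A"
    and "(\<lambda>y. \<integral>\<^sup>+x\<in>A. ennreal (g y x) \<partial>\<mu>) \<in> borel_measurable T"
proof -
  have s[measurable_cong]: "sets \<mu> = sets S" and "subprob_space \<mu>" using \<mu> by (auto simp: space_subprob_algebra)
  interpret subprob_space \<mu> by fact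
  interpret pair_sigma_finite T \<mu> by unfold_locales
  have sp: "space \<mu> = space S" using s by (rule sets_eq_imp_space_eq)
  note A[measurable]
  have m: "(\<lambda>(y, x). ennreal (g y x) * indicator A x) \<in> borel_measurable (T \<Otimes>\<^sub>M \<mu>)" by measurable
  show "(\<lambda>y. \<integral>\<^sup>+x\<in>A. ennreal (g y x) \<partial>\<mu>) \<in> borel_measurable T"
    by (rule sigma_finite_measure.borel_measurable_nn_integral[OF _ m]) unfold_locales
  have "(\<integral>\<^sup>+y. (\<integral>\<^sup>+x\<in>A. ennreal (g y x) \<partial>\<mu>) \<partial>T) = (\<integral>\<^sup>+x. (\<integral>\<^sup>+y. ennreal (g y x) * indicator A x \<partial>T) \<partial>\<mu>)"
    using Fubini'[OF m] by simp
  also have "\<dots> = (\<integral>\<^sup>+x. indicator A x \<partial>\<mu>)"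
  proof (rule nn_integral_cong)
    fix x assume "x \<in> space \<mu>"
    then show "(\<integral>\<^sup>+y. ennreal (g y x) * indicator A x \<partial>T) = indicator A x"
      using g_int[of x] g_section'[of x] sp by (subst nn_integral_multc) auto
  qed
  also have "\<dots> = emeasure \<mu> A" using A s by simp
  finally show "(\<integral>\<^sup>+y. (\<integral>\<^sup>+x\<in>A. ennreal (g y x) \<partial>\<mu>) \<partial>T) = emeasure \<mu> A" .
qed


lemma AE_evidence_finite:
  assumes \<mu>: "\<mu> \<in> space (subprob_algebra S)"
  shows "AE y in T. evidence y \<mu> < \<infinity>"
proof -
  have s: "sets \<mu> = sets S" "subprob_space \<mu>" using \<mu> by (auto simp: space_subprob_algebra)
  have sp: "space \<mu> = space S" using s(1) by (rule sets_eq_imp_space_eq)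
  have e: "evidence y \<mu> = (\<integral>\<^sup>+x\<in>(space S). ennreal (g y x) \<partial>\<mu>)" for y
    unfolding evidence_def sp[symmetric] by (intro nn_integral_cong) auto
  have "(\<lambda>y. evidence y \<mu>) \<in> borel_measurable T" "(\<integral>\<^sup>+y. evidence y \<mu> \<partial>T) \<noteq> \<infinity>"
    using integral_evidence[OF \<mu> sets.top] subprob_space.emeasure_subprob_space_less_top[OF s(2)] by (auto simp: e)
  from nn_integral_PInf_AE[OF this] show ?thesis by (auto simp: less_top)
qed

lemma AE_evidence_pos:
  assumes \<mu>: "\<mu> \<in> space (prob_algebra S)"
  shows "AE y in T. 0 < evidence y \<mu>"
proof (rule AE_I2)
  fix y assume y: "y \<in> space T"
  have s: "sets \<mu> = sets S" "prob_space \<mu>" using \<mu> by (auto simp: space_prob_algebra)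
  have sp: "space \<mu> = space S" using s(1) by (rule sets_eq_imp_space_eq)
  interpret prob_space \<mu> by fact
  have m: "(\<lambda>x. ennreal (g y x)) \<in> borel_measurable \<mu>"
    using g_section[OF y] s(1) by (simp cong: measurable_cong_sets)
  have "evidence y \<mu> \<noteq> 0"
  proof
    assume "evidence y \<mu> = 0"
    then have "AE x in \<mu>. ennreal (g y x) = 0" using nn_integral_0_iff_AE[OF m] by (simp add: evidence_def)
    then have "AE x in \<mu>. False" using AE_space
      by eventually_elim (use g_pos[OF y] sp in \<open>force simp: ennreal_eq_0_iff\<close>)
    then show False by simp
  qed
  then show "0 < evidence y \<mu>" by (simp add: zero_less_iff_neq_zero)
qed

lemma bayes_update_prob:
  assumes \<mu>: "\<mu> \<in> space (subprob_algebra S)" and y: "y \<in> space T"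
    and e: "evidence y \<mu> \<noteq> 0" "evidence y \<mu> < \<infinity>"
  shows "bayes_update (g y) \<mu> \<in> space (prob_algebra S)"
proof -
  have s: "sets \<mu> = sets S" using \<mu> by (auto simp: space_subprob_algebra)
  have h: "g y \<in> borel_measurable \<mu>" using g_section[OF y] s by (simp cong: measurable_cong_sets)
  have "(\<integral>\<^sup>+x. ennreal (g y x) * indicator (space \<mu>) x \<partial>\<mu>) = evidence y \<mu>"
    unfolding evidence_def by (intro nn_integral_cong) auto
  then have "emeasure (bayes_update (g y) \<mu>) (space (bayes_update (g y) \<mu>)) = 1"
    using emeasure_bayes_update[OF h sets.top] e by (simp add: evidence_def[symmetric] ennreal_divide_self less_top)
  then show ?thesis using s by (auto simp: space_prob_algebra intro!: prob_spaceI)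
qed

lemma emeasure_update_times_evidence:
  assumes \<mu>: "\<mu> \<in> space (subprob_algebra S)" and y: "y \<in> space T"
    and e: "evidence y \<mu> < \<infinity>" and A: "A \<in> sets S"
  shows "emeasure (bayes_update (g y) \<mu>) A * evidence y \<mu> = (\<integral>\<^sup>+x\<in>A. ennreal (g y x) \<partial>\<mu>)"
proof -
  have s: "sets \<mu> = sets S" using \<mu> by (auto simp: space_subprob_algebra)
  have h: "g y \<in> borel_measurable \<mu>" using g_section[OF y] s by (simp cong: measurable_cong_sets)
  have le: "(\<integral>\<^sup>+x\<in>A. ennreal (g y x) \<partial>\<mu>) \<le> evidence y \<mu>"
    unfolding evidence_def by (intro nn_integral_mono) (auto simp: indicator_def)
  have "emeasure (bayes_update (g y) \<mu>) A = (\<integral>\<^sup>+x\<in>A. ennreal (g y x) \<partial>\<mu>) / evidence y \<mu>"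
    using emeasure_bayes_update[OF h] A s by (simp add: evidence_def)
  moreover have "a / b * b = a" if "a \<le> b" "b < top" for a b :: ennreal
  proof (cases "b = 0")
    case False
    then show ?thesis using that ennreal_divide_times[of a b b] by (simp add: ennreal_times_divide ennreal_mult_divide_eq less_top mult.commute)
  qed (use that in simp)
  ultimately show ?thesis using le e by simp
qed

text \<open>This is \<open>0\<close> if an evidence is infinite, which happens for almost no \<open>y\<close>, and if the evidence of \<open>\<mu>\<close>
vanishes, where the factor \<open>evidence y \<mu>\<close> in the integrals below vanishes as well.\<close>

definition evidence_ratio :: "'y \<Rightarrow> 'x measure \<Rightarrow> 'x measure \<Rightarrow> real" where
  "evidence_ratio y \<mu> \<nu> = enn2real (evidence y \<nu>) / enn2real (evidence y \<mu>)"

lemma evidence_ratio_nonneg: "0 \<le> evidence_ratio y \<mu> \<nu>"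
  by (simp add: evidence_ratio_def)

lemma integral_evidence_ratio:
  assumes \<mu>: "\<mu> \<in> space (subprob_algebra S)" and \<nu>: "\<nu> \<in> space (subprob_algebra S)"
  shows "(\<integral>\<^sup>+y. ennreal (evidence_ratio y \<mu> \<nu>) * evidence y \<mu> \<partial>T) \<le> 1"
proof -
  have s: "sets \<nu> = sets S" "subprob_space \<nu>" using \<nu> by (auto simp: space_subprob_algebra)
  have sp: "space \<nu> = space S" using s(1) by (rule sets_eq_imp_space_eq)
  have e: "evidence y \<nu> = (\<integral>\<^sup>+x\<in>(space S). ennreal (g y x) \<partial>\<nu>)" for y
    unfolding evidence_def sp[symmetric] by (intro nn_integral_cong) auto
  have "(\<integral>\<^sup>+y. ennreal (evidence_ratio y \<mu> \<nu>) * evidence y \<mu> \<partial>T) \<le> (\<integral>\<^sup>+y. evidence y \<nu> \<partial>T)"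
  proof (rule nn_integral_mono_AE)
    show "AE y in T. ennreal (evidence_ratio y \<mu> \<nu>) * evidence y \<mu> \<le> evidence y \<nu>"
      using AE_evidence_finite[OF \<mu>] AE_evidence_finite[OF \<nu>]
    proof eventually_elim
      case (elim y)
      obtain i where i: "evidence y \<mu> = ennreal i" "0 \<le> i" using elim by (cases "evidence y \<mu>") auto
      obtain j where j: "evidence y \<nu> = ennreal j" "0 \<le> j" using elim by (cases "evidence y \<nu>") auto
      show ?case using i j by (cases "i = 0") (auto simp: evidence_ratio_def ennreal_mult[symmetric])
    qed
  qed
  also have "\<dots> = emeasure \<nu> (space S)" unfolding e by (rule integral_evidence[OF \<nu> sets.top])
  also have "\<dots> \<le> 1" by (rule subprob_space.subprob_emeasure_le_1[OF s(2)])
  finally show ?thesis .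
qed

text \<open>With the evidence ratio in the second weight, the factor \<open>evidence y \<mu>\<close> cancels the normalisation of both
updates, and the integrand becomes the excess of the unnormalised updates. The maximising set \<open>N\<close> of \<open>a \<mu> - b \<nu>\<close>
attains this excess for every \<open>y\<close>, so the integral over \<open>y\<close> can be taken inside.\<close>

lemma integral_excess_update:
  assumes \<mu>: "\<mu> \<in> space (subprob_algebra S)" and \<nu>: "\<nu> \<in> space (subprob_algebra S)"
    and ab: "0 \<le> a" "0 \<le> b"
  shows "(\<integral>\<^sup>+y. ennreal (excess S a (bayes_update (g y) \<mu>) (b * evidence_ratio y \<mu> \<nu>) (bayes_update (g y) \<nu>))
        * evidence y \<mu> \<partial>T) \<le> ennreal (excess S a \<mu> b \<nu>)"
proof -
  interpret subprob_pair S \<mu> \<nu> a b by unfold_locales fact+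
  obtain N where max: "maximising N" using maximising_ex by blast
  then have N: "N \<in> sets S" by (simp add: maximising_def)
  define I where "I \<rho> y F = (\<integral>\<^sup>+x\<in>F. ennreal (g y x) \<partial>\<rho>)" for \<rho> :: "'x measure" and y F
  have "(\<integral>\<^sup>+y. ennreal (excess S a (bayes_update (g y) \<mu>) (b * evidence_ratio y \<mu> \<nu>) (bayes_update (g y) \<nu>))
        * evidence y \<mu> \<partial>T) \<le> (\<integral>\<^sup>+y. ennreal a * I \<mu> y N - ennreal b * I \<nu> y N \<partial>T)"
  proof (rule nn_integral_mono_AE)
    show "AE y in T. ennreal (excess S a (bayes_update (g y) \<mu>) (b * evidence_ratio y \<mu> \<nu>) (bayes_update (g y) \<nu>))
        * evidence y \<mu> \<le> ennreal a * I \<mu> y N - ennreal b * I \<nu> y N"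
      using AE_evidence_finite[OF \<mu>] AE_evidence_finite[OF \<nu>] AE_space
    proof eventually_elim
      case (elim y)
      then have y: "y \<in> space T" by simp
      define i where "i = enn2real (evidence y \<mu>)"
      define j where "j = enn2real (evidence y \<nu>)"
      have ij: "evidence y \<mu> = ennreal i" "0 \<le> i" "evidence y \<nu> = ennreal j" "0 \<le> j"
        using elim by (auto simp: i_def j_def)
      define A where "A F = measure (bayes_update (g y) \<mu>) F * i" for F
      define C where "C F = measure (bayes_update (g y) \<nu>) F * j" for F
      have sub: "subprob_space (bayes_update (g y) \<mu>)" "subprob_space (bayes_update (g y) \<nu>)"
        using subprob_bayes_update[OF g_section[OF y] \<mu>] subprob_bayes_update[OF g_section[OF y] \<nu>]
        by (auto simp: space_subprob_algebra)
      have AC0: "0 \<le> A F" "0 \<le> C F" for F using ij by (auto simp: A_def C_def)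
      have IA: "I \<mu> y F = ennreal (A F)" "I \<nu> y F = ennreal (C F)" if "F \<in> sets S" for F
        using emeasure_update_times_evidence[OF \<mu> y _ that] emeasure_update_times_evidence[OF \<nu> y _ that] elim ij
          finite_measure.emeasure_eq_measure[OF subprob_space.axioms(1)[OF sub(1)], of F]
          finite_measure.emeasure_eq_measure[OF subprob_space.axioms(1)[OF sub(2)], of F]
        by (auto simp: I_def A_def C_def ennreal_mult)
      have m: "(\<lambda>x. ennreal (g y x)) \<in> borel_measurable S" using g_section[OF y] by simp
      have p: "b * C N \<le> a * A N"
        using maximisingD[OF max m, of "\<lambda>_. 0"] IA[OF N] AC0 ab by (simp add: I_def[symmetric] ennreal_mult[symmetric])
      have e: "a * A F - b * C F \<le> a * A N - b * C N" if F: "F \<in> sets S" for F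
      proof -
        have F1: "indicator F x \<le> (1 :: ennreal)" if "x \<in> space S" for x by (simp add: indicator_def)
        have "ennreal (a * A F + b * C N) \<le> ennreal (a * A N + b * C F)"
          using maximisingD[OF max m borel_measurable_indicator[OF F] F1] IA[OF N] IA[OF F] AC0 ab
          by (simp add: I_def[symmetric] ennreal_mult ennreal_plus)
        then have "a * A F + b * C N \<le> a * A N + b * C F"
          using AC0 ab by (subst (asm) ennreal_le_iff) (auto intro!: add_nonneg_nonneg)
        then show ?thesis by linarith
      qed
      show ?case
      proof (cases "i = 0")
        case True
        then show ?thesis using ij by simp
      next
        case False
        then have i: "0 < i" using ij by simp
        have "excess S a (bayes_update (g y) \<mu>) (b * evidence_ratio y \<mu> \<nu>) (bayes_update (g y) \<nu>) \<le> (a * A N - b * C N) / i"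
        proof (rule excess_least)
          fix F assume F: "F \<in> sets S"
          have "a * measure (bayes_update (g y) \<mu>) F - b * evidence_ratio y \<mu> \<nu> * measure (bayes_update (g y) \<nu>) F
             = (a * A F - b * C F) / i"
            using i by (simp add: A_def C_def evidence_ratio_def i_def[symmetric] j_def[symmetric] field_simps)
          also have "\<dots> \<le> (a * A N - b * C N) / i" using e[OF F] i by (intro divide_right_mono) auto
          finally show "a * measure (bayes_update (g y) \<mu>) F - b * evidence_ratio y \<mu> \<nu> * measure (bayes_update (g y) \<nu>) F
             \<le> (a * A N - b * C N) / i" .
        qed
        then have "ennreal (excess S a (bayes_update (g y) \<mu>) (b * evidence_ratio y \<mu> \<nu>) (bayes_update (g y) \<nu>)) * evidence y \<mu>
          \<le> ennreal ((a * A N - b * C N) / i) * ennreal i"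
          using ij by (intro mult_mono ennreal_leI) auto
        also have "\<dots> = ennreal (a * A N - b * C N)"
          using i p by (simp add: ennreal_mult[symmetric])
        also have "\<dots> = ennreal a * I \<mu> y N - ennreal b * I \<nu> y N"
          using IA[OF N] AC0 ab by (simp add: ennreal_mult[symmetric] ennreal_minus)
        finally show ?thesis .
      qed
    qed
  qed
  also have "\<dots> = (\<integral>\<^sup>+y. ennreal a * I \<mu> y N \<partial>T) - (\<integral>\<^sup>+y. ennreal b * I \<nu> y N \<partial>T)"
  proof (rule nn_integral_diff)
    show "(\<lambda>y. ennreal a * I \<mu> y N) \<in> borel_measurable T" "(\<lambda>y. ennreal b * I \<nu> y N) \<in> borel_measurable T"
      using integral_evidence(2)[OF \<mu> N] integral_evidence(2)[OF \<nu> N] unfolding I_def by auto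
    show "(\<integral>\<^sup>+y. ennreal b * I \<nu> y N \<partial>T) \<noteq> \<infinity>"
      using integral_evidence[OF \<nu> N] unfolding I_def
      by (subst nn_integral_cmult) (auto simp: ennreal_mult_eq_top_iff)
    show "AE y in T. ennreal b * I \<nu> y N \<le> ennreal a * I \<mu> y N"
    proof (rule AE_I2)
      fix y assume y: "y \<in> space T"
      have "(\<lambda>x. ennreal (g y x)) \<in> borel_measurable S" using g_section[OF y] by simp
      from maximisingD[OF max this, of "\<lambda>_. 0"] show "ennreal b * I \<nu> y N \<le> ennreal a * I \<mu> y N"
        by (simp add: I_def)
    qed
  qed
  also have "\<dots> = ennreal a * emeasure \<mu> N - ennreal b * emeasure \<nu> N"
    using integral_evidence[OF \<mu> N] integral_evidence[OF \<nu> N] unfolding I_def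
    by (simp add: nn_integral_cmult)
  also have "\<dots> = ennreal (a * measure \<mu> N - b * measure \<nu> N)"
    using ab by (simp add: \<mu>.emeasure_eq_measure \<nu>.emeasure_eq_measure ennreal_mult[symmetric] ennreal_minus)
  also have "\<dots> \<le> ennreal (excess S a \<mu> b \<nu>)"
    by (intro ennreal_leI excess_upper N)
  finally show ?thesis .
qed

end

section \<open>The conditional law of the next observation\<close>

locale hidden_markov = prob_space P for P :: "'w measure" +
  fixes \<X> :: "'x::euclidean_space set" and \<Y> :: "'y::euclidean_space set"
    and \<pi> :: "'x measure" and K :: "nat \<Rightarrow> 'x \<Rightarrow> 'x measure" and g :: "nat \<Rightarrow> 'y \<Rightarrow> 'x \<Rightarrow> real"
    and X :: "nat \<Rightarrow> 'w \<Rightarrow> 'x" and Y :: "nat \<Rightarrow> 'w \<Rightarrow> 'y"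
  assumes \<X>: "\<X> \<in> sets borel" and \<Y>: "\<Y> \<in> sets borel"
    and model: "state_space_model \<X> \<Y> \<pi> K g"
    and generated: "generated_by_model P \<X> \<Y> \<pi> K g X Y"
begin

abbreviation "SX \<equiv> borel_of_set \<X>"
abbreviation "SY \<equiv> borel_of_set \<Y>"
abbreviation "T \<equiv> restrict_space lborel \<Y>"

lemma sets_T [measurable_cong]: "sets T = sets SY"
  by (rule sets_restrict_space_cong) simp

lemma space_T: "space T = \<Y>" "space SX = \<X>" "space SY = \<Y>"
  by (simp_all add: space_restrict_space)

lemma X_meas [measurable]: "X t \<in> measurable P SX"
  using generated by (auto simp: generated_by_model_def)

lemma Y_meas: "1 \<le> t \<Longrightarrow> Y t \<in> measurable P SY"
  using generated by (auto simp: generated_by_model_def)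

lemma K_meas: "1 \<le> t \<Longrightarrow> K t \<in> measurable SX (prob_algebra SX)"
  using model by (auto simp: state_space_model_def)

lemma likelihood_g: "1 \<le> t \<Longrightarrow> likelihood T SX (g t)"
proof (intro likelihood.intro likelihood_axioms.intro)
  assume t: "1 \<le> t"
  show "sigma_finite_measure T"
    by (rule sigma_finite_measure_restrict_space) (use \<Y> in \<open>auto intro: sigma_finite_lborel\<close>)
  have "(\<lambda>(y, x). g t y x) \<in> borel_measurable (SY \<Otimes>\<^sub>M SX)"
    using model t by (auto simp: state_space_model_def)
  then show "(\<lambda>(y, x). g t y x) \<in> borel_measurable (T \<Otimes>\<^sub>M SX)"
    by (simp cong: measurable_cong_sets add: sets_pair_measure_cong[OF sets_T refl])
  show "0 < g t y x" if "y \<in> space T" "x \<in> space SX" for y x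
    using that t model by (auto simp: state_space_model_def space_T)
  show "(\<integral>\<^sup>+y. ennreal (g t y x) \<partial>T) = 1" if "x \<in> space SX" for x
    using that t model by (auto simp: state_space_model_def space_T)
qed

definition obs_rect :: "nat \<Rightarrow> (nat \<Rightarrow> 'y set) \<Rightarrow> 'w set" where
  "obs_rect t B = {w\<in>space P. \<forall>s\<in>{1..t}. Y s w \<in> B s}"

definition obs_rects :: "nat \<Rightarrow> 'w set set" where
  "obs_rects t = {obs_rect t B | B. \<forall>s. B s \<in> sets SY}"

definition obs_algebra :: "nat \<Rightarrow> 'w measure" where
  "obs_algebra t = sigma (space P) (obs_rects t)"

lemma obs_rects_Pow: "obs_rects t \<subseteq> Pow (space P)"
  by (auto simp: obs_rects_def obs_rect_def)

lemma space_obs [simp]: "space (obs_algebra t) = space P"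
  unfolding obs_algebra_def using obs_rects_Pow by (simp add: space_measure_of)

lemma sets_obs: "sets (obs_algebra t) = sigma_sets (space P) (obs_rects t)"
  unfolding obs_algebra_def using obs_rects_Pow by (simp add: sets_measure_of)

lemma obs_rect_events: "(\<And>s. B s \<in> sets SY) \<Longrightarrow> obs_rect t B \<in> events"
proof -
  assume B: "\<And>s. B s \<in> sets SY"
  have "{w\<in>space P. Y s w \<in> B s} \<in> events" if "s \<in> {1..t}" for s
  proof -
    have "Y s -` B s \<inter> space P \<in> events" using Y_meas that B by (intro measurable_sets) auto
    then show ?thesis by (simp add: vimage_def Int_def conj_commute)
  qed
  then have "{w\<in>space P. \<forall>s\<in>{1..t}. Y s w \<in> B s} \<in> events"
    by (intro sets.sets_Collect_finite_All) auto
  then show ?thesis by (simp add: obs_rect_def)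
qed

lemma sets_obs_events: "sets (obs_algebra t) \<subseteq> events"
  unfolding sets_obs using obs_rect_events by (intro sets.sigma_sets_subset) (auto simp: obs_rects_def)

lemma Y_space: "1 \<le> s \<Longrightarrow> w \<in> space P \<Longrightarrow> Y s w \<in> space SY"
  using measurable_space[OF Y_meas] by auto

lemma obs_rects_mono: "obs_rects t \<subseteq> obs_rects (Suc t)"
proof
  fix H assume "H \<in> obs_rects t"
  then obtain B where B: "H = obs_rect t B" "\<And>s. B s \<in> sets SY" by (auto simp: obs_rects_def)
  have "H = obs_rect (Suc t) (B(Suc t := space SY))"
    using Y_space[of "Suc t"] by (auto simp: B(1) obs_rect_def le_Suc_eq)
  moreover have "(B(Suc t := space SY)) s \<in> sets SY" for s using B(2)[of s] sets.top[of SY] by (auto simp del: sets.top)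
  ultimately show "H \<in> obs_rects (Suc t)" unfolding obs_rects_def by blast
qed

lemma obs_mono: "sets (obs_algebra t) \<subseteq> sets (obs_algebra (Suc t))"
  unfolding sets_obs by (rule sigma_sets_mono'[OF obs_rects_mono])

lemma obs_rect_in: "(\<And>s. B s \<in> sets SY) \<Longrightarrow> obs_rect t B \<in> sets (obs_algebra t)"
  unfolding sets_obs by (rule sigma_sets.Basic) (auto simp: obs_rects_def)

lemma Y_obs: assumes "1 \<le> s" "s \<le> t" shows "Y s \<in> measurable (obs_algebra t) SY"
proof (rule measurableI)
  show "Y s w \<in> space SY" if "w \<in> space (obs_algebra t)" for w using that assms Y_space by auto
  fix A assume A: "A \<in> sets SY"
  have "Y s -` A \<inter> space (obs_algebra t) = obs_rect t (\<lambda>r. if r = s then A else space SY)"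
    using assms Y_space by (auto simp: obs_rect_def split: if_splits)
  then show "Y s -` A \<inter> space (obs_algebra t) \<in> sets (obs_algebra t)"
    using A by (simp add: obs_rect_in)
qed

lemma obs_rect_Int:
  "obs_rect t B \<inter> obs_rect t C = obs_rect t (\<lambda>s. B s \<inter> C s)"
  by (auto simp: obs_rect_def)

lemma space_obs_rect: "space P = obs_rect t (\<lambda>_. space SY)"
  using Y_space by (auto simp: obs_rect_def)

lemma pair_obs: "(\<lambda>w. (w, Y (Suc t) w)) \<in> measurable (obs_algebra (Suc t)) (obs_algebra t \<Otimes>\<^sub>M T)"
proof (rule measurable_Pair)
  show "(\<lambda>w. w) \<in> measurable (obs_algebra (Suc t)) (obs_algebra t)"
  proof (rule measurableI)
    fix A assume A: "A \<in> sets (obs_algebra t)"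
    then have "A \<inter> space P = A" using sets.sets_into_space[OF A] by auto
    then show "(\<lambda>w. w) -` A \<inter> space (obs_algebra (Suc t)) \<in> sets (obs_algebra (Suc t))"
      using A obs_mono by auto
  qed auto
  show "Y (Suc t) \<in> measurable (obs_algebra (Suc t)) T"
    using Y_obs[of "Suc t" "Suc t"] by (simp cong: measurable_cong_sets add: sets_T)
qed

lemma subalg: "subalgebra P (obs_algebra t)"
  using sets_obs_events by (auto simp: subalgebra_def)

lemma pair_obs_P: "(\<lambda>w. (w, Y (Suc t) w)) \<in> measurable P (obs_algebra t \<Otimes>\<^sub>M T)"
  by (rule measurable_from_subalg[OF subalg pair_obs])

definition filter_process :: "(nat \<Rightarrow> 'x \<Rightarrow> 'x measure) \<Rightarrow> 'x measure \<Rightarrow> nat \<Rightarrow> 'w \<Rightarrow> 'x measure" where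
  "filter_process K' \<pi>' t w = bayes_filter K' g (\<lambda>s. Y s w) \<pi>' t"

lemma filter_process_Suc:
  "filter_process K' \<pi>' (Suc t) w = bayes_update (g (Suc t) (Y (Suc t) w)) (filter_process K' \<pi>' t w \<bind> K' (Suc t))"
  by (simp add: filter_process_def)

lemma predict_process_meas:
  assumes F: "filter_process K' \<pi>' t \<in> measurable (obs_algebra t) (subprob_algebra SX)"
    and K': "K' (Suc t) \<in> measurable SX (prob_algebra SX)"
  shows "(\<lambda>w. filter_process K' \<pi>' t w \<bind> K' (Suc t)) \<in> measurable (obs_algebra t) (subprob_algebra SX)"
  by (rule measurable_bind2[OF F measurable_prob_algebraD[OF K']])

lemma filter_process_meas:
  assumes K': "\<And>t. 1 \<le> t \<Longrightarrow> K' t \<in> measurable SX (prob_algebra SX)" and \<pi>': "\<pi>' \<in> space (prob_algebra SX)"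
  shows "filter_process K' \<pi>' t \<in> measurable (obs_algebra t) (subprob_algebra SX)"
proof (induction t)
  case 0
  have "filter_process K' \<pi>' 0 = (\<lambda>w. \<pi>')" by (auto simp: filter_process_def)
  moreover have "\<pi>' \<in> space (subprob_algebra SX)"
    using \<pi>' by (auto simp: space_prob_algebra space_subprob_algebra prob_space_imp_subprob_space)
  ultimately show ?case by simp
next
  case (Suc t)
  interpret L: likelihood T SX "g (Suc t)" by (rule likelihood_g) simp
  have "(\<lambda>w. case (w, Y (Suc t) w) of (w, y) \<Rightarrow> bayes_update (g (Suc t) y) (filter_process K' \<pi>' t w \<bind> K' (Suc t)))
     \<in> measurable (obs_algebra (Suc t)) (subprob_algebra SX)"
    using measurable_compose[OF pair_obs L.update_measurable[OF predict_process_meas[OF Suc K']]] by simp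
  then show ?case by (simp add: filter_process_Suc[abs_def])
qed

definition obs_prob :: "nat \<Rightarrow> 'x \<Rightarrow> 'y set \<Rightarrow> real" where
  "obs_prob t x B = measure (density T (\<lambda>y. ennreal (g t y x))) B"

lemma obs_prob_eq:
  assumes t: "1 \<le> t" and x: "x \<in> space SX" and B: "B \<in> sets SY"
  shows "ennreal (obs_prob t x B) = (\<integral>\<^sup>+y\<in>B. ennreal (g t y x) \<partial>T)" "0 \<le> obs_prob t x B" "obs_prob t x B \<le> 1"
proof -
  interpret L: likelihood T SX "g t" by (rule likelihood_g[OF t])
  have m: "(\<lambda>y. ennreal (g t y x)) \<in> borel_measurable T" using L.g_section'[OF x] by simp
  have "emeasure (density T (\<lambda>y. ennreal (g t y x))) (space T) = (\<integral>\<^sup>+y. ennreal (g t y x) * indicator (space T) y \<partial>T)"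
    using m by (subst emeasure_density) auto
  also have "\<dots> = (\<integral>\<^sup>+y. ennreal (g t y x) \<partial>T)" by (intro nn_integral_cong) auto
  also have "\<dots> = 1" by (rule L.g_int[OF x])
  finally interpret D: prob_space "density T (\<lambda>y. ennreal (g t y x))" by (intro prob_spaceI) simp
  show "ennreal (obs_prob t x B) = (\<integral>\<^sup>+y\<in>B. ennreal (g t y x) \<partial>T)"
    unfolding obs_prob_def D.emeasure_eq_measure[symmetric] using m B sets_T by (subst emeasure_density) auto
  show "0 \<le> obs_prob t x B" "obs_prob t x B \<le> 1" by (auto simp: obs_prob_def)
qed

lemma obs_prob_meas:
  assumes t: "1 \<le> t" and B[measurable]: "B \<in> sets SY"
  shows "(\<lambda>x. obs_prob t x B) \<in> borel_measurable SX"
proof -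
  interpret L: likelihood T SX "g t" by (rule likelihood_g[OF t])
  have B': "B \<in> sets T" using B sets_T by simp
  have "(\<lambda>(x, y). ennreal (g t y x) * indicator B y) \<in> borel_measurable (SX \<Otimes>\<^sub>M T)"
  proof -
    have "(\<lambda>p. case (snd p, fst p) of (y, x) \<Rightarrow> g t y x) \<in> borel_measurable (SX \<Otimes>\<^sub>M T)"
      using L.g_meas by (rule measurable_compose[rotated]) measurable
    then show ?thesis using B' by (simp add: case_prod_beta')
  qed
  then have "(\<lambda>x. \<integral>\<^sup>+y\<in>B. ennreal (g t y x) \<partial>T) \<in> borel_measurable SX"
    by (rule L.T.borel_measurable_nn_integral)
  then have "(\<lambda>x. enn2real (\<integral>\<^sup>+y\<in>B. ennreal (g t y x) \<partial>T)) \<in> borel_measurable SX"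
    by simp
  then show ?thesis
    by (rule measurable_cong[THEN iffD1, rotated]) (simp add: obs_prob_eq(1)[OF t _ B, symmetric] obs_prob_eq(2)[OF t _ B])
qed

lemma indicator_obs_rect:
  "w \<in> space P \<Longrightarrow> indicator (obs_rect t B) w = (\<Prod>s\<in>{1..t}. indicator (B s) (Y s w) :: real)"
  by (auto simp: obs_rect_def indicator_def prod_eq_1_iff intro!: prod_zero[symmetric] split: if_splits)

lemma states_all_sub: "subalgebra P (states_all P \<X> X)" "X t \<in> measurable (states_all P \<X> X) SX"
proof -
  have m: "(\<lambda>w s. X s w) \<in> measurable P (Pi\<^sub>M UNIV (\<lambda>_. SX))"
    by (rule measurable_PiM_single') (auto simp: PiE_def extensional_def dest: measurable_space[OF X_meas])
  show "subalgebra P (states_all P \<X> X)"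
    unfolding subalgebra_def states_all_def using sets_image_in_sets[OF refl m] by simp
  have "(\<lambda>w s. X s w) \<in> measurable (states_all P \<X> X) (Pi\<^sub>M UNIV (\<lambda>_. SX))"
    unfolding states_all_def using measurable_space[OF m] by (intro measurable_vimage_algebra1) auto
  from measurable_compose[OF this measurable_component_singleton[of t UNIV]]
  show "X t \<in> measurable (states_all P \<X> X) SX" by simp
qed

lemma states_upto_sub: "subalgebra P (states_upto P \<X> X t)"
  "s \<le> t \<Longrightarrow> X s \<in> measurable (states_upto P \<X> X t) SX"
proof -
  have m: "(\<lambda>w. \<lambda>s\<in>{..t}. X s w) \<in> measurable P (Pi\<^sub>M {..t} (\<lambda>_. SX))"
    by (rule measurable_restrict) (rule X_meas)
  show "subalgebra P (states_upto P \<X> X t)"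
    unfolding subalgebra_def states_upto_def using sets_image_in_sets[OF refl m] by simp
  have "(\<lambda>w. \<lambda>s\<in>{..t}. X s w) \<in> measurable (states_upto P \<X> X t) (Pi\<^sub>M {..t} (\<lambda>_. SX))"
    unfolding states_upto_def using measurable_space[OF m] by (intro measurable_vimage_algebra1) auto
  from measurable_compose[OF this measurable_component_singleton[of s "{..t}"]]
  show "X s \<in> measurable (states_upto P \<X> X t) SX" if "s \<le> t" using that by simp
qed

lemma cond_exp_integral:
  fixes Z f h :: "'w \<Rightarrow> real"
  assumes F: "subalgebra P F" and Z: "Z \<in> borel_measurable F" "\<And>w. w \<in> space P \<Longrightarrow> \<bar>Z w\<bar> \<le> 1"
    and f: "f \<in> borel_measurable P" "\<And>w. w \<in> space P \<Longrightarrow> \<bar>f w\<bar> \<le> 1"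
    and h: "h \<in> borel_measurable P" "AE w in P. real_cond_exp P F f w = h w"
  shows "(\<integral>w. Z w * f w \<partial>P) = (\<integral>w. Z w * h w \<partial>P)"
proof -
  interpret F: finite_measure_subalgebra P F by unfold_locales (rule F)
  have ZP: "Z \<in> borel_measurable P" by (rule measurable_from_subalg[OF F Z(1)])
  have b: "\<bar>Z w * f w\<bar> \<le> 1" if "w \<in> space P" for w
    using mult_mono[OF Z(2)[OF that] f(2)[OF that]] by (simp add: abs_mult)
  have "integrable P (\<lambda>w. Z w * f w)"
    using ZP f(1) b by (intro integrable_const_bound[where B=1] AE_I2) auto
  from F.real_cond_exp_intg(2)[OF this Z(1) f(1)]
  have "(\<integral>w. Z w * f w \<partial>P) = (\<integral>w. Z w * real_cond_exp P F f w \<partial>P)" by simp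
  also have "\<dots> = (\<integral>w. Z w * h w \<partial>P)"
  proof (rule integral_cong_AE)
    show "(\<lambda>w. Z w * real_cond_exp P F f w) \<in> borel_measurable P" 
      using ZP borel_measurable_cond_exp2[of P F f] by auto
    show "AE w in P. Z w * real_cond_exp P F f w = Z w * h w" using h(2) by eventually_elim simp
  qed (use ZP h in auto)
  finally show ?thesis .
qed

text \<open>Conditional independence of the observations and their conditional laws, integrated against a function of
the states.\<close>

lemma obs_given_states:
  fixes Z :: "'w \<Rightarrow> real"
  assumes B: "\<And>s. B s \<in> sets SY"
    and Z: "Z \<in> borel_measurable (states_all P \<X> X)" "\<And>w. w \<in> space P \<Longrightarrow> \<bar>Z w\<bar> \<le> 1"
  shows "(\<integral>w. Z w * indicator (obs_rect t B) w \<partial>P) = (\<integral>w. Z w * (\<Prod>s\<in>{1..t}. obs_prob s (X s w) (B s)) \<partial>P)"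
proof -
  let ?F = "states_all P \<X> X"
  have ae1: "AE w in P. real_cond_exp P ?F (\<lambda>w. \<Prod>s\<in>{1..t}. indicator (B s) (Y s w)) w
      = (\<Prod>s\<in>{1..t}. real_cond_exp P ?F (\<lambda>w. indicator (B s) (Y s w)) w)"
    using generated B unfolding generated_by_model_def by (auto simp del: prod.cl_ivl_Suc)
  have "AE w in P. \<forall>s\<in>{1..t}. real_cond_exp P ?F (\<lambda>w. indicator (B s) (Y s w)) w = obs_prob s (X s w) (B s)"
    using generated B unfolding generated_by_model_def obs_prob_def by (intro AE_finite_allI) auto
  with ae1 have ae: "AE w in P. real_cond_exp P ?F (\<lambda>w. \<Prod>s\<in>{1..t}. indicator (B s) (Y s w)) w
      = (\<Prod>s\<in>{1..t}. obs_prob s (X s w) (B s))"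
    by eventually_elim (auto intro!: prod.cong)
  have Ym: "(\<lambda>w. indicator (B s) (Y s w) :: real) \<in> borel_measurable P" if "s \<in> {1..t}" for s
    using measurable_compose[OF Y_meas borel_measurable_indicator[OF B]] that by auto
  have "(\<integral>w. Z w * indicator (obs_rect t B) w \<partial>P) = (\<integral>w. Z w * (\<Prod>s\<in>{1..t}. indicator (B s) (Y s w)) \<partial>P)"
    by (intro Bochner_Integration.integral_cong) (auto simp: indicator_obs_rect)
  also have "\<dots> = (\<integral>w. Z w * (\<Prod>s\<in>{1..t}. obs_prob s (X s w) (B s)) \<partial>P)"
  proof (rule cond_exp_integral[OF states_all_sub(1) Z _ _ _ ae])
    show "(\<lambda>w. \<Prod>s\<in>{1..t}. indicator (B s) (Y s w) :: real) \<in> borel_measurable P"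
      using Ym by (intro borel_measurable_prod)
    show "\<bar>\<Prod>s\<in>{1..t}. indicator (B s) (Y s w) :: real\<bar> \<le> 1" for w
      unfolding abs_prod by (intro prod_le_1) (auto simp: indicator_def)
    show "(\<lambda>w. \<Prod>s\<in>{1..t}. obs_prob s (X s w) (B s)) \<in> borel_measurable P"
      using B measurable_compose[OF X_meas obs_prob_meas] by (intro borel_measurable_prod) auto
  qed
  finally show ?thesis .
qed

text \<open>Given all states, the past observations have a conditional probability that depends on the states up to
time \<open>t\<close> only. So they may be replaced by a function of these states, to which the Markov property applies.\<close>

lemma markov_given_obs:
  assumes B: "\<And>s. B s \<in> sets SY" and A: "A \<in> sets SX"
  shows "(\<integral>w. indicator A (X (Suc t) w) * indicator (obs_rect t B) w \<partial>P)
     = (\<integral>w. measure (K (Suc t) (X t w)) A * indicator (obs_rect t B) w \<partial>P)"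
proof -
  let ?W = "\<lambda>w. \<Prod>s\<in>{1..t}. obs_prob s (X s w) (B s)"
  have K1: "(\<lambda>x. measure (K (Suc t) x) A) \<in> borel_measurable SX"
    using measurable_compose[OF measurable_prob_algebraD[OF K_meas] measurable_measure_subprob_algebra[OF A]] by simp
  have K2: "measure (K (Suc t) x) A \<le> 1" if "x \<in> space SX" for x
    using measurable_space[OF K_meas that, of "Suc t"] by (auto simp: space_prob_algebra intro: prob_space.prob_le_1)
  have IA: "(\<lambda>x. indicator A x :: real) \<in> borel_measurable SX" using A by simp
  have Xs: "X s w \<in> space SX" if "w \<in> space P" for s w using measurable_space[OF X_meas that] .
  have W: "?W \<in> borel_measurable (states_upto P \<X> X t)"
    using B measurable_compose[OF states_upto_sub(2) obs_prob_meas] by (intro borel_measurable_prod) auto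
  have W1: "\<bar>?W w\<bar> \<le> 1" if "w \<in> space P" for w
    unfolding abs_prod using obs_prob_eq[OF _ Xs[OF that] B] by (intro prod_le_1) auto
  have "(\<integral>w. indicator A (X (Suc t) w) * indicator (obs_rect t B) w \<partial>P) = (\<integral>w. indicator A (X (Suc t) w) * ?W w \<partial>P)"
    using measurable_compose[OF states_all_sub(2) IA] by (intro obs_given_states B) (auto simp: indicator_def)
  also have "\<dots> = (\<integral>w. ?W w * indicator A (X (Suc t) w) \<partial>P)" by (simp add: mult.commute)
  also have "\<dots> = (\<integral>w. ?W w * measure (K (Suc t) (X t w)) A \<partial>P)"
  proof (rule cond_exp_integral[OF states_upto_sub(1) W W1])
    show "(\<lambda>w. indicator A (X (Suc t) w) :: real) \<in> borel_measurable P" by (rule measurable_compose[OF X_meas IA])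
    show "(\<lambda>w. measure (K (Suc t) (X t w)) A) \<in> borel_measurable P" by (rule measurable_compose[OF X_meas K1])
    have "\<forall>t\<ge>1. \<forall>A\<in>sets SX. AE w in P. real_cond_exp P (states_upto P \<X> X (t - 1)) (\<lambda>w. indicator A (X t w)) w
          = measure (K t (X (t - 1) w)) A"
      using generated unfolding generated_by_model_def by (elim conjE) assumption
    from this[rule_format, OF _ A, of "Suc t"]
    show "AE w in P. real_cond_exp P (states_upto P \<X> X t) (\<lambda>w. indicator A (X (Suc t) w)) w = measure (K (Suc t) (X t w)) A"
      by simp
  qed (auto simp: indicator_def)
  also have "\<dots> = (\<integral>w. measure (K (Suc t) (X t w)) A * ?W w \<partial>P)" by (simp add: mult.commute)
  also have "\<dots> = (\<integral>w. measure (K (Suc t) (X t w)) A * indicator (obs_rect t B) w \<partial>P)"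
    using measurable_compose[OF states_all_sub(2) K1] K2 Xs by (intro obs_given_states[symmetric] B) auto
  finally show ?thesis .
qed

text \<open>Both sides are reduced to functions of the states by \<open>obs_given_states\<close>, at the times \<open>t + 1\<close> and \<open>t\<close>.\<close>

lemma obs_next:
  assumes B: "\<And>s. B s \<in> sets SY" and A: "A \<in> sets SX" and C: "C \<in> sets SY"
  shows "(\<integral>w. indicator A (X (Suc t) w) * indicator (obs_rect t B) w * indicator C (Y (Suc t) w) \<partial>P)
     = (\<integral>w. indicator A (X (Suc t) w) * obs_prob (Suc t) (X (Suc t) w) C * indicator (obs_rect t B) w \<partial>P)"
proof -
  let ?B = "B(Suc t := C)"
  have IA: "(\<lambda>x. indicator A x :: real) \<in> borel_measurable SX" using A by simp
  have Xs: "X s w \<in> space SX" if "w \<in> space P" for s w using measurable_space[OF X_meas that] .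
  have B': "?B s \<in> sets SY" for s using B C by auto
  have r: "indicator (obs_rect (Suc t) ?B) w = indicator (obs_rect t B) w * (indicator C (Y (Suc t) w) :: real)" for w
    by (auto simp: obs_rect_def indicator_def atLeastAtMostSuc_conv)
  have pr: "(\<Prod>s\<in>{1..Suc t}. obs_prob s (X s w) (?B s)) = (\<Prod>s\<in>{1..t}. obs_prob s (X s w) (B s)) * obs_prob (Suc t) (X (Suc t) w) C" for w
    by (simp add: prod.cl_ivl_Suc)
  have "(\<integral>w. indicator A (X (Suc t) w) * indicator (obs_rect t B) w * indicator C (Y (Suc t) w) \<partial>P)
    = (\<integral>w. indicator A (X (Suc t) w) * indicator (obs_rect (Suc t) ?B) w \<partial>P :: real)"
    by (simp add: r mult.assoc)
  also have "\<dots> = (\<integral>w. indicator A (X (Suc t) w) * (\<Prod>s\<in>{1..Suc t}. obs_prob s (X s w) (?B s)) \<partial>P)"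
    using measurable_compose[OF states_all_sub(2) IA] by (intro obs_given_states B') (auto simp: indicator_def)
  also have "\<dots> = (\<integral>w. (indicator A (X (Suc t) w) * obs_prob (Suc t) (X (Suc t) w) C) * (\<Prod>s\<in>{1..t}. obs_prob s (X s w) (B s)) \<partial>P)"
    unfolding pr by (simp add: mult_ac)
  also have "\<dots> = (\<integral>w. indicator A (X (Suc t) w) * obs_prob (Suc t) (X (Suc t) w) C * indicator (obs_rect t B) w \<partial>P)"
  proof (rule obs_given_states[symmetric, OF B])
    show "(\<lambda>w. indicator A (X (Suc t) w) * obs_prob (Suc t) (X (Suc t) w) C) \<in> borel_measurable (states_all P \<X> X)"
      using measurable_compose[OF states_all_sub(2) IA] measurable_compose[OF states_all_sub(2) obs_prob_meas[OF _ C]] by auto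
    show "\<bar>indicator A (X (Suc t) w) * obs_prob (Suc t) (X (Suc t) w) C\<bar> \<le> 1" if "w \<in> space P" for w
      using obs_prob_eq[OF _ Xs[OF that] C, of "Suc t"] by (auto simp: indicator_def)
  qed
  finally show ?thesis .
qed

text \<open>The filter is the conditional law of the state given the observations. It suffices to test this on
rectangles, which are stable under intersection and generate \<open>obs_algebra t\<close>.\<close>

definition filter_correct :: "nat \<Rightarrow> bool" where
  "filter_correct t \<longleftrightarrow> (\<forall>B A. (\<forall>s. B s \<in> sets SY) \<longrightarrow> A \<in> sets SX \<longrightarrow>
     (\<integral>\<^sup>+w. indicator A (X t w) * indicator (obs_rect t B) w \<partial>P)
       = (\<integral>\<^sup>+w. emeasure (filter_process K \<pi> t w) A * indicator (obs_rect t B) w \<partial>P))"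

abbreviation prediction :: "nat \<Rightarrow> 'w \<Rightarrow> 'x measure" where
  "prediction t w \<equiv> filter_process K \<pi> t w \<bind> K (Suc t)"

lemma \<pi>_prob: "\<pi> \<in> space (prob_algebra SX)"
  using model by (auto simp: state_space_model_def)

lemma filter_meas: "filter_process K \<pi> t \<in> measurable (obs_algebra t) (subprob_algebra SX)"
  by (rule filter_process_meas[OF K_meas \<pi>_prob])

lemma filter_meas_P: "filter_process K \<pi> t \<in> measurable P (subprob_algebra SX)"
  by (rule measurable_from_subalg[OF subalg filter_meas])

lemma prediction_meas: "prediction t \<in> measurable (obs_algebra t) (subprob_algebra SX)"
  by (rule predict_process_meas[OF filter_meas K_meas]) simp

lemma prediction_meas_P: "prediction t \<in> measurable P (subprob_algebra SX)"
  by (rule measurable_from_subalg[OF subalg prediction_meas])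

text \<open>Restrict \<open>P\<close> to the rectangle. The state \<open>X t\<close> then has the averaged filter as its law, and \<open>X (Suc t)\<close> the
image of this law under the kernel.\<close>

lemma prediction_correct:
  assumes fc: "filter_correct t" and B: "\<And>s. B s \<in> sets SY" and h: "h \<in> borel_measurable SX"
  shows "(\<integral>\<^sup>+w. h (X (Suc t) w) * indicator (obs_rect t B) w \<partial>P)
     = (\<integral>\<^sup>+w. (\<integral>\<^sup>+x. h x \<partial>prediction t w) * indicator (obs_rect t B) w \<partial>P)"
proof -
  let ?H = "obs_rect t B"
  have H[measurable]: "?H \<in> events" by (rule obs_rect_events[OF B])
  define M where "M = density P (indicator ?H)"
  have M[measurable_cong]: "sets M = events" "space M = space P" by (simp_all add: M_def)
  have MX: "X s \<in> measurable M SX" for s using X_meas by (simp cong: measurable_cong_sets add: M)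
  have KS: "K (Suc t) \<in> measurable SX (subprob_algebra SX)" by (rule measurable_prob_algebraD[OF K_meas]) simp
  have MF: "filter_process K \<pi> t \<in> measurable M (subprob_algebra SX)"
    using filter_meas_P by (simp cong: measurable_cong_sets add: M)
  have intM: "(\<integral>\<^sup>+w. f w \<partial>M) = (\<integral>\<^sup>+w\<in>?H. f w \<partial>P)" if "f \<in> borel_measurable P" for f
    using that unfolding M_def by (subst nn_integral_density) (auto simp: mult.commute)
  have ne: "space M \<noteq> {}" using not_empty M by simp
  have eX: "emeasure (distr M SX (X s)) A = (\<integral>\<^sup>+w\<in>?H. indicator A (X s w) \<partial>P)" if A: "A \<in> sets SX" for s A
  proof -
    have "emeasure (distr M SX (X s)) A = (\<integral>\<^sup>+x. indicator A x \<partial>distr M SX (X s))" using A by simp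
    also have "\<dots> = (\<integral>\<^sup>+w. indicator A (X s w) \<partial>M)" using A by (intro nn_integral_distr MX) auto
    also have "\<dots> = (\<integral>\<^sup>+w\<in>?H. indicator A (X s w) \<partial>P)" using A by (intro intM) auto
    finally show ?thesis .
  qed
  have 1: "distr M SX (X t) = M \<bind> filter_process K \<pi> t"
  proof (rule measure_eqI)
    show "sets (distr M SX (X t)) = sets (M \<bind> filter_process K \<pi> t)"
      using sets_bind[of M "filter_process K \<pi> t" SX] measurable_space[OF MF] ne by (auto simp: space_subprob_algebra)
    fix A assume "A \<in> sets (distr M SX (X t))"
    then have A: "A \<in> sets SX" by simp
    have m: "(\<lambda>w. emeasure (filter_process K \<pi> t w) A) \<in> borel_measurable P"
      by (rule measurable_compose[OF filter_meas_P measurable_emeasure_subprob_algebra[OF A]])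
    show "emeasure (distr M SX (X t)) A = emeasure (M \<bind> filter_process K \<pi> t) A"
      using fc B A by (simp add: eX emeasure_bind[OF ne MF A] intM[OF m] filter_correct_def)
  qed
  have 2: "distr M SX (X (Suc t)) = distr M SX (X t) \<bind> K (Suc t)"
  proof (rule measure_eqI)
    have ne': "space (distr M SX (X t)) \<noteq> {}" using not_empty measurable_space[OF X_meas] by auto
    have KD: "K (Suc t) \<in> measurable (distr M SX (X t)) (subprob_algebra SX)" using KS by simp
    show "sets (distr M SX (X (Suc t))) = sets (distr M SX (X t) \<bind> K (Suc t))"
      using sets_bind[of "distr M SX (X t)" "K (Suc t)" SX] measurable_space[OF KD] ne' by (auto simp: space_subprob_algebra)
    fix A assume "A \<in> sets (distr M SX (X (Suc t)))"
    then have A: "A \<in> sets SX" by simp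
    have Kp: "emeasure (K (Suc t) (X t w)) A = ennreal (measure (K (Suc t) (X t w)) A)" "measure (K (Suc t) (X t w)) A \<le> 1"
      if "w \<in> space P" for w
    proof -
      have "K (Suc t) (X t w) \<in> space (subprob_algebra SX)" using measurable_space[OF KS measurable_space[OF X_meas that]] .
      then interpret subprob_space "K (Suc t) (X t w)" by (simp add: space_subprob_algebra)
      show "emeasure (K (Suc t) (X t w)) A = ennreal (measure (K (Suc t) (X t w)) A)" by (rule emeasure_eq_measure)
      show "measure (K (Suc t) (X t w)) A \<le> 1" by (rule subprob_measure_le_1)
    qed
    have mK: "(\<lambda>w. measure (K (Suc t) (X t w)) A) \<in> borel_measurable P"
      by (rule measurable_compose[OF X_meas measurable_compose[OF KS measurable_measure_subprob_algebra[OF A]]])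
    have mK': "(\<lambda>w. emeasure (K (Suc t) (X t w)) A) \<in> borel_measurable P"
      by (rule measurable_compose[OF X_meas measurable_compose[OF KS measurable_emeasure_subprob_algebra[OF A]]])
    have "emeasure (distr M SX (X (Suc t))) A = (\<integral>\<^sup>+w. ennreal (indicator A (X (Suc t) w) * indicator ?H w) \<partial>P)"
      unfolding eX[OF A] by (intro nn_integral_cong) (auto simp: indicator_def)
    also have "\<dots> = ennreal (\<integral>w. indicator A (X (Suc t) w) * indicator ?H w \<partial>P)"
      using A by (intro nn_integral_eq_integral integrable_const_bound[where B=1] AE_I2) (auto simp: indicator_def)
    also have "\<dots> = ennreal (\<integral>w. measure (K (Suc t) (X t w)) A * indicator ?H w \<partial>P)"
      by (simp only: markov_given_obs[OF B A])
    also have "\<dots> = (\<integral>\<^sup>+w. ennreal (measure (K (Suc t) (X t w)) A * indicator ?H w) \<partial>P)"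
      using mK Kp by (intro nn_integral_eq_integral[symmetric] integrable_const_bound[where B=1] AE_I2) (auto simp: indicator_def)
    also have "\<dots> = (\<integral>\<^sup>+w\<in>?H. emeasure (K (Suc t) (X t w)) A \<partial>P)"
      using Kp by (intro nn_integral_cong) (auto simp: indicator_def)
    also have "\<dots> = emeasure (distr M SX (X t) \<bind> K (Suc t)) A"
      using measurable_compose[OF KS measurable_emeasure_subprob_algebra[OF A]]
      by (simp add: emeasure_bind[OF ne' KD A] nn_integral_distr[OF MX] intM[OF mK'])
    finally show "emeasure (distr M SX (X (Suc t))) A = emeasure (distr M SX (X t) \<bind> K (Suc t)) A" .
  qed
  have "(\<integral>\<^sup>+w\<in>?H. h (X (Suc t) w) \<partial>P) = (\<integral>\<^sup>+w. h (X (Suc t) w) \<partial>M)"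
    using measurable_compose[OF X_meas h] by (simp add: intM)
  also have "\<dots> = (\<integral>\<^sup>+x. h x \<partial>distr M SX (X (Suc t)))"
    using h by (intro nn_integral_distr[symmetric] MX) auto
  also have "\<dots> = (\<integral>\<^sup>+x. h x \<partial>(M \<bind> prediction t))"
    unfolding 2 1 by (simp only: bind_assoc[OF MF KS])
  also have "\<dots> = (\<integral>\<^sup>+w. (\<integral>\<^sup>+x. h x \<partial>prediction t w) \<partial>M)"
    using h prediction_meas_P by (intro nn_integral_bind) (auto cong: measurable_cong_sets simp: M)
  also have "\<dots> = (\<integral>\<^sup>+w. (\<integral>\<^sup>+x. h x \<partial>prediction t w) * indicator ?H w \<partial>P)"
    by (intro intM measurable_compose[OF prediction_meas_P nn_integral_measurable_subprob_algebra[OF h]])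
  finally show ?thesis .
qed

lemma joint_next:
  assumes fc: "filter_correct t" and B: "\<And>s. B s \<in> sets SY" and A: "A \<in> sets SX" and C: "C \<in> sets SY"
  shows "(\<integral>\<^sup>+w. indicator A (X (Suc t) w) * indicator (obs_rect t B) w * indicator C (Y (Suc t) w) \<partial>P)
     = (\<integral>\<^sup>+w. (\<integral>\<^sup>+y. (\<integral>\<^sup>+x\<in>A. ennreal (g (Suc t) y x) \<partial>prediction t w) * indicator C y \<partial>T) * indicator (obs_rect t B) w \<partial>P)"
proof -
  let ?H = "obs_rect t B"
  interpret L: likelihood T SX "g (Suc t)" by (rule likelihood_g) simp
  have H[measurable]: "?H \<in> events" by (rule obs_rect_events[OF B])
  have Y1[measurable]: "Y (Suc t) \<in> measurable P SY" by (rule Y_meas) simp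
  have Xs: "X s w \<in> space SX" if "w \<in> space P" for s w using measurable_space[OF X_meas that] .
  note A[measurable] C[measurable]
  have C': "C \<in> sets T" using C sets_T by simp
  have om[measurable]: "(\<lambda>x. obs_prob (Suc t) x C) \<in> borel_measurable SX" by (rule obs_prob_meas[OF _ C]) simp
  have "(\<integral>\<^sup>+w. indicator A (X (Suc t) w) * indicator ?H w * indicator C (Y (Suc t) w) \<partial>P)
     = (\<integral>\<^sup>+w. ennreal (indicator A (X (Suc t) w) * indicator ?H w * indicator C (Y (Suc t) w)) \<partial>P)"
    by (intro nn_integral_cong) (auto simp: indicator_def)
  also have "\<dots> = ennreal (\<integral>w. indicator A (X (Suc t) w) * indicator ?H w * indicator C (Y (Suc t) w) \<partial>P)"
    by (intro nn_integral_eq_integral integrable_const_bound[where B=1] AE_I2) (auto simp: indicator_def)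
  also have "\<dots> = ennreal (\<integral>w. indicator A (X (Suc t) w) * obs_prob (Suc t) (X (Suc t) w) C * indicator ?H w \<partial>P)"
    by (simp only: obs_next[OF B A C])
  also have "\<dots> = (\<integral>\<^sup>+w. ennreal (indicator A (X (Suc t) w) * obs_prob (Suc t) (X (Suc t) w) C * indicator ?H w) \<partial>P)"
    using obs_prob_eq[OF _ Xs C] 
    by (intro nn_integral_eq_integral[symmetric] integrable_const_bound[where B=1] AE_I2) (auto simp: indicator_def)
  also have "\<dots> = (\<integral>\<^sup>+w\<in>?H. (\<lambda>x. indicator A x * ennreal (obs_prob (Suc t) x C)) (X (Suc t) w) \<partial>P)"
    by (intro nn_integral_cong) (auto simp: indicator_def)
  also have "\<dots> = (\<integral>\<^sup>+w. (\<integral>\<^sup>+x. indicator A x * ennreal (obs_prob (Suc t) x C) \<partial>prediction t w) * indicator ?H w \<partial>P)"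
    by (rule prediction_correct[OF fc B]) measurable
  also have "\<dots> = (\<integral>\<^sup>+w. (\<integral>\<^sup>+y. (\<integral>\<^sup>+x\<in>A. ennreal (g (Suc t) y x) \<partial>prediction t w) * indicator C y \<partial>T) * indicator ?H w \<partial>P)"
  proof (rule nn_integral_cong, rule arg_cong2[where f="(*)", OF _ refl])
    fix w assume w: "w \<in> space P"
    let ?\<mu> = "prediction t w"
    have \<mu>: "?\<mu> \<in> space (subprob_algebra SX)" by (rule measurable_space[OF prediction_meas_P w])
    then have s[measurable_cong]: "sets ?\<mu> = sets SX" and sub: "subprob_space ?\<mu>" by (auto simp: space_subprob_algebra)
    interpret \<mu>: subprob_space ?\<mu> by fact
    interpret pair_sigma_finite T ?\<mu> by unfold_locales
    have sp: "space ?\<mu> = space SX" using s by (rule sets_eq_imp_space_eq)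
    have m: "(\<lambda>(y, x). ennreal (g (Suc t) y x) * indicator A x * indicator C y) \<in> borel_measurable (T \<Otimes>\<^sub>M ?\<mu>)"
      using C' by measurable
    have "(\<integral>\<^sup>+x. indicator A x * ennreal (obs_prob (Suc t) x C) \<partial>?\<mu>)
      = (\<integral>\<^sup>+x. (\<integral>\<^sup>+y\<in>C. ennreal (g (Suc t) y x) * indicator A x \<partial>T) \<partial>?\<mu>)"
    proof (rule nn_integral_cong)
      fix x assume "x \<in> space ?\<mu>"
      then have x: "x \<in> space SX" using sp by simp
      show "indicator A x * ennreal (obs_prob (Suc t) x C) = (\<integral>\<^sup>+y\<in>C. ennreal (g (Suc t) y x) * indicator A x \<partial>T)"
        using obs_prob_eq(1)[OF _ x C, of "Suc t"] by (cases "x \<in> A") auto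
    qed
    also have "\<dots> = (\<integral>\<^sup>+y. (\<integral>\<^sup>+x. ennreal (g (Suc t) y x) * indicator A x * indicator C y \<partial>?\<mu>) \<partial>T)"
      using Fubini'[OF m] by simp
    also have "\<dots> = (\<integral>\<^sup>+y. (\<integral>\<^sup>+x\<in>A. ennreal (g (Suc t) y x) \<partial>?\<mu>) * indicator C y \<partial>T)"
      by (intro nn_integral_cong) (auto simp: indicator_def)
    finally show "(\<integral>\<^sup>+x. indicator A x * ennreal (obs_prob (Suc t) x C) \<partial>?\<mu>)
      = (\<integral>\<^sup>+y. (\<integral>\<^sup>+x\<in>A. ennreal (g (Suc t) y x) \<partial>?\<mu>) * indicator C y \<partial>T)" .
  qed
  finally show ?thesis .
qed

abbreviation evidence :: "nat \<Rightarrow> 'y \<Rightarrow> 'x measure \<Rightarrow> ennreal" where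
  "evidence t \<equiv> likelihood.evidence (g t)"

text \<open>Both sides integrate \<open>\<phi>\<close> against a finite measure on pairs of a past and a next observation, and the two
measures agree on rectangles by \<open>joint_next\<close>.\<close>

lemma disintegration_step:
  assumes fc: "filter_correct t" and \<phi>: "\<phi> \<in> borel_measurable (obs_algebra t \<Otimes>\<^sub>M T)"
  shows "(\<integral>\<^sup>+w. \<phi> (w, Y (Suc t) w) \<partial>P)
     = (\<integral>\<^sup>+w. (\<integral>\<^sup>+y. \<phi> (w, y) * evidence (Suc t) y (prediction t w) \<partial>T) \<partial>P)"
proof -
  interpret L: likelihood T SX "g (Suc t)" by (rule likelihood_g) simp
  let ?G = "restr_to_subalg P (obs_algebra t)"
  have G: "sets ?G = sets (obs_algebra t)" "space ?G = space P"
    by (rule sets_restr_to_subalg[OF subalg]) (simp add: space_restr_to_subalg)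
  have GT: "sets (?G \<Otimes>\<^sub>M T) = sets (obs_algebra t \<Otimes>\<^sub>M T)" by (rule sets_pair_measure_cong[OF G(1) refl])
  have finG: "finite_measure ?G" using finite_measure_restr_to_subalg[OF subalg] by simp
  interpret G: finite_measure ?G by (rule finG)
  interpret GT: pair_sigma_finite ?G T by unfold_locales
  define ev where "ev z = evidence (Suc t) (snd z) (prediction t (fst z))" for z
  have ev: "ev \<in> borel_measurable (obs_algebra t \<Otimes>\<^sub>M T)"
    unfolding ev_def using L.evidence_measurable[OF prediction_meas] by (simp add: case_prod_beta')
  have mcong: "f \<in> borel_measurable (?G \<Otimes>\<^sub>M T)" if "f \<in> borel_measurable (obs_algebra t \<Otimes>\<^sub>M T)" for f :: "_ \<Rightarrow> ennreal"
    using that by (simp cong: measurable_cong_sets add: GT)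
  have prod: "(\<integral>\<^sup>+z. f z \<partial>(?G \<Otimes>\<^sub>M T)) = (\<integral>\<^sup>+w. (\<integral>\<^sup>+y. f (w, y) \<partial>T) \<partial>P)"
    if f: "f \<in> borel_measurable (obs_algebra t \<Otimes>\<^sub>M T)" for f :: "_ \<Rightarrow> ennreal"
  proof -
    have "(\<lambda>w. \<integral>\<^sup>+y. f (w, y) \<partial>T) \<in> borel_measurable (obs_algebra t)"
      by (rule L.T.borel_measurable_nn_integral_fst[OF f])
    then show ?thesis
      using L.T.nn_integral_fst[OF mcong[OF f]] nn_integral_subalgebra2[OF subalg] by simp
  qed
  let ?N1 = "distr P (obs_algebra t \<Otimes>\<^sub>M T) (\<lambda>w. (w, Y (Suc t) w))"
  let ?N2 = "density (?G \<Otimes>\<^sub>M T) ev"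
  let ?E = "{H \<times> C | H C. H \<in> obs_rects t \<and> C \<in> sets T}"
  let ?\<Omega> = "space P \<times> space T"
  have top: "space P \<in> obs_rects t"
    unfolding obs_rects_def using space_obs_rect[of t] by (auto intro!: exI[of _ "\<lambda>_. space SY"])
  have sE: "sets (obs_algebra t \<Otimes>\<^sub>M T) = sigma_sets ?\<Omega> ?E"
  proof -
    have "sets (obs_algebra t \<Otimes>\<^sub>M T) = sets (sigma (space (obs_algebra t) \<times> space T) ?E)"
      using top obs_rects_Pow
      by (intro sets_pair_eq[where Ca="{space P}" and Cb="{space T}"])
         (auto simp: sets_obs sets.sigma_sets_eq dest: sets.sets_into_space)
    then show ?thesis
      using obs_rects_Pow by (subst (asm) sets_measure_of) (auto dest: sets.sets_into_space)
  qed
  have "?N1 = ?N2"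
  proof (rule measure_eqI_generator_eq[where A="\<lambda>_. ?\<Omega>"])
    show "Int_stable ?E"
    proof (rule Int_stableI)
      fix a b assume "a \<in> ?E" "b \<in> ?E"
      then obtain H C H' C' where h: "a = H \<times> C" "b = H' \<times> C'" "H \<in> obs_rects t" "H' \<in> obs_rects t" "C \<in> sets T" "C' \<in> sets T"
        by auto
      obtain B B' where b: "H = obs_rect t B" "H' = obs_rect t B'" "\<forall>s. B s \<in> sets SY" "\<forall>s. B' s \<in> sets SY"
        using h by (auto simp: obs_rects_def)
      have "H \<inter> H' \<in> obs_rects t"
        unfolding b obs_rect_Int unfolding obs_rects_def using b by blast
      moreover have "a \<inter> b = (H \<inter> H') \<times> (C \<inter> C')" using h by auto
      ultimately show "a \<inter> b \<in> ?E" using h by blast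
    qed
    show "?E \<subseteq> Pow ?\<Omega>" using obs_rects_Pow by (auto dest: sets.sets_into_space)
    show "sets ?N1 = sigma_sets ?\<Omega> ?E" "sets ?N2 = sigma_sets ?\<Omega> ?E" using sE GT by simp_all
    show "range (\<lambda>_. ?\<Omega>) \<subseteq> ?E" using top by auto
    show "(\<Union>i::nat. ?\<Omega>) = ?\<Omega>" by simp
    have "prob_space ?N1" by (rule prob_space_distr[OF pair_obs_P])
    then show "emeasure ?N1 ?\<Omega> \<noteq> \<infinity>"
      by (metis finite_measure.emeasure_finite prob_space.axioms(1) infinity_ennreal_def)
    fix Z assume "Z \<in> ?E"
    then obtain B C where Z: "Z = obs_rect t B \<times> C" "\<And>s. B s \<in> sets SY" "C \<in> sets T"
      by (auto simp: obs_rects_def)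
    have ZM: "Z \<in> sets (obs_algebra t \<Otimes>\<^sub>M T)"
      using Z obs_rect_in by auto
    have CY: "C \<in> sets SY" using Z sets_T by simp
    have "emeasure ?N1 Z = (\<integral>\<^sup>+z. indicator Z z \<partial>?N1)" using ZM by simp
    also have "\<dots> = (\<integral>\<^sup>+w. indicator Z (w, Y (Suc t) w) \<partial>P)"
      using ZM by (intro nn_integral_distr pair_obs_P) auto
    also have "\<dots> = (\<integral>\<^sup>+w. indicator (space SX) (X (Suc t) w) * indicator (obs_rect t B) w * indicator C (Y (Suc t) w) \<partial>P)"
      using measurable_space[OF X_meas] by (intro nn_integral_cong) (auto simp: Z indicator_def)
    also have "\<dots> = (\<integral>\<^sup>+w. (\<integral>\<^sup>+y. (\<integral>\<^sup>+x\<in>(space SX). ennreal (g (Suc t) y x) \<partial>prediction t w) * indicator C y \<partial>T) * indicator (obs_rect t B) w \<partial>P)"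
      by (rule joint_next[OF fc Z(2) sets.top CY])
    also have "\<dots> = (\<integral>\<^sup>+w. (\<integral>\<^sup>+y. ev (w, y) * indicator Z (w, y) \<partial>T) \<partial>P)"
    proof (rule nn_integral_cong)
      fix w assume w: "w \<in> space P"
      have "space (prediction t w) = space SX"
        using measurable_space[OF prediction_meas_P w] by (auto simp: space_subprob_algebra dest: sets_eq_imp_space_eq)
      then have e: "(\<integral>\<^sup>+x\<in>(space SX). ennreal (g (Suc t) y x) \<partial>prediction t w) = ev (w, y)" for y
        unfolding ev_def L.evidence_def fst_conv snd_conv by (intro nn_integral_cong) auto
      show "(\<integral>\<^sup>+y. (\<integral>\<^sup>+x\<in>(space SX). ennreal (g (Suc t) y x) \<partial>prediction t w) * indicator C y \<partial>T) * indicator (obs_rect t B) w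
         = (\<integral>\<^sup>+y. ev (w, y) * indicator Z (w, y) \<partial>T)"
        unfolding e by (cases "w \<in> obs_rect t B") (auto simp: Z indicator_def intro!: nn_integral_cong)
    qed
    also have "\<dots> = (\<integral>\<^sup>+z\<in>Z. ev z \<partial>(?G \<Otimes>\<^sub>M T))"
      using ev ZM by (intro prod[symmetric]) auto
    also have "\<dots> = emeasure ?N2 Z"
      using mcong[OF ev] ZM GT by (subst emeasure_density) auto
    finally show "emeasure ?N1 Z = emeasure ?N2 Z" .
  qed
  have "(\<integral>\<^sup>+w. \<phi> (w, Y (Suc t) w) \<partial>P) = (\<integral>\<^sup>+z. \<phi> z \<partial>?N1)"
    using \<phi> pair_obs_P by (subst nn_integral_distr) auto
  also have "\<dots> = (\<integral>\<^sup>+z. ev z * \<phi> z \<partial>(?G \<Otimes>\<^sub>M T))"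
    unfolding \<open>?N1 = ?N2\<close> by (rule nn_integral_density) (auto intro!: mcong ev \<phi>)
  also have "\<dots> = (\<integral>\<^sup>+w. (\<integral>\<^sup>+y. ev (w, y) * \<phi> (w, y) \<partial>T) \<partial>P)"
    using ev \<phi> by (intro prod) auto
  finally show ?thesis by (simp add: ev_def mult.commute)
qed

text \<open>Bayes' formula: by \<open>disintegration_step\<close>, the average of the updated filter is an integral over \<open>y\<close> in which
the evidence cancels the normalisation.\<close>

lemma filter_correct: "filter_correct t"
proof (induction t)
  case 0
  show ?case
    unfolding filter_correct_def
  proof (intro allI impI)
    fix B :: "nat \<Rightarrow> 'y set" and A assume A: "A \<in> sets SX"
    have d: "distr P SX (X 0) = \<pi>" using generated unfolding generated_by_model_def by (elim conjE)
    have "(\<integral>\<^sup>+w. indicator A (X 0 w) * indicator (obs_rect 0 B) w \<partial>P) = (\<integral>\<^sup>+w. indicator A (X 0 w) \<partial>P)"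
      by (intro nn_integral_cong) (auto simp: obs_rect_def)
    also have "\<dots> = (\<integral>\<^sup>+x. indicator A x \<partial>distr P SX (X 0))"
      using A by (intro nn_integral_distr[symmetric] X_meas) auto
    also have "\<dots> = emeasure \<pi> A" unfolding d using A \<pi>_prob by (simp add: space_prob_algebra)
    also have "\<dots> = (\<integral>\<^sup>+w. emeasure \<pi> A \<partial>P)" by (simp add: emeasure_space_1)
    also have "\<dots> = (\<integral>\<^sup>+w. emeasure (filter_process K \<pi> 0 w) A * indicator (obs_rect 0 B) w \<partial>P)"
      by (intro nn_integral_cong) (auto simp: obs_rect_def filter_process_def)
    finally show "(\<integral>\<^sup>+w. indicator A (X 0 w) * indicator (obs_rect 0 B) w \<partial>P)
       = (\<integral>\<^sup>+w. emeasure (filter_process K \<pi> 0 w) A * indicator (obs_rect 0 B) w \<partial>P)" .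
  qed
next
  case (Suc t)
  interpret L: likelihood T SX "g (Suc t)" by (rule likelihood_g) simp
  show ?case
    unfolding filter_correct_def
  proof (intro allI impI)
    fix B :: "nat \<Rightarrow> 'y set" and A assume B: "\<forall>s. B s \<in> sets SY" and A: "A \<in> sets SX"
    let ?C = "B (Suc t)"
    have C: "?C \<in> sets SY" "?C \<in> sets T" using B sets_T by auto
    have r: "indicator (obs_rect (Suc t) B) w = indicator (obs_rect t B) w * (indicator ?C (Y (Suc t) w) :: ennreal)" for w
      by (auto simp: obs_rect_def indicator_def atLeastAtMostSuc_conv)
    define U where "U z = emeasure (bayes_update (g (Suc t) (snd z)) (prediction t (fst z))) A" for z
    define \<phi> where "\<phi> z = U z * indicator (obs_rect t B) (fst z) * indicator ?C (snd z)" for z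
    have U: "U \<in> borel_measurable (obs_algebra t \<Otimes>\<^sub>M T)"
      using measurable_compose[OF L.update_measurable[OF prediction_meas] measurable_emeasure_subprob_algebra[OF A]]
      unfolding U_def by (simp add: case_prod_beta')
    have \<phi>: "\<phi> \<in> borel_measurable (obs_algebra t \<Otimes>\<^sub>M T)"
    proof -
      have [measurable]: "obs_rect t B \<in> sets (obs_algebra t)" using obs_rect_in B by auto
      note U[measurable] C(2)[measurable]
      show ?thesis unfolding \<phi>_def by measurable
    qed
    have "(\<integral>\<^sup>+w. indicator A (X (Suc t) w) * indicator (obs_rect (Suc t) B) w \<partial>P)
       = (\<integral>\<^sup>+w. indicator A (X (Suc t) w) * indicator (obs_rect t B) w * indicator ?C (Y (Suc t) w) \<partial>P)"
      by (simp add: r mult.assoc)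
    also have "\<dots> = (\<integral>\<^sup>+w. (\<integral>\<^sup>+y. (\<integral>\<^sup>+x\<in>A. ennreal (g (Suc t) y x) \<partial>prediction t w) * indicator ?C y \<partial>T) * indicator (obs_rect t B) w \<partial>P)"
      using B by (intro joint_next[OF Suc _ A C(1)]) auto
    also have "\<dots> = (\<integral>\<^sup>+w. (\<integral>\<^sup>+y. \<phi> (w, y) * evidence (Suc t) y (prediction t w) \<partial>T) \<partial>P)"
    proof (rule nn_integral_cong)
      fix w assume w: "w \<in> space P"
      have \<mu>: "prediction t w \<in> space (subprob_algebra SX)" by (rule measurable_space[OF prediction_meas_P w])
      have "(\<integral>\<^sup>+y. \<phi> (w, y) * evidence (Suc t) y (prediction t w) \<partial>T)
        = (\<integral>\<^sup>+y. (\<integral>\<^sup>+x\<in>A. ennreal (g (Suc t) y x) \<partial>prediction t w) * indicator ?C y * indicator (obs_rect t B) w \<partial>T)"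
      proof (rule nn_integral_cong_AE)
        show "AE y in T. \<phi> (w, y) * evidence (Suc t) y (prediction t w)
           = (\<integral>\<^sup>+x\<in>A. ennreal (g (Suc t) y x) \<partial>prediction t w) * indicator ?C y * indicator (obs_rect t B) w"
          using L.AE_evidence_finite[OF \<mu>] AE_space
        proof eventually_elim
          case (elim y)
          have "U (w, y) * evidence (Suc t) y (prediction t w) = (\<integral>\<^sup>+x\<in>A. ennreal (g (Suc t) y x) \<partial>prediction t w)"
            unfolding U_def using L.emeasure_update_times_evidence[OF \<mu> _ _ A] elim by simp
          moreover have "\<phi> (w, y) * evidence (Suc t) y (prediction t w)
             = U (w, y) * evidence (Suc t) y (prediction t w) * indicator ?C y * indicator (obs_rect t B) w"
            by (simp add: \<phi>_def mult_ac)
          ultimately show ?case by simp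
        qed
      qed
      also have "\<dots> = (\<integral>\<^sup>+y. (\<integral>\<^sup>+x\<in>A. ennreal (g (Suc t) y x) \<partial>prediction t w) * indicator ?C y \<partial>T) * indicator (obs_rect t B) w"
        by (cases "w \<in> obs_rect t B") auto
      finally show "(\<integral>\<^sup>+y. (\<integral>\<^sup>+x\<in>A. ennreal (g (Suc t) y x) \<partial>prediction t w) * indicator ?C y \<partial>T) * indicator (obs_rect t B) w
         = (\<integral>\<^sup>+y. \<phi> (w, y) * evidence (Suc t) y (prediction t w) \<partial>T)" by simp
    qed
    also have "\<dots> = (\<integral>\<^sup>+w. \<phi> (w, Y (Suc t) w) \<partial>P)"
      by (rule disintegration_step[OF Suc \<phi>, symmetric])
    also have "\<dots> = (\<integral>\<^sup>+w. emeasure (filter_process K \<pi> (Suc t) w) A * indicator (obs_rect (Suc t) B) w \<partial>P)"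
      by (simp add: \<phi>_def U_def r filter_process_Suc mult.assoc)
    finally show "(\<integral>\<^sup>+w. indicator A (X (Suc t) w) * indicator (obs_rect (Suc t) B) w \<partial>P)
       = (\<integral>\<^sup>+w. emeasure (filter_process K \<pi> (Suc t) w) A * indicator (obs_rect (Suc t) B) w \<partial>P)" .
  qed
qed

lemmas disintegration = disintegration_step[OF filter_correct]

text \<open>Observations whose evidence under the second model is zero or infinite form a null set for the reference
measure \<open>T\<close>, and the true law of the next observation is absolutely continuous with respect to it.\<close>

lemma filter_process_prob:
  assumes K': "\<And>t. 1 \<le> t \<Longrightarrow> K' t \<in> measurable SX (prob_algebra SX)" and \<pi>': "\<pi>' \<in> space (prob_algebra SX)"
  shows "AE w in P. filter_process K' \<pi>' t w \<in> space (prob_algebra SX)"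
proof (induction t)
  case 0
  then show ?case using \<pi>' by (simp add: filter_process_def)
next
  case (Suc t)
  interpret L: likelihood T SX "g (Suc t)" by (rule likelihood_g) simp
  let ?q = "\<lambda>w. filter_process K' \<pi>' t w \<bind> K' (Suc t)"
  have q: "?q \<in> measurable (obs_algebra t) (subprob_algebra SX)"
    by (rule predict_process_meas[OF filter_process_meas[OF K' \<pi>'] K']) simp_all
  define ev where "ev z = evidence (Suc t) (snd z) (?q (fst z))" for z
  have ev[measurable]: "ev \<in> borel_measurable (obs_algebra t \<Otimes>\<^sub>M T)"
    unfolding ev_def using L.evidence_measurable[OF q] by (simp add: case_prod_beta')
  define bad where "bad = {z \<in> space (obs_algebra t \<Otimes>\<^sub>M T). ev z = 0 \<or> ev z = \<infinity>}"
  have bad: "bad \<in> sets (obs_algebra t \<Otimes>\<^sub>M T)" unfolding bad_def by measurable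
  have "(\<integral>\<^sup>+w. indicator bad (w, Y (Suc t) w) \<partial>P)
     = (\<integral>\<^sup>+w. (\<integral>\<^sup>+y. indicator bad (w, y) * evidence (Suc t) y (prediction t w) \<partial>T) \<partial>P)"
    using bad by (intro disintegration) auto
  also have "\<dots> = (\<integral>\<^sup>+w. 0 \<partial>P)"
  proof (rule nn_integral_cong_AE)
    show "AE w in P. (\<integral>\<^sup>+y. indicator bad (w, y) * evidence (Suc t) y (prediction t w) \<partial>T) = 0"
      using Suc AE_space
    proof eventually_elim
      case (elim w)
      have "prob_space (?q w)" using elim K' by (intro prob_space_bind') auto
      then have qw: "?q w \<in> space (subprob_algebra SX)" "?q w \<in> space (prob_algebra SX)"
        using measurable_space[OF q, of w] elim by (auto simp: space_prob_algebra space_subprob_algebra)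
      have "AE y in T. indicator bad (w, y) * evidence (Suc t) y (prediction t w) = 0"
        using L.AE_evidence_finite[OF qw(1)] L.AE_evidence_pos[OF qw(2)]
        by eventually_elim (auto simp: bad_def ev_def indicator_def)
      then have "(\<integral>\<^sup>+y. indicator bad (w, y) * evidence (Suc t) y (prediction t w) \<partial>T) = (\<integral>\<^sup>+y. 0 \<partial>T)"
        by (rule nn_integral_cong_AE)
      then show ?case by simp
    qed
  qed
  finally have "(\<integral>\<^sup>+w. indicator bad (w, Y (Suc t) w) \<partial>P) = 0" by simp
  moreover have "(\<lambda>w. indicator bad (w, Y (Suc t) w) :: ennreal) \<in> borel_measurable P"
    using measurable_compose[OF pair_obs_P borel_measurable_indicator[OF bad]] by simp
  ultimately have "AE w in P. (indicator bad (w, Y (Suc t) w) :: ennreal) = 0"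
    by (simp add: nn_integral_0_iff_AE)
  then show ?case using AE_space
  proof eventually_elim
    case (elim w)
    have y: "Y (Suc t) w \<in> space T" using Y_space[of "Suc t" w] elim by (simp add: space_T)
    have "(w, Y (Suc t) w) \<notin> bad" using elim by (auto simp: indicator_def split: if_splits)
    then have "ev (w, Y (Suc t) w) \<noteq> 0" "ev (w, Y (Suc t) w) \<noteq> \<infinity>"
      using elim y by (auto simp: bad_def space_pair_measure)
    then show ?case
      unfolding filter_process_Suc using elim
      by (intro L.bayes_update_prob y measurable_space[OF q]) (auto simp: ev_def less_top)
  qed
qed

end

section \<open>Total variation, kernel norm and kernel distance\<close>

lemma excess_commute:
  assumes \<mu>: "\<mu> \<in> space (prob_algebra M)" and \<nu>: "\<nu> \<in> space (prob_algebra M)"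
  shows "excess M 1 \<mu> 1 \<nu> = excess M 1 \<nu> 1 \<mu>"
proof -
  have le: "excess M 1 \<mu> 1 \<nu> \<le> excess M 1 \<nu> 1 \<mu>"
    if \<mu>: "\<mu> \<in> space (prob_algebra M)" and \<nu>: "\<nu> \<in> space (prob_algebra M)" for \<mu> \<nu>
  proof (rule excess_least)
    fix F assume F: "F \<in> sets M"
    have s: "sets \<mu> = sets M" "sets \<nu> = sets M" "prob_space \<mu>" "prob_space \<nu>"
      using \<mu> \<nu> by (auto simp: space_prob_algebra)
    interpret subprob_pair M \<nu> \<mu> 1 1 by (rule prob_pair[OF \<nu> \<mu>]) simp_all
    have "measure \<mu> (space M - F) = 1 - measure \<mu> F" "measure \<nu> (space M - F) = 1 - measure \<nu> F"
      using prob_space.prob_compl[OF s(3), of F] prob_space.prob_compl[OF s(4), of F] F s(1,2)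
        sets_eq_imp_space_eq[OF s(1)] sets_eq_imp_space_eq[OF s(2)] by auto
    then show "1 * measure \<mu> F - 1 * measure \<nu> F \<le> excess M 1 \<nu> 1 \<mu>"
      using excess_upper[of "space M - F"] F by simp
  qed
  show ?thesis using le[OF \<mu> \<nu>] le[OF \<nu> \<mu>] by simp
qed

lemma tv_norm_eq_excess:
  "tv_norm M (\<lambda>F. c * measure_diff \<mu> \<nu> F) = (excess M c \<mu> c \<nu> + excess M c \<nu> c \<mu>) / 2"
proof -
  have "(INF F\<in>sets M. c * measure_diff \<mu> \<nu> F) = - (SUP F\<in>sets M. - (c * measure_diff \<mu> \<nu> F))"
    by (simp add: Inf_real_def image_image)
  then show ?thesis
    by (simp add: tv_norm_def excess_def measure_diff_def algebra_simps)
qed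

lemma tv_norm_scaled_prob_diff:
  assumes \<mu>: "\<mu> \<in> space (prob_algebra M)" and \<nu>: "\<nu> \<in> space (prob_algebra M)" and c: "0 \<le> c"
  shows "tv_norm M (\<lambda>F. c * measure_diff \<mu> \<nu> F) = c * excess M 1 \<mu> 1 \<nu>"
  unfolding tv_norm_eq_excess
  using excess_scale[OF prob_pair[OF \<mu> \<nu>] c] excess_scale[OF prob_pair[OF \<nu> \<mu>] c] excess_commute[OF \<mu> \<nu>] by simp

lemma tv_norm_prob_diff:
  assumes \<mu>: "\<mu> \<in> space (prob_algebra M)" and \<nu>: "\<nu> \<in> space (prob_algebra M)"
  shows "tv_norm M (measure_diff \<mu> \<nu>) = excess M 1 \<mu> 1 \<nu>"
  using tv_norm_scaled_prob_diff[OF assms, of 1] by simp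

lemma tv_norm_cong: "(\<And>F. F \<in> sets M \<Longrightarrow> m F = m' F) \<Longrightarrow> tv_norm M m = tv_norm M m'"
  by (simp add: tv_norm_def)

lemma excess_prob_upper:
  assumes \<mu>: "\<mu> \<in> space (prob_algebra M)" and \<nu>: "\<nu> \<in> space (prob_algebra M)" and F: "F \<in> sets M"
  shows "measure \<mu> F - measure \<nu> F \<le> excess M 1 \<mu> 1 \<nu>"
  using subprob_pair.excess_upper[OF prob_pair[OF \<mu> \<nu> zero_le_one zero_le_one] F] by simp

lemma bind_in_prob_algebra:
  assumes "\<mu> \<in> space (prob_algebra S)" "k \<in> measurable S (prob_algebra S)"
  shows "\<mu> \<bind> k \<in> space (prob_algebra S)"
  using prob_space_bind'[OF assms] sets_bind'[OF assms] by (simp add: space_prob_algebra)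

text \<open>Test the supremum with the point mass at \<open>x\<close>.\<close>

lemma measure_le_kernel_dist:
  assumes k: "k \<in> measurable (borel_of_set A) (prob_algebra (borel_of_set A))"
    and l: "l \<in> measurable (borel_of_set A) (prob_algebra (borel_of_set A))"
    and x: "x \<in> space (borel_of_set A)" and F: "F \<in> sets (borel_of_set A)"
  shows "\<bar>measure (k x) F - measure (l x) F\<bar> \<le> kernel_dist A k l"
proof -
  let ?S = "borel_of_set A"
  have kx: "k x \<in> space (prob_algebra ?S)" "l x \<in> space (prob_algebra ?S)"
    using measurable_space[OF k x] measurable_space[OF l x] by auto
  have r: "return ?S x \<in> space (prob_algebra ?S)"
    using prob_space_return[OF x] by (simp add: space_prob_algebra)
  have b: "return ?S x \<bind> k = k x" "return ?S x \<bind> l = l x"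
    using measurable_prob_algebraD[OF k] measurable_prob_algebraD[OF l] x by (auto intro!: bind_return)
  have "bdd_above ((\<lambda>\<nu>. tv_norm ?S (measure_diff (\<nu> \<bind> k) (\<nu> \<bind> l))) ` space (prob_algebra ?S))"
  proof (rule bdd_aboveI2)
    fix \<nu> assume \<nu>: "\<nu> \<in> space (prob_algebra ?S)"
    note bp = bind_in_prob_algebra[OF \<nu> k] bind_in_prob_algebra[OF \<nu> l]
    show "tv_norm ?S (measure_diff (\<nu> \<bind> k) (\<nu> \<bind> l)) \<le> 1"
      using subprob_pair.excess_le[OF prob_pair[OF bp zero_le_one zero_le_one]] by (simp add: tv_norm_prob_diff[OF bp])
  qed
  from cSUP_upper[OF r this] have "excess ?S 1 (k x) 1 (l x) \<le> kernel_dist A k l"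
    by (simp add: kernel_dist_def b tv_norm_prob_diff[OF kx])
  moreover have "measure (k x) F - measure (l x) F \<le> excess ?S 1 (k x) 1 (l x)"
    by (rule excess_prob_upper[OF kx F])
  moreover have "measure (l x) F - measure (k x) F \<le> excess ?S 1 (k x) 1 (l x)"
    using excess_prob_upper[OF kx(2,1) F] excess_commute[OF kx] by simp
  ultimately show ?thesis by linarith
qed

lemma kernel_perturbation_refl:
  assumes k: "k \<in> measurable S (prob_algebra S)"
  shows "kernel_perturbation S k k 0 1"
proof
  have le1: "measure (k x) F \<le> 1" if "x \<in> space S" for x F
    using measurable_space[OF k that] by (auto simp: space_prob_algebra intro: prob_space.prob_le_1)
  show "measure (k x) F - measure (k x') F \<le> 1" if "x \<in> space S" for x x' F
    using le1[OF that, of F] measure_nonneg[of "k x'" F] by linarith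
qed (use k in auto)

text \<open>The factor \<open>c\<close> is absorbed into the measures, since \<open>signed_integral\<close> is computed from differences of finite
measures.\<close>

lemma kernel_signed_scaled:
  assumes \<mu>: "\<mu> \<in> space (prob_algebra S)" and \<nu>: "\<nu> \<in> space (prob_algebra S)" and c: "0 \<le> c"
    and k: "k \<in> measurable S (prob_algebra S)" and F: "F \<in> sets S"
  shows "kernel_signed S k (\<lambda>F. c * measure_diff \<mu> \<nu> F) F = c * measure_diff (\<mu> \<bind> k) (\<nu> \<bind> k) F"
proof -
  interpret K: kernel_perturbation S k k 0 1
    by (rule kernel_perturbation_refl[OF k])
  let ?A = "scale_measure (ennreal c) \<mu>" and ?B = "scale_measure (ennreal c) \<nu>"
  have s: "sets \<mu> = sets S" "sets \<nu> = sets S" "prob_space \<mu>" "prob_space \<nu>"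
    using \<mu> \<nu> by (auto simp: space_prob_algebra)
  have fin: "finite_measure ?A" "finite_measure ?B"
    using finite_measure.emeasure_finite[OF prob_space.finite_measure[OF s(3)]]
      finite_measure.emeasure_finite[OF prob_space.finite_measure[OF s(4)]]
    by (auto intro!: finite_measureI simp: ennreal_mult_eq_top_iff)
  have m: "(\<lambda>F. c * measure_diff \<mu> \<nu> F) = measure_diff ?A ?B"
    using c by (auto simp: measure_diff_def algebra_simps)
  have f: "(\<lambda>x. measure (k x) F) \<in> borel_measurable S"
    by (rule measurable_compose[OF measurable_prob_algebraD[OF k] measurable_measure_subprob_algebra[OF F]])
  have f1: "\<bar>measure (k x) F\<bar> \<le> 1" if "x \<in> space S" for x
    using measurable_space[OF k that] by (auto simp: space_prob_algebra intro: prob_space.prob_le_1)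
  have int: "(\<integral>x. measure (k x) F \<partial>scale_measure (ennreal c) \<rho>) = c * (\<integral>x. measure (k x) F \<partial>\<rho>)"
    if "sets \<rho> = sets S" for \<rho>
  proof -
    have fm: "(\<lambda>x. measure (k x) F) \<in> borel_measurable \<rho>" "(\<lambda>x. measure (k x) F) \<in> borel_measurable (scale_measure (ennreal c) \<rho>)"
      using f that by (simp_all cong: measurable_cong_sets)
    show ?thesis using fm c by (simp add: integral_eq_nn_integral nn_integral_scale_measure enn2real_mult)
  qed
  show ?thesis
    unfolding kernel_signed_def m
    using signed_integral_eq[OF fin(1) _ fin(2) _ f f1] s c
      K.measure_bind_kernel(1)[OF \<mu> k F] K.measure_bind_kernel(1)[OF \<nu> k F]
    by (simp add: int measure_diff_def algebra_simps)
qed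

text \<open>Test the norm with the difference of the point masses at \<open>x\<close> and \<open>x'\<close>, whose total variation norm is \<open>1\<close>.
The supremum is an upper bound because all ratios are at most \<open>1\<close>.\<close>

lemma measure_le_kernel_norm:
  fixes A :: "'a::t1_space set"
  assumes k: "k \<in> measurable (borel_of_set A) (prob_algebra (borel_of_set A))"
    and x: "x \<in> space (borel_of_set A)" and x': "x' \<in> space (borel_of_set A)" and F: "F \<in> sets (borel_of_set A)"
  shows "measure (k x) F - measure (k x') F \<le> kernel_norm A k" "0 \<le> kernel_norm A k"
proof -
  let ?S = "borel_of_set A"
  let ?R = "{tv_norm ?S (kernel_signed ?S k m) / tv_norm ?S m | m. m \<in> signed_probs A \<and> m \<noteq> (\<lambda>F. 0)}"
  interpret K: kernel_perturbation ?S k k 0 1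
    by (rule kernel_perturbation_refl[OF k])
  have tv: "tv_norm ?S (kernel_signed ?S k (\<lambda>F. c * measure_diff \<mu> \<nu> F)) = c * excess ?S 1 (\<mu> \<bind> k) 1 (\<nu> \<bind> k)"
    if "\<mu> \<in> space (prob_algebra ?S)" "\<nu> \<in> space (prob_algebra ?S)" "0 \<le> c" for c \<mu> \<nu>
  proof -
    have "tv_norm ?S (kernel_signed ?S k (\<lambda>F. c * measure_diff \<mu> \<nu> F)) = tv_norm ?S (\<lambda>F. c * measure_diff (\<mu> \<bind> k) (\<nu> \<bind> k) F)"
      by (rule tv_norm_cong) (rule kernel_signed_scaled[OF that k])
    then show ?thesis using tv_norm_scaled_prob_diff[OF bind_in_prob_algebra[OF that(1) k] bind_in_prob_algebra[OF that(2) k] that(3)] by simp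
  qed
  have le1: "r \<le> 1" if r: "r \<in> ?R" for r
  proof -
    obtain \<beta> \<mu> \<nu> where m: "\<mu> \<in> space (prob_algebra ?S)" "\<nu> \<in> space (prob_algebra ?S)"
      "r = tv_norm ?S (kernel_signed ?S k (\<lambda>F. \<beta> * measure_diff \<mu> \<nu> F)) / tv_norm ?S (\<lambda>F. \<beta> * measure_diff \<mu> \<nu> F)"
      using r by (auto simp: signed_probs_def)
    \<comment> \<open>a negative factor exchanges the two measures\<close>
    have "\<exists>c \<mu>' \<nu>'. 0 \<le> c \<and> \<mu>' \<in> space (prob_algebra ?S) \<and> \<nu>' \<in> space (prob_algebra ?S) \<and>
        (\<lambda>F. \<beta> * measure_diff \<mu> \<nu> F) = (\<lambda>F. c * measure_diff \<mu>' \<nu>' F)"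
    proof (cases "0 \<le> \<beta>")
      case True
      then show ?thesis using m by blast
    next
      case False
      then have "(\<lambda>F. \<beta> * measure_diff \<mu> \<nu> F) = (\<lambda>F. - \<beta> * measure_diff \<nu> \<mu> F)"
        by (auto simp: measure_diff_def algebra_simps)
      then show ?thesis using m False by (intro exI[of _ "-\<beta>"]) auto
    qed
    then obtain c \<mu>' \<nu>' where c: "0 \<le> c" "\<mu>' \<in> space (prob_algebra ?S)" "\<nu>' \<in> space (prob_algebra ?S)"
      and eq: "(\<lambda>F. \<beta> * measure_diff \<mu> \<nu> F) = (\<lambda>F. c * measure_diff \<mu>' \<nu>' F)" by blast
    have "excess ?S 1 (\<mu>' \<bind> k) 1 (\<nu>' \<bind> k) \<le> excess ?S 1 \<mu>' 1 \<nu>'"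
      using K.excess_predict[OF c(2,3), of 1 1] by simp
    moreover have "0 \<le> excess ?S 1 \<mu>' 1 \<nu>'"
      using subprob_pair.excess_nonneg[OF prob_pair[OF c(2,3) zero_le_one zero_le_one]] .
    ultimately show ?thesis
      using c(1) unfolding m(3) eq tv[OF c(2,3,1)] tv_norm_scaled_prob_diff[OF c(2,3,1)]
      by (auto simp: divide_le_eq_1 mult_le_0_iff intro!: mult_left_mono)
  qed
  then have bdd: "bdd_above (insert 0 ?R)" by (intro bdd_aboveI[of _ 1]) auto
  show nn: "0 \<le> kernel_norm A k" unfolding kernel_norm_def using bdd by (intro cSup_upper) auto
  show "measure (k x) F - measure (k x') F \<le> kernel_norm A k"
  proof (cases "x = x'")
    case False
    let ?\<mu> = "return ?S x" and ?\<nu> = "return ?S x'"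
    have r: "?\<mu> \<in> space (prob_algebra ?S)" "?\<nu> \<in> space (prob_algebra ?S)"
      using prob_space_return[OF x] prob_space_return[OF x'] by (simp_all add: space_prob_algebra)
    have b: "?\<mu> \<bind> k = k x" "?\<nu> \<bind> k = k x'"
      using measurable_prob_algebraD[OF k] x x' by (auto intro!: bind_return)
    have kx: "k x \<in> space (prob_algebra ?S)" "k x' \<in> space (prob_algebra ?S)"
      using measurable_space[OF k] x x' by auto
    let ?m = "\<lambda>F. 1 * measure_diff ?\<mu> ?\<nu> F"
    have xs: "{x} \<in> sets ?S"
      using x by (auto simp: sets_restrict_space space_restrict_space intro!: image_eqI[of _ _ "{x}"])
    have d: "measure ?\<mu> {x} - measure ?\<nu> {x} = 1"
      using xs False by (simp add: measure_def)
    have "?m \<noteq> (\<lambda>F. 0)"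
    proof
      assume "?m = (\<lambda>F. 0)"
      from fun_cong[OF this, of "{x}"] d show False by (simp add: measure_diff_def)
    qed
    moreover have "?m \<in> signed_probs A" unfolding signed_probs_def using r by blast
    ultimately have "tv_norm ?S (kernel_signed ?S k ?m) / tv_norm ?S ?m \<in> ?R" by blast
    then have "tv_norm ?S (kernel_signed ?S k ?m) / tv_norm ?S ?m \<le> kernel_norm A k"
      unfolding kernel_norm_def using bdd by (intro cSup_upper) auto
    moreover have "tv_norm ?S (kernel_signed ?S k ?m) = excess ?S 1 (k x) 1 (k x')"
      using tv[OF r zero_le_one] by (simp add: b)
    moreover have "tv_norm ?S ?m = 1"
    proof -
      have "tv_norm ?S ?m = excess ?S 1 ?\<mu> 1 ?\<nu>" using tv_norm_scaled_prob_diff[OF r zero_le_one] by simp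
      moreover have "excess ?S 1 ?\<mu> 1 ?\<nu> \<le> 1"
        by (rule subprob_pair.excess_le[OF prob_pair[OF r zero_le_one zero_le_one]])
      moreover have "1 \<le> excess ?S 1 ?\<mu> 1 ?\<nu>" using excess_prob_upper[OF r xs] d by simp
      ultimately show ?thesis by simp
    qed
    ultimately show ?thesis using excess_prob_upper[OF kx F] by simp
  qed (use nn in simp)
qed

section \<open>Error of the misspecified filter\<close>

lemma (in likelihood) evidence_ratio_measurable:
  assumes p: "p \<in> measurable N (subprob_algebra S)" and q: "q \<in> measurable N (subprob_algebra S)"
  shows "(\<lambda>(w, y). evidence_ratio y (p w) (q w)) \<in> borel_measurable (N \<Otimes>\<^sub>M T)"
  using evidence_measurable[OF p] evidence_measurable[OF q]
  by (simp add: evidence_ratio_def case_prod_beta')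

context hidden_markov
begin

context
  fixes \<pi>h :: "'x measure" and Kh :: "nat \<Rightarrow> 'x \<Rightarrow> 'x measure"
  assumes mis: "state_space_model \<X> \<Y> \<pi>h Kh g"
begin

lemma Kh_meas: "1 \<le> t \<Longrightarrow> Kh t \<in> measurable SX (prob_algebra SX)"
  using mis by (auto simp: state_space_model_def)

lemma \<pi>h_prob: "\<pi>h \<in> space (prob_algebra SX)"
  using mis by (auto simp: state_space_model_def)

abbreviation prediction_mis :: "nat \<Rightarrow> 'w \<Rightarrow> 'x measure" where
  "prediction_mis t w \<equiv> filter_process Kh \<pi>h t w \<bind> Kh (Suc t)"

lemma filter_mis_meas: "filter_process Kh \<pi>h t \<in> measurable (obs_algebra t) (subprob_algebra SX)"
  by (rule filter_process_meas[OF Kh_meas \<pi>h_prob])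

lemma prediction_mis_meas: "prediction_mis t \<in> measurable (obs_algebra t) (subprob_algebra SX)"
  by (rule predict_process_meas[OF filter_mis_meas Kh_meas]) simp

definition observed_ratio :: "nat \<Rightarrow> 'w \<Rightarrow> real" where
  "observed_ratio t w = likelihood.evidence_ratio (g (Suc t)) (Y (Suc t) w) (prediction t w) (prediction_mis t w)"

lemma observed_ratio_nonneg: "0 \<le> observed_ratio t w"
proof -
  interpret L: likelihood T SX "g (Suc t)" by (rule likelihood_g) simp
  show ?thesis by (simp add: observed_ratio_def L.evidence_ratio_nonneg)
qed

lemma observed_ratio_meas: "observed_ratio t \<in> borel_measurable (obs_algebra (Suc t))"
proof -
  interpret L: likelihood T SX "g (Suc t)" by (rule likelihood_g) simp
  show ?thesis
    using measurable_compose[OF pair_obs L.evidence_ratio_measurable[OF prediction_meas prediction_mis_meas]]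
    unfolding observed_ratio_def by simp
qed

lemma nn_integral_observed_ratio:
  assumes a: "a \<in> borel_measurable (obs_algebra t)" 
  shows "(\<integral>\<^sup>+w. ennreal (a w) * ennreal (observed_ratio t w) \<partial>P) \<le> (\<integral>\<^sup>+w. ennreal (a w) \<partial>P)"
proof -
  interpret L: likelihood T SX "g (Suc t)" by (rule likelihood_g) simp
  let ?r = "\<lambda>w y. L.evidence_ratio y (prediction t w) (prediction_mis t w)"
  have r: "(\<lambda>z. ennreal (?r (fst z) (snd z))) \<in> borel_measurable (obs_algebra t \<Otimes>\<^sub>M T)"
    using L.evidence_ratio_measurable[OF prediction_meas prediction_mis_meas] by (simp add: case_prod_beta')
  have \<phi>: "(\<lambda>z. ennreal (a (fst z)) * ennreal (?r (fst z) (snd z))) \<in> borel_measurable (obs_algebra t \<Otimes>\<^sub>M T)"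
  proof -
    note r[measurable] a[measurable]
    show ?thesis by measurable
  qed
  have "(\<integral>\<^sup>+w. ennreal (a w) * ennreal (observed_ratio t w) \<partial>P)
    = (\<integral>\<^sup>+w. (\<integral>\<^sup>+y. ennreal (a w) * ennreal (?r w y) * evidence (Suc t) y (prediction t w) \<partial>T) \<partial>P)"
    using disintegration[OF \<phi>] by (simp add: observed_ratio_def)
  also have "\<dots> \<le> (\<integral>\<^sup>+w. ennreal (a w) \<partial>P)"
  proof (rule nn_integral_mono)
    fix w assume w: "w \<in> space P"
    then have w': "w \<in> space (obs_algebra t)" by simp
    have pq: "prediction t w \<in> space (subprob_algebra SX)" "prediction_mis t w \<in> space (subprob_algebra SX)"
      using measurable_space[OF prediction_meas w'] measurable_space[OF prediction_mis_meas w'] by auto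
    have m: "(\<lambda>y. ennreal (?r w y) * evidence (Suc t) y (prediction t w)) \<in> borel_measurable T"
      using measurable_compose[OF measurable_Pair1'[OF w'] L.evidence_ratio_measurable[OF prediction_meas prediction_mis_meas]]
        measurable_compose[OF measurable_Pair1'[OF w'] L.evidence_measurable[OF prediction_meas]]
      by (intro borel_measurable_times_ennreal) auto
    have "(\<integral>\<^sup>+y. ennreal (a w) * ennreal (?r w y) * evidence (Suc t) y (prediction t w) \<partial>T)
      = ennreal (a w) * (\<integral>\<^sup>+y. ennreal (?r w y) * evidence (Suc t) y (prediction t w) \<partial>T)"
      using nn_integral_cmult[OF m, of "ennreal (a w)"] by (simp add: mult.assoc)
    also have "\<dots> \<le> ennreal (a w) * 1"
      by (intro mult_left_mono L.integral_evidence_ratio pq) simp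
    finally show "(\<integral>\<^sup>+y. ennreal (a w) * ennreal (?r w y) * evidence (Suc t) y (prediction t w) \<partial>T) \<le> ennreal (a w)" by simp
  qed
  finally show ?thesis .
qed

lemma nn_integral_excess_update:
  assumes a: "a \<in> borel_measurable (obs_algebra t)" and b: "b \<in> borel_measurable (obs_algebra t)"
    and a0: "\<And>w. w \<in> space P \<Longrightarrow> 0 \<le> a w" and b0: "\<And>w. w \<in> space P \<Longrightarrow> 0 \<le> b w"
  shows "(\<integral>\<^sup>+w. ennreal (excess SX (a w) (filter_process K \<pi> (Suc t) w) (b w * observed_ratio t w) (filter_process Kh \<pi>h (Suc t) w)) \<partial>P)
    \<le> (\<integral>\<^sup>+w. ennreal (excess SX (a w) (prediction t w) (b w) (prediction_mis t w)) \<partial>P)"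
proof -
  interpret L: likelihood T SX "g (Suc t)" by (rule likelihood_g) simp
  let ?r = "\<lambda>w y. L.evidence_ratio y (prediction t w) (prediction_mis t w)"
  let ?N = "obs_algebra t \<Otimes>\<^sub>M T"
  define \<phi> where "\<phi> z = ennreal (excess SX (a (fst z)) (bayes_update (g (Suc t) (snd z)) (prediction t (fst z)))
      (b (fst z) * ?r (fst z) (snd z)) (bayes_update (g (Suc t) (snd z)) (prediction_mis t (fst z))))" for z
  have r: "(\<lambda>z. ?r (fst z) (snd z)) \<in> borel_measurable ?N"
    using L.evidence_ratio_measurable[OF prediction_meas prediction_mis_meas] by (simp add: case_prod_beta')
  have ab: "(\<lambda>z. a (fst z)) \<in> borel_measurable ?N" "(\<lambda>z. b (fst z)) \<in> borel_measurable ?N"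
    using a b by measurable
  have \<phi>: "\<phi> \<in> borel_measurable ?N"
    unfolding \<phi>_def
  proof (intro measurable_compose[OF _ measurable_ennreal] measurable_excess[OF \<X>] borel_measurable_times ab r)
    show "(\<lambda>z. bayes_update (g (Suc t) (snd z)) (prediction t (fst z))) \<in> measurable ?N (subprob_algebra SX)"
      "(\<lambda>z. bayes_update (g (Suc t) (snd z)) (prediction_mis t (fst z))) \<in> measurable ?N (subprob_algebra SX)"
      using L.update_measurable[OF prediction_meas] L.update_measurable[OF prediction_mis_meas]
      by (simp_all add: case_prod_beta')
    show "0 \<le> a (fst z)" "0 \<le> b (fst z) * ?r (fst z) (snd z)" if "z \<in> space ?N" for z
      using that a0 b0 L.evidence_ratio_nonneg by (auto simp: space_pair_measure)
  qed
  have "(\<integral>\<^sup>+w. ennreal (excess SX (a w) (filter_process K \<pi> (Suc t) w) (b w * observed_ratio t w) (filter_process Kh \<pi>h (Suc t) w)) \<partial>P)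
     = (\<integral>\<^sup>+w. (\<integral>\<^sup>+y. \<phi> (w, y) * evidence (Suc t) y (prediction t w) \<partial>T) \<partial>P)"
    using disintegration[OF \<phi>] by (simp add: \<phi>_def filter_process_Suc observed_ratio_def)
  also have "\<dots> \<le> (\<integral>\<^sup>+w. ennreal (excess SX (a w) (prediction t w) (b w) (prediction_mis t w)) \<partial>P)"
  proof (rule nn_integral_mono)
    fix w assume w: "w \<in> space P"
    then have w': "w \<in> space (obs_algebra t)" by simp
    show "(\<integral>\<^sup>+y. \<phi> (w, y) * evidence (Suc t) y (prediction t w) \<partial>T) \<le> ennreal (excess SX (a w) (prediction t w) (b w) (prediction_mis t w))"
      unfolding \<phi>_def fst_conv snd_conv
      by (intro L.integral_excess_update measurable_space[OF prediction_meas w'] measurable_space[OF prediction_mis_meas w'] a0 b0 w)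
  qed
  finally show ?thesis .
qed

text \<open>The kernel norm is cut off at \<open>1\<close>; both \<open>1\<close> and the norm bound the oscillation of the kernel.\<close>

lemma perturbed_filter_pair:
  assumes sm: "summable (\<lambda>t. kernel_dist \<X> (K (Suc t)) (Kh (Suc t)))"
    and c: "c < 1" "\<exists>\<^sub>\<infinity>t. kernel_norm \<X> (K (Suc t)) \<le> c"
  shows "perturbed_filter_pair P obs_algebra \<X> (filter_process K \<pi>) (filter_process Kh \<pi>h)
    (\<lambda>t. K (Suc t)) (\<lambda>t. Kh (Suc t)) observed_ratio (\<lambda>t. kernel_dist \<X> (K (Suc t)) (Kh (Suc t)))
    (\<lambda>t. min 1 (kernel_norm \<X> (K (Suc t)))) c"
proof unfold_locales
  show "\<X> \<in> sets borel" by (rule \<X>)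
  show "space (obs_algebra t) = space P" "sets (obs_algebra t) \<subseteq> events"
    "sets (obs_algebra t) \<subseteq> sets (obs_algebra (Suc t))" for t
    by (rule space_obs, rule sets_obs_events, rule obs_mono)
  show "filter_process K \<pi> t \<in> measurable (obs_algebra t) (subprob_algebra SX)"
    "filter_process Kh \<pi>h t \<in> measurable (obs_algebra t) (subprob_algebra SX)" for t
    by (rule filter_meas, rule filter_mis_meas)
  have "AE w in P. filter_process K \<pi> t w \<in> space (prob_algebra SX)"
    "AE w in P. filter_process Kh \<pi>h t w \<in> space (prob_algebra SX)" for t
    using filter_process_prob[of K \<pi> t] filter_process_prob[of Kh \<pi>h t] K_meas \<pi>_prob Kh_meas \<pi>h_prob by blast+
  then show "AE w in P. filter_process K \<pi> t w \<in> space (prob_algebra SX) \<and> filter_process Kh \<pi>h t w \<in> space (prob_algebra SX)" for t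
    by (intro AE_conjI)
  show "observed_ratio t \<in> borel_measurable (obs_algebra (Suc t))" "0 \<le> observed_ratio t w" for t w
    by (rule observed_ratio_meas, rule observed_ratio_nonneg)
  have ne: "space SX \<noteq> {}" using not_empty measurable_space[OF X_meas] by blast
  fix t :: nat
  have K: "K (Suc t) \<in> measurable SX (prob_algebra SX)" and Kh: "Kh (Suc t) \<in> measurable SX (prob_algebra SX)"
    by (rule K_meas, simp, rule Kh_meas, simp)
  interpret L: likelihood T SX "g (Suc t)" by (rule likelihood_g) simp
  interpret KK: kernel_perturbation SX "K (Suc t)" "K (Suc t)" 0 1 by (rule kernel_perturbation_refl[OF K])
  show "K (Suc t) \<in> measurable SX (prob_algebra SX)" "Kh (Suc t) \<in> measurable SX (prob_algebra SX)" by fact+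
  show "\<bar>measure (K (Suc t) x) F - measure (Kh (Suc t) x) F\<bar> \<le> kernel_dist \<X> (K (Suc t)) (Kh (Suc t))"
    if "x \<in> space SX" "F \<in> sets SX" for x F by (rule measure_le_kernel_dist[OF K Kh that])
  show "measure (K (Suc t) x) F - measure (K (Suc t) x') F \<le> min 1 (kernel_norm \<X> (K (Suc t)))"
    if "x \<in> space SX" "x' \<in> space SX" "F \<in> sets SX" for x x' F
    using measure_le_kernel_norm(1)[OF K that] KK.\<kappa>[OF that] by simp
  show "0 \<le> min 1 (kernel_norm \<X> (K (Suc t)))" "min 1 (kernel_norm \<X> (K (Suc t))) \<le> 1"
    using measure_le_kernel_norm(2)[OF K _ _ sets.top] ne by auto
  show "summable (\<lambda>t. kernel_dist \<X> (K (Suc t)) (Kh (Suc t)))" by (rule sm)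
  show "c < 1" by (rule c)
  show "\<exists>\<^sub>\<infinity>t. min 1 (kernel_norm \<X> (K (Suc t))) \<le> c"
    using c(2) by (rule INFM_mono) simp
  fix a :: "'w \<Rightarrow> real"
  assume a: "a \<in> borel_measurable (obs_algebra t)" and a0: "\<And>w. w \<in> space P \<Longrightarrow> 0 \<le> a w" and ia: "integrable P a"
  have na: "(\<integral>\<^sup>+w. ennreal (a w) \<partial>P) = ennreal (\<integral>w. a w \<partial>P)" 
    using ia a0 by (intro nn_integral_eq_integral AE_I2) auto
  have Ea: "0 \<le> (\<integral>w. a w \<partial>P)" using a0 by (intro integral_nonneg_AE AE_I2)
  show "integrable P (\<lambda>w. a w * observed_ratio t w) \<and> (\<integral>w. a w * observed_ratio t w \<partial>P) \<le> (\<integral>w. a w \<partial>P)"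
  proof
    have m: "(\<lambda>w. a w * observed_ratio t w) \<in> borel_measurable P"
      using measurable_from_subalg[OF subalg a] measurable_from_subalg[OF subalg observed_ratio_meas[of t]] by simp
    have nn: "0 \<le> a w * observed_ratio t w" if "w \<in> space P" for w using a0[OF that] observed_ratio_nonneg by simp
    have "(\<integral>\<^sup>+w. ennreal (a w * observed_ratio t w) \<partial>P) = (\<integral>\<^sup>+w. ennreal (a w) * ennreal (observed_ratio t w) \<partial>P)"
      using a0 observed_ratio_nonneg by (intro nn_integral_cong) (simp add: ennreal_mult)
    then have le: "(\<integral>\<^sup>+w. ennreal (a w * observed_ratio t w) \<partial>P) \<le> ennreal (\<integral>w. a w \<partial>P)"
      using nn_integral_observed_ratio[OF a] na by simp
    then show "integrable P (\<lambda>w. a w * observed_ratio t w)"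
      using m nn by (intro integrableI_nonneg AE_I2) (auto intro: le_less_trans)
    show "(\<integral>w. a w * observed_ratio t w \<partial>P) \<le> (\<integral>w. a w \<partial>P)"
      using enn2real_mono[OF le] Ea m nn by (subst integral_eq_nn_integral) auto
  qed
  fix b :: "'w \<Rightarrow> real"
  assume b: "b \<in> borel_measurable (obs_algebra t)" and b0: "\<And>w. w \<in> space P \<Longrightarrow> 0 \<le> b w"
  let ?E1 = "\<lambda>w. excess SX (a w) (filter_process K \<pi> (Suc t) w) (b w * observed_ratio t w) (filter_process Kh \<pi>h (Suc t) w)"
  let ?E0 = "\<lambda>w. excess SX (a w) (prediction t w) (b w) (prediction_mis t w)"
  have p0: "subprob_pair SX (prediction t w) (prediction_mis t w) (a w) (b w)" if "w \<in> space P" for w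
    using that a0 b0 measurable_space[OF prediction_meas, of w t] measurable_space[OF prediction_mis_meas, of w t]
    by unfold_locales auto
  have p1: "subprob_pair SX (filter_process K \<pi> (Suc t) w) (filter_process Kh \<pi>h (Suc t) w) (a w) (b w * observed_ratio t w)" if "w \<in> space P" for w
    using that a0 b0 measurable_space[OF filter_meas, of w "Suc t"] measurable_space[OF filter_mis_meas, of w "Suc t"] observed_ratio_nonneg
    by unfold_locales auto
  have m0: "?E0 \<in> borel_measurable P"
    using a b a0 b0 by (intro measurable_from_subalg[OF subalg[of t]] measurable_excess[OF \<X> prediction_meas prediction_mis_meas]) auto
  have m1: "?E1 \<in> borel_measurable P"
    using a b a0 b0 observed_ratio_nonneg
      measurable_from_subalg[OF subalg a] measurable_from_subalg[OF subalg b] measurable_from_subalg[OF subalg observed_ratio_meas[of t]]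
      measurable_from_subalg[OF subalg filter_meas[of "Suc t"]] measurable_from_subalg[OF subalg filter_mis_meas[of "Suc t"]]
    by (intro measurable_excess[OF \<X>]) auto
  have i0: "integrable P ?E0"
    using subprob_pair.excess_nonneg[OF p0] subprob_pair.excess_le[OF p0] a0
    by (intro Bochner_Integration.integrable_bound[OF ia m0] AE_I2) auto
  have "(\<integral>\<^sup>+w. ennreal (?E1 w) \<partial>P) \<le> ennreal (\<integral>w. ?E0 w \<partial>P)"
    using nn_integral_excess_update[OF a b a0 b0] nn_integral_eq_integral[OF i0] subprob_pair.excess_nonneg[OF p0] by simp
  from enn2real_mono[OF this] show "(\<integral>w. ?E1 w \<partial>P) \<le> (\<integral>w. ?E0 w \<partial>P)"
    using subprob_pair.excess_nonneg[OF p0] subprob_pair.excess_nonneg[OF p1] m1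
    by (subst integral_eq_nn_integral) (auto intro!: integral_nonneg_AE)
qed

end

end

lemma (in prob_space) variance_tendsto_0:
  assumes f: "\<And>t. f t \<in> borel_measurable M" "\<And>t w. w \<in> space M \<Longrightarrow> 0 \<le> f t w" "\<And>t w. w \<in> space M \<Longrightarrow> f t w \<le> 1"
    and lim: "(\<lambda>t. expectation (f t)) \<longlonglongrightarrow> (0::real)"
  shows "integrable M (\<lambda>w. (f t w)\<^sup>2)" "(\<lambda>t. variance (f t)) \<longlonglongrightarrow> 0"
proof -
  have sq: "(f t w)\<^sup>2 \<le> f t w" if "w \<in> space M" for t w
    using f(2,3)[OF that] by (simp add: power2_eq_square mult_left_le)
  have i: "integrable M (f t)" for t
    using f by (intro integrable_const_bound[where B=1] AE_I2) auto
  show i2: "integrable M (\<lambda>w. (f t w)\<^sup>2)" for t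
    using f(1) order_trans[OF sq f(3)] by (intro integrable_const_bound[where B=1] AE_I2) auto
  show "(\<lambda>t. variance (f t)) \<longlonglongrightarrow> 0"
  proof (rule tendsto_sandwich[OF _ _ tendsto_const lim])
    show "eventually (\<lambda>t. 0 \<le> variance (f t)) sequentially"
      by (intro always_eventually allI integral_nonneg_AE AE_I2) simp
    have "variance (f t) \<le> expectation (f t)" for t
    proof -
      have "variance (f t) = expectation (\<lambda>w. (f t w)\<^sup>2) - (expectation (f t))\<^sup>2"
        by (rule variance_eq[OF i i2])
      also have "\<dots> \<le> expectation (\<lambda>w. (f t w)\<^sup>2)" by simp
      also have "\<dots> \<le> expectation (f t)" using i i2 sq by (intro integral_mono_AE AE_I2) auto
      finally show ?thesis .
    qed
    then show "eventually (\<lambda>t. variance (f t) \<le> expectation (f t)) sequentially"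
      by (intro always_eventually allI)
  qed
qed

theorem theorem4p9:
  fixes P :: "'w measure"
    and \<X> :: "'x::euclidean_space set" and \<Y> :: "'y::euclidean_space set"
    and \<pi>\<^sub>0 \<pi>h\<^sub>0 :: "'x measure"
    and K Kh :: "nat \<Rightarrow> 'x \<Rightarrow> 'x measure"
    and g :: "nat \<Rightarrow> 'y \<Rightarrow> 'x \<Rightarrow> real"
    and X :: "nat \<Rightarrow> 'w \<Rightarrow> 'x" and Y :: "nat \<Rightarrow> 'w \<Rightarrow> 'y"
    and \<tau> :: "nat \<Rightarrow> nat" and \<kappa> :: real
    and Eh :: "nat \<Rightarrow> 'w \<Rightarrow> real"
  defines "Eh \<equiv> (\<lambda>t \<omega>. filter_error \<X> g \<pi>\<^sub>0 K \<pi>h\<^sub>0 Kh (\<lambda>s. Y s \<omega>) t)"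
  assumes "prob_space P"
    and "\<X> \<in> sets borel" and "\<Y> \<in> sets borel"
    and "state_space_model \<X> \<Y> \<pi>\<^sub>0 K g"
    and "state_space_model \<X> \<Y> \<pi>h\<^sub>0 Kh g"
    and "generated_by_model P \<X> \<Y> \<pi>\<^sub>0 K g X Y"
    and "summable (\<lambda>t. kernel_dist \<X> (K (Suc t)) (Kh (Suc t)))"
    and "strict_mono \<tau>" and "\<And>j. 1 \<le> \<tau> j"
    and "(\<lambda>j. kernel_norm \<X> (K (\<tau> j))) \<longlonglongrightarrow> \<kappa>" and "\<kappa> < 1"
  shows "(AE \<omega> in P. (\<lambda>t. Eh t \<omega>) \<longlonglongrightarrow> 0)
    \<and> ((\<forall>t. integrable P (Eh t)) \<and> (\<lambda>t. prob_space.expectation P (\<lambda>\<omega>. \<bar>Eh t \<omega> - 0\<bar>)) \<longlonglongrightarrow> 0)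
    \<and> ((\<forall>t. integrable P (\<lambda>\<omega>. (Eh t \<omega>)\<^sup>2)) \<and> (\<lambda>t. prob_space.variance P (Eh t)) \<longlonglongrightarrow> 0)"
proof -
  interpret hidden_markov P \<X> \<Y> \<pi>\<^sub>0 K g X Y
    by (intro hidden_markov.intro hidden_markov_axioms.intro) fact+
  note mis = \<open>state_space_model \<X> \<Y> \<pi>h\<^sub>0 Kh g\<close>
  let ?\<mu> = "filter_process K \<pi>\<^sub>0" and ?\<nu> = "filter_process Kh \<pi>h\<^sub>0"
  define c where "c = (\<kappa> + 1) / 2"
  have c: "c < 1" "\<kappa> < c" using \<open>\<kappa> < 1\<close> by (auto simp: c_def)
  have inf: "\<exists>\<^sub>\<infinity>t. kernel_norm \<X> (K (Suc t)) \<le> c"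
    unfolding INFM_nat_le
  proof
    fix m
    have "eventually (\<lambda>j. kernel_norm \<X> (K (\<tau> j)) < c) sequentially"
      using \<open>(\<lambda>j. kernel_norm \<X> (K (\<tau> j))) \<longlonglongrightarrow> \<kappa>\<close> c(2) by (rule order_tendstoD)
    then obtain J where J: "\<And>j. j \<ge> J \<Longrightarrow> kernel_norm \<X> (K (\<tau> j)) < c" by (auto simp: eventually_sequentially)
    \<comment> \<open>the kernel of time \<open>\<tau> j\<close> acts in the step from \<open>\<tau> j - 1\<close>\<close>
    let ?j = "max J (Suc m)"
    have "?j \<le> \<tau> ?j" by (rule strict_mono_imp_increasing) fact
    then have "m \<le> \<tau> ?j - 1" "Suc (\<tau> ?j - 1) = \<tau> ?j" by auto
    then show "\<exists>t\<ge>m. kernel_norm \<X> (K (Suc t)) \<le> c"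
      using J[of ?j] by (intro exI[of _ "\<tau> ?j - 1"]) auto
  qed
  interpret F: perturbed_filter_pair P obs_algebra \<X> ?\<mu> ?\<nu> "\<lambda>t. K (Suc t)" "\<lambda>t. Kh (Suc t)" "observed_ratio \<pi>h\<^sub>0 Kh"
     "\<lambda>t. kernel_dist \<X> (K (Suc t)) (Kh (Suc t))" "\<lambda>t. min 1 (kernel_norm \<X> (K (Suc t)))" c
    by (rule perturbed_filter_pair[OF mis _ c(1) inf]) fact
  have Eh: "Eh t w = (excess SX 1 (?\<mu> t w) 1 (?\<nu> t w) + excess SX 1 (?\<nu> t w) 1 (?\<mu> t w)) / 2" for t w
    using tv_norm_eq_excess[of SX 1] by (simp add: Eh_def filter_error_def filter_process_def)
  have swap: "subprob_pair SX (?\<nu> t w) (?\<mu> t w) 1 1" if "w \<in> space P" for t w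
    using F.pair[OF that, of 1 1 t] by (auto simp: subprob_pair_def)
  have Eh_bounds: "0 \<le> Eh t w" "Eh t w \<le> 1" if "w \<in> space P" for t w
    using F.err_bounds[OF that, of t] subprob_pair.excess_nonneg[OF swap[OF that, of t]] subprob_pair.excess_le[OF swap[OF that, of t]]
    unfolding Eh by auto
  have Eh_meas: "Eh t \<in> borel_measurable P" for t
  proof -
    have "(\<lambda>w. excess SX 1 (?\<nu> t w) 1 (?\<mu> t w)) \<in> borel_measurable P"
      by (rule F.meas_P[OF measurable_excess[OF \<open>\<X> \<in> sets borel\<close> F.\<nu> F.\<mu>]]) auto
    moreover have "(\<lambda>w. excess SX 1 (?\<mu> t w) 1 (?\<nu> t w)) \<in> borel_measurable P"
      by (rule F.meas_P[OF F.err_meas])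
    ultimately show ?thesis unfolding Eh[abs_def] by simp
  qed
  have Eh_err: "AE w in P. \<forall>t. Eh t w = F.err t w"
    unfolding AE_all_countable
  proof
    show "AE w in P. Eh t w = F.err t w" for t
      using F.prob[of t] by eventually_elim (simp add: Eh excess_commute)
  qed
  have as: "AE w in P. (\<lambda>t. Eh t w) \<longlonglongrightarrow> 0"
    using F.err_AE Eh_err by eventually_elim simp
  have "expectation (Eh t) = expectation (F.err t)" for t
    using Eh_err by (intro integral_cong_AE Eh_meas F.meas_P[OF F.err_meas]) auto
  then have L1: "(\<lambda>t. expectation (Eh t)) \<longlonglongrightarrow> 0" using F.err_L1 by simp
  have int: "integrable P (Eh t)" for t
    using Eh_bounds by (intro integrable_const_bound[where B=1] AE_I2 Eh_meas) auto
  have "expectation (\<lambda>w. \<bar>Eh t w - 0\<bar>) = expectation (Eh t)" for t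
    using Eh_bounds by (intro Bochner_Integration.integral_cong) auto
  then have L1': "(\<lambda>t. expectation (\<lambda>w. \<bar>Eh t w - 0\<bar>)) \<longlonglongrightarrow> 0" using L1 by simp
  show ?thesis
    using as int L1' variance_tendsto_0[OF Eh_meas Eh_bounds L1] by blast
qed

end
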